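(* Let $T(s)\in\mathcal{F}_\infty^{m\times m}$, and let $\mathbf{T}_{T(s)}:\mathcal{D}_{\mathbf{T}_{T(s)}}\subseteq\mathcal{L}_2^m\to\mathcal{L}_2^m$ be the maximal operator associated with $T(s)$. Suppose that $\mathbf{T}_{T(s)}$ is causally extendible, and for $\tau>0$ let $\mathbf{T}_{T(s)}^\tau$ be the truncation of $\mathbf{T}_{T(s)}$ to $\mathcal{L}_{2,\tau}^m$. Then $$\lim_{\tau\to\infty}\bar\sigma(\mathbf{T}_{T(s)}^\tau)=\sup_{\mathrm{Re}\,s>0}\bar\sigma(T(s)),\qquad \lim_{\tau\to\infty}\underline{\sigma}(\mathbf{T}_{T(s)}^\tau)=\inf_{\mathrm{Re}\,s>0}\underline{\sigma}(T(s)).$$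
   Context: $\mathcal{L}_2^m$ is the Hilbert space of square-integrable functions $[0,\infty)\to\mathbb{C}^m$ with $\langle u,y\rangle=\int_0^\infty u(t)^*y(t)\,dt$. For $\tau>0$, $\mathcal{L}_{2,\tau}^m\subseteq\mathcal{L}_2^m$ is the closed subspace of functions vanishing on $[\tau,\infty)$, and $\mathbf{P}_\tau:\mathcal{L}_2^m\to\mathcal{L}_{2,\tau}^m$ is the truncation ($\mathbf{P}_\tau f=f$ on $[0,\tau]$ and $0$ for $t>\tau$). $\mathcal{H}_2^m$ is the $\mathbb{C}^m$-valued Hardy space of the open right half-plane and $\mathcal{H}_\infty^{p\times q}$ the space of bounded analytic $p\times q$ matrix functions on the open right half-plane. The Fourier (Laplace) transform $u\mapsto\hat u$ is a Hilbert space isomorphism $\mathcal{L}_2^m\to\mathcal{H}_2^m$ (with norm on $\mathcal{H}_2^m$ given by $\sup_{\sigma>0}(\frac1{2\pi}\int|\hat f(\sigma+i\omega)|^2d\omega)^{1/2}$). $\mathcal{F}_\infty^{m\times m}$ denotes the quotient field over $\mathcal{H}_\infty^{m\times m}$: the transfer functions $T$ that can be written $T=NM^{-1}$ with $\begin{pmatrix}M\\N\end{pmatrix}\in\mathcal{H}_\infty^{2m\times m}$ (with $M$ invertible, i.e. $\det M\not\equiv0$). Such $T$ is meromorphic on the open right half-plane; the supremum and infimum over $\mathrm{Re}\,s>0$ are taken over points at which $T$ is defined (not poles). For a linear operator $\mathbf{T}:\mathcal{D}_{\mathbf{T}}\subseteq\mathcal{L}_2^m\to\mathcal{L}_2^m$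 with graph $\mathcal{G}_{\mathbf{T}}=\{(u,\mathbf{T}u):u\in\mathcal{D}_{\mathbf{T}}\}$, let $\hat{\mathbf{T}}$ be the corresponding operator on $\mathcal{H}_2^m$, i.e. $\hat{\mathbf{T}}\hat u=\widehat{\mathbf{T}u}$. Write $\mathbf{T}_1\preceq\mathbf{T}_2$ if $\mathcal{G}_{\mathbf{T}_1}\subseteq\mathcal{G}_{\mathbf{T}_2}$. Given $T\in\mathcal{F}_\infty^{m\times m}$, let $$\mathcal{T}=\left\{\mathbf{T}:\mathcal{G}_{\hat{\mathbf{T}}}=\begin{pmatrix}M\\N\end{pmatrix}\mathcal{H}_2^m,\ \begin{pmatrix}M\\N\end{pmatrix}\in\mathcal{H}_\infty^{2m\times m},\ T=NM^{-1}\right\}.$$ The maximal operator $\mathbf{T}_{T(s)}$ is the maximum element of $\mathcal{T}$ with respect to $\preceq$. It is a known result (Georgiou and Smith) that for every $T\in\mathcal{F}_\infty^{m\times m}$ this maximum exists and is a closed operator. An operator $\mathbf{T}:\mathcal{D}_{\mathbf{T}}\subseteq\mathcal{L}_2^m\to\mathcal{L}_2^m$ is causal if, for every $\tau>0$ and $u\in\mathcal{D}_{\mathbf{T}}$, $\mathbf{P}_\tau\mathbf{T}u$ depends only on $\mathbf{P}_\tau u$ (i.e. $u_1,u_2\in\mathcal{D}_{\mathbf{T}}$ and $\mathbf{P}_\tau u_1=\mathbf{P}_\tau u_2$ imply $\mathbf{P}_\tau\mathbf{T}u_1=\mathbf{P}_\tau\mathbf{T}u_2$). It is causally extendible if it is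 causal and $\mathbf{P}_\tau\mathcal{D}_{\mathbf{T}}=\mathcal{L}_{2,\tau}^m$ for all $\tau>0$. For causally extendible $\mathbf{T}_{T(s)}$, the truncation $\mathbf{T}_{T(s)}^\tau$ (written $\mathbf{P}_\tau\mathbf{T}_{T(s)}\mathbf{P}_\tau$) is the operator $\mathcal{L}_{2,\tau}^m\to\mathcal{L}_{2,\tau}^m$ with graph $\mathbf{P}_\tau\mathcal{G}_{\mathbf{T}_{T(s)}}$, i.e. $\mathbf{T}_{T(s)}^\tau\mathbf{P}_\tau u=\mathbf{P}_\tau\mathbf{T}_{T(s)}u$ for $u\in\mathcal{D}_{\mathbf{T}_{T(s)}}$. For an operator $\mathbf{T}$, $\bar\sigma(\mathbf{T})=\sup_{0\ne u\in\mathcal{D}_{\mathbf{T}}}\|\mathbf{T}u\|/\|u\|$ and $\underline{\sigma}(\mathbf{T})=\inf_{0\ne u\in\mathcal{D}_{\mathbf{T}}}\|\mathbf{T}u\|/\|u\|$ (values in $[0,\infty]$). For a complex matrix, $\bar\sigma$ and $\underline{\sigma}$ are the largest and smallest singular values. *)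

theory Defs
  imports "HOL-Complex_Analysis.Complex_Analysis"
begin

section \<open>The Hilbert space of square-integrable functions on the half-line\<close>

abbreviation halfline :: "real measure" where
  "halfline \<equiv> lebesgue_on {0..}"

definition square_integrable :: "(real \<Rightarrow> complex ^ 'm) \<Rightarrow> bool" where
  "square_integrable f \<longleftrightarrow>
     f \<in> borel_measurable halfline \<and> integrable halfline (\<lambda>t. (norm (f t))\<^sup>2)"

definition L2_eq :: "(real \<Rightarrow> complex ^ 'm) \<Rightarrow> (real \<Rightarrow> complex ^ 'm) \<Rightarrow> bool" where
  "L2_eq f g \<longleftrightarrow>
     square_integrable f \<and> square_integrable g \<and> (AE t in halfline. f t = g t)"

lemma square_integrable_zero: "square_integrable (\<lambda>t. 0)"
  by (simp add: square_integrable_def)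

lemma borel_measurable_vec_cscale [measurable (raw)]:
  fixes f :: "'a \<Rightarrow> complex ^ 'm"
  assumes "f \<in> borel_measurable M"
  shows "(\<lambda>x. c *s f x) \<in> borel_measurable M"
proof -
  have "continuous_on UNIV (\<lambda>v :: complex ^ 'm. c *s v)"
    unfolding vector_scalar_mult_def by (intro continuous_intros)
  then show ?thesis
    using assms by (rule borel_measurable_continuous_on)
qed

lemma norm_vec_cscale: "norm (c *s v) = norm c * norm v" for c :: complex and v :: "complex ^ 'm"
  by (simp add: norm_vec_def norm_mult L2_set_right_distrib)

lemma square_integrable_add:
  assumes "square_integrable f" "square_integrable g"
  shows "square_integrable (\<lambda>t. f t + g t)"
proof -
  have [measurable]: "f \<in> borel_measurable halfline" "g \<in> borel_measurable halfline"
    using assms by (simp_all add: square_integrable_def)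
  have "integrable halfline (\<lambda>t. (norm (f t + g t))\<^sup>2)"
  proof (rule Bochner_Integration.integrable_bound)
    show "integrable halfline (\<lambda>t. 2 * ((norm (f t))\<^sup>2 + (norm (g t))\<^sup>2))"
      using assms by (simp add: square_integrable_def)
    have "(norm (f t + g t))\<^sup>2 \<le> 2 * ((norm (f t))\<^sup>2 + (norm (g t))\<^sup>2)" for t
    proof -
      have "(norm (f t + g t))\<^sup>2 \<le> (norm (f t) + norm (g t))\<^sup>2"
        by (intro power_mono norm_triangle_ineq) simp
      also have "\<dots> \<le> 2 * ((norm (f t))\<^sup>2 + (norm (g t))\<^sup>2)"
        using sum_squares_bound[of "norm (f t)" "norm (g t)"] by (simp add: power2_sum)
      finally show ?thesis .
    qed
    then show "AE t in halfline. norm ((norm (f t + g t))\<^sup>2)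
        \<le> norm (2 * ((norm (f t))\<^sup>2 + (norm (g t))\<^sup>2))"
      by simp
  qed measurable
  then show ?thesis by (simp add: square_integrable_def)
qed

lemma square_integrable_cscale:
  "square_integrable f \<Longrightarrow> square_integrable (\<lambda>t. c *s f t)"
  by (auto simp: square_integrable_def norm_vec_cscale power_mult_distrib)

lemma square_integrable_scaleR:
  "square_integrable f \<Longrightarrow> square_integrable (\<lambda>t. r *\<^sub>R f t)"
  by (auto simp: square_integrable_def power_mult_distrib)

lemma square_integrable_minus:
  "square_integrable f \<Longrightarrow> square_integrable (\<lambda>t. - f t)"
  by (auto simp: square_integrable_def)

lemma square_integrable_diff:
  "square_integrable f \<Longrightarrow> square_integrable g \<Longrightarrow> square_integrable (\<lambda>t. f t - g t)"
  using square_integrable_add[of f "\<lambda>t. - g t"] square_integrable_minus[of g] by simp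

lemma square_integrable_truncate:
  assumes "square_integrable f"
  shows "square_integrable (\<lambda>t. if t \<le> \<tau> then f t else 0)"
proof -
  have [measurable]: "f \<in> borel_measurable halfline"
    using assms by (simp add: square_integrable_def)
  have [measurable]: "(\<lambda>t. t) \<in> borel_measurable halfline"
    by (intro continuous_imp_measurable_on_sets_lebesgue continuous_intros) simp
  have m: "(\<lambda>t. if t \<le> \<tau> then f t else 0) \<in> borel_measurable halfline"
    by measurable
  have "integrable halfline (\<lambda>t. (norm (if t \<le> \<tau> then f t else 0))\<^sup>2)"
    by (rule Bochner_Integration.integrable_bound[where f = "\<lambda>t. (norm (f t))\<^sup>2"])
       (use assms m in \<open>auto simp: square_integrable_def\<close>)
  with m show ?thesis by (simp add: square_integrable_def)
qed

lemma integrable_inner_square_integrable: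
  assumes "square_integrable f" "square_integrable g"
  shows "integrable halfline (\<lambda>t. f t \<bullet> g t)"
proof (rule Bochner_Integration.integrable_bound)
  have [measurable]: "f \<in> borel_measurable halfline" "g \<in> borel_measurable halfline"
    using assms by (simp_all add: square_integrable_def)
  show "(\<lambda>t. f t \<bullet> g t) \<in> borel_measurable halfline" by measurable
  show "integrable halfline (\<lambda>t. (norm (f t))\<^sup>2 + (norm (g t))\<^sup>2)"
    using assms by (simp add: square_integrable_def)
  have "\<bar>f t \<bullet> g t\<bar> \<le> (norm (f t))\<^sup>2 + (norm (g t))\<^sup>2" for t
    using Cauchy_Schwarz_ineq2[of "f t" "g t"] sum_squares_bound[of "norm (f t)" "norm (g t)"]
      zero_le_power2[of "norm (f t)"] zero_le_power2[of "norm (g t)"]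
    by linarith
  then show "AE t in halfline. norm (f t \<bullet> g t) \<le> norm ((norm (f t))\<^sup>2 + (norm (g t))\<^sup>2)"
    by simp
qed

quotient_type (overloaded) 'm L2 = "real \<Rightarrow> complex ^ 'm" / partial: L2_eq
proof (rule part_equivpI)
  show "\<exists>f. L2_eq f f"
    using square_integrable_zero by (auto simp: L2_eq_def)
  show "symp L2_eq"
    by (auto simp: symp_def L2_eq_def eq_commute)
  show "transp L2_eq"
    by (rule transpI) (auto simp: L2_eq_def elim: eventually_elim2)
qed

text \<open>
  The inner product of this instance is the real part of the complex inner product
  \<open>\<integral> u(t)\<^sup>* y(t) dt\<close>; both induce the same norm.
\<close>

instantiation L2 :: (finite) real_inner
begin

lift_definition zero_L2 :: "'a L2" is "\<lambda>t. 0"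
  by (simp add: L2_eq_def square_integrable_zero)

lift_definition plus_L2 :: "'a L2 \<Rightarrow> 'a L2 \<Rightarrow> 'a L2" is "\<lambda>f g t. f t + g t"
  by (auto simp: L2_eq_def square_integrable_add elim: eventually_elim2)

lift_definition minus_L2 :: "'a L2 \<Rightarrow> 'a L2 \<Rightarrow> 'a L2" is "\<lambda>f g t. f t - g t"
  by (auto simp: L2_eq_def square_integrable_diff elim: eventually_elim2)

lift_definition uminus_L2 :: "'a L2 \<Rightarrow> 'a L2" is "\<lambda>f t. - f t"
  by (auto simp: L2_eq_def square_integrable_minus elim: eventually_mono)

lift_definition scaleR_L2 :: "real \<Rightarrow> 'a L2 \<Rightarrow> 'a L2" is "\<lambda>r f t. r *\<^sub>R f t"
  by (auto simp: L2_eq_def square_integrable_scaleR elim: eventually_mono)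

lift_definition inner_L2 :: "'a L2 \<Rightarrow> 'a L2 \<Rightarrow> real" is
  "\<lambda>f g. integral\<^sup>L halfline (\<lambda>t. f t \<bullet> g t)"
proof (rule integral_cong_AE, goal_cases)
  case (1 f f' g g')
  then show ?case
    by (auto simp: L2_eq_def intro!: borel_measurable_integrable integrable_inner_square_integrable)
next
  case (2 f f' g g')
  then show ?case
    by (auto simp: L2_eq_def intro!: borel_measurable_integrable integrable_inner_square_integrable)
next
  case (3 f f' g g')
  then have "AE t in halfline. f t = f' t" "AE t in halfline. g t = g' t"
    by (auto simp: L2_eq_def)
  then show ?case by eventually_elim simp
qed

definition norm_L2 :: "'a L2 \<Rightarrow> real" where
  "norm_L2 u = sqrt (u \<bullet> u)"

definition sgn_L2 :: "'a L2 \<Rightarrow> 'a L2" where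
  "sgn_L2 u = inverse (norm u) *\<^sub>R u"

definition dist_L2 :: "'a L2 \<Rightarrow> 'a L2 \<Rightarrow> real" where
  "dist_L2 u v = norm (u - v)"

definition uniformity_L2 :: "('a L2 \<times> 'a L2) filter" where
  "uniformity_L2 = (INF e\<in>{0<..}. principal {(x, y). dist x y < e})"

definition open_L2 :: "'a L2 set \<Rightarrow> bool" where
  "open_L2 U \<longleftrightarrow> (\<forall>x\<in>U. \<forall>\<^sub>F (x', y) in uniformity. x' = x \<longrightarrow> y \<in> U)"

instance
proof
  fix u v w :: "'a L2" and r s :: real
  show "u + v + w = u + (v + w)"
    by transfer (auto simp: L2_eq_def add.assoc intro!: square_integrable_add)
  show "u + v = v + u"
    by transfer (auto simp: L2_eq_def add.commute intro!: square_integrable_add)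
  show "0 + u = u"
    by transfer (auto simp: L2_eq_def)
  show "- u + u = 0"
    by transfer (auto simp: L2_eq_def square_integrable_zero)
  show "u - v = u + - v"
    by transfer (auto simp: L2_eq_def square_integrable_diff)
  show "r *\<^sub>R (u + v) = r *\<^sub>R u + r *\<^sub>R v"
    by transfer (auto simp: L2_eq_def scaleR_add_right
        intro!: square_integrable_add square_integrable_scaleR)
  show "(r + s) *\<^sub>R u = r *\<^sub>R u + s *\<^sub>R u"
    by transfer (auto simp: L2_eq_def scaleR_add_left
        intro!: square_integrable_add square_integrable_scaleR)
  show "r *\<^sub>R s *\<^sub>R u = (r * s) *\<^sub>R u"
    by transfer (auto simp: L2_eq_def intro!: square_integrable_scaleR)
  show "1 *\<^sub>R u = u"
    by transfer (auto simp: L2_eq_def)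
  show "u \<bullet> v = v \<bullet> u"
    by transfer (simp add: inner_commute)
  show "(u + v) \<bullet> w = u \<bullet> w + v \<bullet> w"
    by transfer (simp add: L2_eq_def inner_add_left integrable_inner_square_integrable)
  show "(r *\<^sub>R u) \<bullet> v = r * (u \<bullet> v)"
    by transfer (simp add: L2_eq_def)
  show "0 \<le> u \<bullet> u"
    by transfer simp
  show "u \<bullet> u = 0 \<longleftrightarrow> u = 0"
  proof transfer
    fix f :: "real \<Rightarrow> complex ^ 'a"
    assume "L2_eq f f"
    then have f: "square_integrable f" by (simp add: L2_eq_def)
    then have "integral\<^sup>L halfline (\<lambda>t. f t \<bullet> f t) = 0 \<longleftrightarrow> (AE t in halfline. f t \<bullet> f t = 0)"
      by (intro integral_nonneg_eq_0_iff_AE integrable_inner_square_integrable) auto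
    with f show "integral\<^sup>L halfline (\<lambda>t. f t \<bullet> f t) = 0 \<longleftrightarrow> L2_eq f (\<lambda>t. 0)"
      by (simp add: L2_eq_def square_integrable_zero)
  qed
qed (simp_all only: norm_L2_def sgn_L2_def dist_L2_def uniformity_L2_def open_L2_def)

end

lift_definition cscale_L2 :: "complex \<Rightarrow> ('m::finite) L2 \<Rightarrow> 'm L2" is "\<lambda>c f t. c *s f t"
  by (auto simp: L2_eq_def square_integrable_cscale elim: eventually_mono)

lift_definition P_trunc :: "real \<Rightarrow> ('m::finite) L2 \<Rightarrow> 'm L2" is "\<lambda>\<tau> f t. if t \<le> \<tau> then f t else 0"
  by (auto simp: L2_eq_def square_integrable_truncate elim: eventually_mono)

lift_definition vanishes_from :: "real \<Rightarrow> ('m::finite) L2 \<Rightarrow> bool" is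
  "\<lambda>\<tau> f. AE t in halfline. \<tau> \<le> t \<longrightarrow> f t = 0"
  by (auto simp: L2_eq_def elim: eventually_elim2)

definition L2_upto :: "real \<Rightarrow> ('m::finite) L2 set" where
  "L2_upto \<tau> = {u. vanishes_from \<tau> u}"


section \<open>Hardy spaces of the right half-plane and the Laplace transform\<close>

definition rhp :: "complex set" where
  "rhp = {s. 0 < Re s}"

text \<open>
  Functions on the half-plane that take part in equations between functions (elements of
  \<open>H2\<close> and Laplace transforms) are extended by zero to the whole plane, so that equality
  of functions means equality on the half-plane.
\<close>

definition H2 :: "(complex \<Rightarrow> complex ^ 'm) set" where
  "H2 = {f. (\<forall>i. (\<lambda>s. f s $ i) holomorphic_on rhp) \<and>
            (SUP \<sigma>\<in>{0<..}. ennreal (1 / (2 * pi)) *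
               (\<integral>\<^sup>+ \<omega>. ennreal ((norm (f (Complex \<sigma> \<omega>)))\<^sup>2) \<partial>lborel)) < \<infinity> \<and>
            (\<forall>s. s \<notin> rhp \<longrightarrow> f s = 0)}"

definition Hinf :: "(complex \<Rightarrow> complex ^ 'q ^ 'p) set" where
  "Hinf = {F. (\<forall>i j. (\<lambda>s. F s $ i $ j) holomorphic_on rhp) \<and> bounded (F ` rhp)}"

lift_definition laplace :: "('m::finite) L2 \<Rightarrow> complex \<Rightarrow> complex ^ 'm" is
  "\<lambda>f s. if s \<in> rhp
         then (\<chi> i. integral\<^sup>L halfline (\<lambda>t. exp (- (s * of_real t)) * f t $ i)) else 0"
proof -
  fix f g :: "real \<Rightarrow> complex ^ 'm"
  assume fg: "L2_eq f g"
  then have [measurable]: "f \<in> borel_measurable halfline" "g \<in> borel_measurable halfline"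
    by (simp_all add: L2_eq_def square_integrable_def)
  have nth: "(\<lambda>v :: complex ^ 'm. v $ i) \<in> borel_measurable borel" for i
    by (intro borel_measurable_continuous_onI continuous_intros)
  have [measurable]: "(\<lambda>t. f t $ i) \<in> borel_measurable halfline"
      "(\<lambda>t. g t $ i) \<in> borel_measurable halfline" for i
    by (rule measurable_compose[OF _ nth], measurable)+
  have [measurable]: "(\<lambda>t. exp (- (s * of_real t))) \<in> borel_measurable halfline" for s :: complex
    by (intro continuous_imp_measurable_on_sets_lebesgue continuous_intros) simp
  have "integral\<^sup>L halfline (\<lambda>t. exp (- (s * of_real t)) * f t $ i) =
        integral\<^sup>L halfline (\<lambda>t. exp (- (s * of_real t)) * g t $ i)" for s i
    by (rule integral_cong_AE) (use fg in \<open>auto simp: L2_eq_def elim: eventually_mono\<close>)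
  then show "(\<lambda>s. if s \<in> rhp
         then (\<chi> i. integral\<^sup>L halfline (\<lambda>t. exp (- (s * of_real t)) * f t $ i)) else 0) =
       (\<lambda>s. if s \<in> rhp
         then (\<chi> i. integral\<^sup>L halfline (\<lambda>t. exp (- (s * of_real t)) * g t $ i)) else 0)"
    by (simp only:)
qed


section \<open>Transfer functions\<close>

text \<open>
  The relation \<open>T = N M\<^sup>-\<^sup>1\<close> between meromorphic matrix functions. The entries of a transfer
  function are in the normal form of \<^const>\<open>nicely_meromorphic_on\<close> (removable singularities
  removed, value 0 at poles), so its values at the points where \<open>det M\<close> vanishes are determined
  as well; points where some entry has a pole are excluded in \<open>regular_points\<close>.
\<close>

definition is_right_fraction ::
    "(complex \<Rightarrow> complex ^ 'm ^ 'm) \<Rightarrow> (complex \<Rightarrow> complex ^ 'm ^ 'm) \<Rightarrow>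
     (complex \<Rightarrow> complex ^ 'm ^ 'm) \<Rightarrow> bool" where
  "is_right_fraction T N M \<longleftrightarrow>
     M \<in> Hinf \<and> N \<in> Hinf \<and> (\<exists>s\<in>rhp. det (M s) \<noteq> 0) \<and>
     (\<forall>s\<in>rhp. det (M s) \<noteq> 0 \<longrightarrow> T s = N s ** matrix_inv (M s))"

definition Finf :: "(complex \<Rightarrow> complex ^ 'm ^ 'm) set" where
  "Finf = {T. (\<forall>i j. (\<lambda>s. T s $ i $ j) nicely_meromorphic_on rhp) \<and>
              (\<exists>N M. is_right_fraction T N M)}"

definition regular_points :: "(complex \<Rightarrow> complex ^ 'm ^ 'm) \<Rightarrow> complex set" where
  "regular_points T = {s \<in> rhp. \<forall>i j. \<not> is_pole (\<lambda>z. T z $ i $ j) s}"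


section \<open>Operators\<close>

text \<open>
  A partially defined operator \<open>\<D> \<subseteq> L2 \<rightarrow> L2\<close> is identified with its graph; its domain is
  \<^const>\<open>Domain\<close> of the graph, and the order on operators is inclusion.
\<close>

type_synonym 'm operator = "('m L2 \<times> 'm L2) set"

definition linear_operator :: "('m::finite) operator \<Rightarrow> bool" where
  "linear_operator G \<longleftrightarrow>
     single_valued G \<and> (0, 0) \<in> G \<and>
     (\<forall>(u, y)\<in>G. \<forall>(u', y')\<in>G. (u + u', y + y') \<in> G) \<and>
     (\<forall>c. \<forall>(u, y)\<in>G. (cscale_L2 c u, cscale_L2 c y) \<in> G)"

definition hat_graph ::
    "('m::finite) operator \<Rightarrow> ((complex \<Rightarrow> complex ^ 'm) \<times> (complex \<Rightarrow> complex ^ 'm)) set" where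
  "hat_graph G = (\<lambda>(u, y). (laplace u, laplace y)) ` G"

definition operators_of :: "(complex \<Rightarrow> complex ^ 'm ^ 'm) \<Rightarrow> ('m::finite) operator set" where
  "operators_of T =
     {G. linear_operator G \<and>
         (\<exists>N M. is_right_fraction T N M \<and>
                hat_graph G = (\<lambda>v. (\<lambda>s. M s *v v s, \<lambda>s. N s *v v s)) ` H2)}"

definition is_maximal_operator :: "(complex \<Rightarrow> complex ^ 'm ^ 'm) \<Rightarrow> ('m::finite) operator \<Rightarrow> bool" where
  "is_maximal_operator T G \<longleftrightarrow> G \<in> operators_of T \<and> (\<forall>G'\<in>operators_of T. G' \<subseteq> G)"

definition causal :: "('m::finite) operator \<Rightarrow> bool" where
  "causal G \<longleftrightarrow>
     (\<forall>\<tau>>0. \<forall>(u, y)\<in>G. \<forall>(u', y')\<in>G.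
        P_trunc \<tau> u = P_trunc \<tau> u' \<longrightarrow> P_trunc \<tau> y = P_trunc \<tau> y')"

definition causally_extendible :: "('m::finite) operator \<Rightarrow> bool" where
  "causally_extendible G \<longleftrightarrow> causal G \<and> (\<forall>\<tau>>0. P_trunc \<tau> ` Domain G = L2_upto \<tau>)"

definition truncation :: "real \<Rightarrow> ('m::finite) operator \<Rightarrow> 'm operator" where
  "truncation \<tau> G = map_prod (P_trunc \<tau>) (P_trunc \<tau>) ` G"

lemma single_valued_truncation: "causal G \<Longrightarrow> 0 < \<tau> \<Longrightarrow> single_valued (truncation \<tau> G)"
  by (fastforce simp: causal_def truncation_def single_valued_def)

lemma Domain_truncation:
  "causally_extendible G \<Longrightarrow> 0 < \<tau> \<Longrightarrow> Domain (truncation \<tau> G) = L2_upto \<tau>"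
  by (force simp: causally_extendible_def truncation_def Domain_fst image_image)

definition op_sigma_max :: "('m::finite) operator \<Rightarrow> ennreal" where
  "op_sigma_max G = (SUP (u, y)\<in>{(u, y)\<in>G. u \<noteq> 0}. ennreal (norm y / norm u))"

definition op_sigma_min :: "('m::finite) operator \<Rightarrow> ennreal" where
  "op_sigma_min G = (INF (u, y)\<in>{(u, y)\<in>G. u \<noteq> 0}. ennreal (norm y / norm u))"


section \<open>Singular values of complex matrices\<close>

definition conj_transpose :: "complex ^ 'n ^ 'm \<Rightarrow> complex ^ 'm ^ 'n" where
  "conj_transpose A = (\<chi> i j. cnj (A $ j $ i))"

definition singular_values :: "complex ^ 'm ^ 'm \<Rightarrow> real set" where
  "singular_values A =
     {\<sigma>. 0 \<le> \<sigma> \<and> (\<exists>x. x \<noteq> 0 \<and> (conj_transpose A ** A) *v x = complex_of_real (\<sigma>\<^sup>2) *s x)}"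

definition sigma_max :: "complex ^ 'm ^ 'm \<Rightarrow> real" where
  "sigma_max A = Max (singular_values A)"

definition sigma_min :: "complex ^ 'm ^ 'm \<Rightarrow> real" where
  "sigma_min A = Min (singular_values A)"

end

theory Submission
  imports Defs "HOL-Probability.Probability"
begin

text \<open>
  Let the graph of the operator be \<open>(M v, N v)\<close> with \<open>v\<close> in \<open>H2\<close>. For \<open>c \<ge> 0\<close>, the bound
  \<open>norm (P\<^sub>\<tau> y) \<le> c norm (P\<^sub>\<tau> u)\<close> for all \<open>\<tau>\<close> and all \<open>(u, y)\<close> in the graph is equivalent to
  \<open>norm (N(s) x) \<le> c norm (M(s) x)\<close> for all \<open>s\<close> with \<open>Re s > 0\<close>; exchanging \<open>M\<close> and \<open>N\<close> gives the
  analogue for lower bounds. From the frequency domain to the time domain, \<open>N = S M\<close> with \<open>S\<close>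
  holomorphic and bounded by \<open>c\<close>, and such a multiplier acts causally. Conversely, averaging the truncated bounds with
  exponential weights gives, by Plancherel, an \<open>L2\<close> bound on each line \<open>Re s = a\<close>; testing it on
  \<open>v(s) = (s - i w0 + 1)^(-k) x\<close> and letting \<open>k\<close> grow localises it at \<open>a + i w0\<close>.
  Invariance of the graph under delays makes the two extremal gains of the truncations monotone in
  \<open>\<tau>\<close>, so the limits exist and equal the frequency-domain extrema.
\<close>

section \<open>Continuity of translation in the mean\<close>

text \<open>Bounds are stated for the pair \<open>N s *v x\<close>, \<open>M s *v x\<close> and not
  for \<open>T s\<close>: such an inequality makes sense at poles of \<open>T\<close> and at zeros
  of \<open>det (M s)\<close>, survives limits, and is symmetric in the two factors. A lower bound
  with \<open>c > 0\<close> is thus an upper bound with \<open>1 / c\<close> for the inverse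
  relation, whose denominator is \<open>N\<close>. The obstacle is that the extrema run over the
  open half-plane, while an L2 bound on the whole half-line only controls the imaginary axis; there
  a zero of \<open>det (N s)\<close> inside the half-plane can be invisible, as for (s - 1) / (s +
  1). The truncations at all times supply the missing information: weighted by
  \<open>exp (- 2 a \<tau>)\<close> they give a bound on Re s = a. Boundary values are avoided
  throughout: transforms are evaluated only at Re s > 0, where the damped function is integrable and
  square integrable, and the damping is removed in the time domain.\<close>

abbreviation lborel_integral :: "(real \<Rightarrow> 'a::{banach, second_countable_topology}) \<Rightarrow> 'a"
    (binder "LI " 10) where
  "lborel_integral f \<equiv> integral\<^sup>L lborel f"

lemmas integrableL_bound = Bochner_Integration.integrable_bound
  and integrableL_add = Bochner_Integration.integrable_add
  and integrableL_diff = Bochner_Integration.integrable_diff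
  and integralL_cong = Bochner_Integration.integral_cong
  and integralL_add = Bochner_Integration.integral_add
  and integralL_diff = Bochner_Integration.integral_diff

text \<open>The shape of the approximation arguments below: the error \<open>e\<close> is uniform in
  \<open>n\<close>, while the null sequence may depend on \<open>e\<close>.\<close>

lemma tendsto_zero_if_approx:
  fixes a :: "nat \<Rightarrow> real"
  assumes "\<And>n. 0 \<le> a n"
    and "\<And>e. 0 < e \<Longrightarrow> \<exists>b. b \<longlonglongrightarrow> 0 \<and> (\<forall>n. a n \<le> b n + e)"
  shows "a \<longlonglongrightarrow> 0"
proof (rule LIMSEQ_I)
  fix r :: real assume "0 < r"
  then obtain b where b: "b \<longlonglongrightarrow> 0" "\<And>n. a n \<le> b n + r / 2"
    using assms(2)[of "r/2"] by auto
  from b(1) \<open>0 < r\<close> obtain N where "\<And>n. n \<ge> N \<Longrightarrow> norm (b n - 0) < r/2"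
    by (metis LIMSEQ_D half_gt_zero)
  then have "norm (a n - 0) < r" if "n \<ge> N" for n
    using that b(2)[of n] assms(1)[of n] by fastforce
  then show "\<exists>no. \<forall>n\<ge>no. norm (a n - 0) < r" by blast
qed

lemma norm_add_diff_le: "norm (a + b - c) \<le> norm a + norm b + norm c"
  for a b c :: "'a::real_normed_vector"
  using norm_triangle_ineq4[of "a + b" c] norm_triangle_ineq[of a b] by linarith

lemma integrable_translate:
  fixes f :: "real \<Rightarrow> 'a::{banach, second_countable_topology}"
  assumes "integrable lborel f"
  shows "integrable lborel (\<lambda>t. f (t - h))"
  using lborel_integrable_real_affine[OF assms, of 1 "-h"] by (simp add: algebra_simps)

lemma integral_translate:
  fixes f :: "real \<Rightarrow> 'a::{banach, second_countable_topology}"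
  shows "(LI t. f (t - h)) = (LI t. f t)"
  using lborel_integral_real_affine[of 1 f "-h"] by (simp add: algebra_simps)

lemma integral_add_translate:
  fixes p q :: "real \<Rightarrow> real"
  assumes p: "integrable lborel p" and q: "integrable lborel q"
  shows "(LI t. p t + (q (t - h) + q t)) = (LI t. p t) + 2 * (LI t. q t)"
  using integralL_add[OF p integrableL_add[OF integrable_translate[OF q, of h] q]]
    integralL_add[OF integrable_translate[OF q, of h] q] integral_translate[of q h]
  by (simp only:)

text \<open>Outer regularity replaces \<open>A\<close> by an open set \<open>U\<close>, whose points
  stay in \<open>U\<close> under small shifts. The exchange costs the measure of
  \<open>U - A\<close> twice, once at \<open>t\<close> and once at \<open>t - h n\<close>.\<close>

lemma indicator_translation_tendsto:
  fixes A :: "real set"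
  assumes A: "A \<in> sets borel" and fin: "emeasure lborel A < \<infinity>" and h: "h \<longlonglongrightarrow> 0"
  shows "(\<lambda>n. LI t. \<bar>indicator A (t - h n) - indicator A t\<bar>) \<longlonglongrightarrow> (0::real)"
proof (rule tendsto_zero_if_approx)
  fix e :: real assume "0 < e"
  obtain U where U: "open U" "A \<subseteq> U" "emeasure lebesgue (U - A) < ennreal (e/2)"
    using sets_lebesgue_outer_open[of A "e/2"] A \<open>0 < e\<close> by auto
  have UB: "U \<in> sets borel" using U by simp
  have em: "emeasure lborel (U - A) < ennreal (e/2)" using U(3) A UB by simp
  have finD: "emeasure lborel (U - A) < \<infinity>"
    using order_less_trans[OF em ennreal_less_top] by simp
  have finU: "emeasure lborel U < \<infinity>"
  proof -
    have "emeasure lborel U = emeasure lborel (A \<union> (U - A))" using U(2) by (simp add: Un_absorb1)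
    also have "\<dots> \<le> emeasure lborel A + emeasure lborel (U - A)"
      using A UB by (intro emeasure_subadditive) auto
    also have "\<dots> < \<infinity>" using fin finD by simp
    finally show ?thesis .
  qed
  have mD: "measure lborel (U - A) \<le> e/2"
    using em \<open>0 < e\<close> unfolding measure_def by (intro enn2real_leI) auto
  have iU: "integrable lborel (indicator U :: real \<Rightarrow> real)" using UB finU by simp
  have iA: "integrable lborel (indicator A :: real \<Rightarrow> real)" using A fin by simp
  have iD: "integrable lborel (indicator (U - A) :: real \<Rightarrow> real)" using A UB finD by simp
  \<comment> \<open>Only points that leave \<open>U\<close> are counted, so convergence is asked for
    at points of \<open>U\<close> alone and the boundary of \<open>U\<close> never matters. The
    points that enter \<open>U\<close> are recovered by translation invariance.\<close>
  define b where "b = (\<lambda>n. LI t. 2 * (indicator U t * (1 - indicator U (t - h n))) :: real)"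
  have iP: "integrable lborel (\<lambda>t. 2 * (indicator U t * (1 - indicator U (t - c))) :: real)" for c
    by (rule integrableL_bound[OF integrable_mult_right[OF iU, of 2]])
       (use UB in \<open>auto simp: indicator_def\<close>)
  have "b \<longlonglongrightarrow> (\<integral>t. 0 \<partial>(lborel :: real measure))" unfolding b_def
  proof (rule integral_dominated_convergence[where w = "\<lambda>t. 2 * indicator U t"])
    show "AE t in lborel. (\<lambda>n. 2 * (indicator U t * (1 - indicator U (t - h n))) :: real) \<longlonglongrightarrow> 0"
    proof (rule AE_I2)
      fix t :: real
      show "(\<lambda>n. 2 * (indicator U t * (1 - indicator U (t - h n))) :: real) \<longlonglongrightarrow> 0"
      proof (cases "t \<in> U")
        case True
        have "(\<lambda>n. t - h n) \<longlonglongrightarrow> t" using tendsto_diff[OF tendsto_const h, of t] by simp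
        then have "eventually (\<lambda>n. t - h n \<in> U) sequentially"
          using U(1) True by (rule topological_tendstoD)
        then have "eventually (\<lambda>n. 2 * (indicator U t * (1 - indicator U (t - h n))) = (0::real)) sequentially"
          by eventually_elim (auto simp: indicator_def)
        then show ?thesis by (rule tendsto_eventually)
      qed simp
    qed
  qed (use UB iU in \<open>auto simp: indicator_times_eq_if split: split_indicator\<close>)
  then have b0: "b \<longlonglongrightarrow> 0" by simp
  have "(LI t. \<bar>indicator A (t - h n) - indicator A t\<bar>) \<le> b n + e" for n
  proof -
    \<comment> \<open>For \<open>p\<close>, \<open>q\<close> in {0, 1}, the values of
      \<open>indicator U\<close> at \<open>t - h n\<close> and at \<open>t\<close>, the distance of
      \<open>p\<close> and \<open>q\<close> is \<open>2 * (q * (1 - p)) + (p - q)\<close>; the last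
      difference integrates to 0.\<close>
    have "(LI t. \<bar>indicator A (t - h n) - indicator A t\<bar> :: real) \<le>
      (LI t. (2 * (indicator U t * (1 - indicator U (t - h n))) + (indicator U (t - h n) - indicator U t))
         + (indicator (U - A) (t - h n) + indicator (U - A) t))"
      by (intro integral_mono integrableL_add integrableL_diff
           integrable_abs integrable_translate iU iA iD iP)
         (use U(2) in \<open>auto simp: indicator_def\<close>)
    also have "\<dots> = b n + 2 * measure lborel (U - A)"
    proof (subst integral_add_translate)
      show "integrable lborel (\<lambda>t. 2 * (indicator U t * (1 - indicator U (t - h n))) + (indicator U (t - h n) - indicator U t) :: real)"
        by (intro integrableL_add integrableL_diff integrable_translate iU iP)
      have "(LI t. 2 * (indicator U t * (1 - indicator U (t - h n))) + (indicator U (t - h n) - indicator U t)) =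
         b n + ((LI t. indicator U (t - h n)) - (LI t. indicator U t :: real))"
        unfolding b_def
        by (subst integralL_add[OF iP integrableL_diff[OF integrable_translate[OF iU] iU]])
           (subst integralL_diff[OF integrable_translate[OF iU] iU], rule refl)
      also have "\<dots> = b n" by (subst integral_translate) simp
      finally show "(LI t. 2 * (indicator U t * (1 - indicator U (t - h n))) + (indicator U (t - h n) - indicator U t)) + 2 * (LI t. indicator (U - A) t) =
         b n + 2 * measure lborel (U - A)" using A UB by simp
    qed (rule iD)
    finally show ?thesis using mD by linarith
  qed
  with b0 show "\<exists>b. b \<longlonglongrightarrow> 0 \<and> (\<forall>n. (LI t. \<bar>indicator A (t - h n) - indicator A t\<bar>) \<le> b n + e)"
    by blast
qed simp

text \<open>The functions with this property include indicators of sets of finite measure and are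
  closed under sums and dominated limits; in the limit case the shifted error has the same integral
  as the error.\<close>

lemma L1_translation_tendsto:
  fixes g :: "real \<Rightarrow> 'a::{banach, second_countable_topology}"
  assumes "integrable lborel g" and h: "h \<longlonglongrightarrow> 0"
  shows "(\<lambda>n. LI t. norm (g (t - h n) - g t)) \<longlonglongrightarrow> 0"
  using assms(1)
proof (induction rule: integrable_induct)
  case (base A c)
  have "(LI t. norm (indicator A (t - h n) *\<^sub>R c - indicator A t *\<^sub>R c))
     = norm c * (LI t. \<bar>indicator A (t - h n) - indicator A t\<bar>)" for n
    by (simp flip: scaleR_diff_left)
  with tendsto_mult_right_zero[OF indicator_translation_tendsto[of A h]] base h show ?case by simp
next
  case (add f g)
  show ?case
  proof (rule real_tendsto_sandwich[OF _ _ tendsto_const])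
    show "(\<lambda>n. (LI t. norm (f (t - h n) - f t)) + (LI t. norm (g (t - h n) - g t))) \<longlonglongrightarrow> 0"
      using tendsto_add[OF add.IH] by simp
    show "\<forall>\<^sub>F n in sequentially. (LI t. norm (f (t - h n) + g (t - h n) - (f t + g t)))
       \<le> (LI t. norm (f (t - h n) - f t)) + (LI t. norm (g (t - h n) - g t))"
    proof (rule always_eventually, rule allI)
      fix n
      have "(LI t. norm (f (t - h n) + g (t - h n) - (f t + g t)))
         \<le> (LI t. norm (f (t - h n) - f t) + norm (g (t - h n) - g t))"
        by (intro integral_mono integrableL_add integrableL_diff
             integrable_norm integrable_translate add.hyps)
           (metis add_diff_add norm_triangle_ineq)
      also have "\<dots> = (LI t. norm (f (t - h n) - f t)) + (LI t. norm (g (t - h n) - g t))"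
        by (intro integralL_add integrableL_add integrableL_diff
             integrable_norm integrable_translate add.hyps)
      finally show "(LI t. norm (f (t - h n) + g (t - h n) - (f t + g t))) \<le> \<dots>" .
    qed
  qed simp
next
  case (lim f s)
  have I: "(\<lambda>i. LI t. norm (s i t - f t)) \<longlonglongrightarrow> (\<integral>t. 0 \<partial>(lborel :: real measure))"
  \<comment> \<open>The approximants satisfy \<open>norm (s i t) \<le> 2 * norm (f t)\<close>,
    whence the factor 3.\<close>
  proof (rule integral_dominated_convergence[where w = "\<lambda>t. 3 * norm (f t)"])
    show "AE t in lborel. (\<lambda>i. norm (s i t - f t)) \<longlonglongrightarrow> 0"
      using lim(2) by (auto intro!: AE_I2 tendsto_norm_zero simp: LIM_zero_iff)
    show "AE t in lborel. norm (norm (s i t - f t)) \<le> 3 * norm (f t)" for i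
      
    proof (rule AE_I2)
      fix t :: real
      have "norm (s i t) \<le> 2 * norm (f t)" using lim(3) by simp
      then show "norm (norm (s i t - f t)) \<le> 3 * norm (f t)"
        using norm_triangle_ineq4[of "s i t" "f t"] by simp
    qed
  qed (use lim in \<open>auto intro!: borel_measurable_integrable\<close>)
  show ?case
  proof (rule tendsto_zero_if_approx)
    fix e :: real assume "0 < e"
    then have "0 < e/2" by simp
    from LIMSEQ_D[OF I this] obtain i where "norm ((LI t. norm (s i t - f t)) - (\<integral>t. 0 \<partial>(lborel :: real measure))) < e/2"
      by blast
    then have i: "(LI t. norm (s i t - f t)) < e/2" by simp
    have "(LI t. norm (f (t - h n) - f t)) \<le> (LI t. norm (s i (t - h n) - s i t)) + e" for n
    proof -
      have "(LI t. norm (f (t - h n) - f t)) \<le>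
        (LI t. norm (s i (t - h n) - s i t) + ((\<lambda>t. norm (s i t - f t)) (t - h n) + norm (s i t - f t)))"
      proof (intro integral_mono integrableL_add integrableL_diff
             integrable_norm integrable_translate lim(1,4))
        fix t
        have "f (t - h n) - f t = (s i (t - h n) - s i t) + (s i t - f t) - (s i (t - h n) - f (t - h n))"
          by simp
        then show "norm (f (t - h n) - f t) \<le> norm (s i (t - h n) - s i t) + (norm (s i (t - h n) - f (t - h n)) + norm (s i t - f t))"
          using norm_add_diff_le[of "s i (t - h n) - s i t" "s i t - f t" "s i (t - h n) - f (t - h n)"] by simp
      qed
      also have "\<dots> = (LI t. norm (s i (t - h n) - s i t)) + ((LI t. norm (s i t - f t)) + (LI t. norm (s i t - f t)))"
        by (subst integral_add_translate) (intro integrableL_diff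
             integrable_norm integrable_translate lim(1,4) | simp)+
      finally show ?thesis using i by simp
    qed
    with lim(5)[of i]
    show "\<exists>b. b \<longlonglongrightarrow> 0 \<and> (\<forall>n. (LI t. norm (f (t - h n) - f t)) \<le> b n + e)"
      by blast
  qed simp
qed

text \<open>Replacing \<open>g\<close> by 0 where its modulus exceeds \<open>B\<close> costs a small
  L2 error and leaves a bounded function, for which the squared difference is at most
  \<open>2 * B\<close> times the difference. This reduces the claim to L1.\<close>

lemma L2_translation_tendsto:
  fixes g :: "real \<Rightarrow> complex"
  assumes g1: "integrable lborel g" and g2: "integrable lborel (\<lambda>t. (norm (g t))\<^sup>2)"
    and h: "h \<longlonglongrightarrow> 0"
  shows "(\<lambda>n. LI t. (norm (g (t - h n) - g t))\<^sup>2) \<longlonglongrightarrow> 0"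
proof (rule tendsto_zero_if_approx)
  fix e :: real assume "0 < e"
  have [measurable]: "g \<in> borel_measurable borel" using g1 by auto
  define gB where "gB = (\<lambda>B::nat. \<lambda>t. if norm (g t) \<le> real B then g t else 0)"
  have gBm[measurable]: "gB B \<in> borel_measurable borel" for B unfolding gB_def by measurable
  have gB1: "integrable lborel (gB B)" for B
    by (rule integrableL_bound[OF g1]) (auto simp: gB_def)
  have I: "(\<lambda>B. LI t. (norm (g t - gB B t))\<^sup>2) \<longlonglongrightarrow> (\<integral>t. 0 \<partial>(lborel :: real measure))"
  proof (rule integral_dominated_convergence[where w = "\<lambda>t. (norm (g t))\<^sup>2"])
    show "AE t in lborel. (\<lambda>B. (norm (g t - gB B t))\<^sup>2) \<longlonglongrightarrow> 0"
    proof (rule AE_I2)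
      fix t
      have "eventually (\<lambda>B. (norm (g t - gB B t))\<^sup>2 = 0) sequentially"
        using eventually_ge_at_top[of "nat \<lceil>norm (g t)\<rceil>"]
        by eventually_elim (auto simp: gB_def nat_le_iff ceiling_le_iff)
      then show "(\<lambda>B. (norm (g t - gB B t))\<^sup>2) \<longlonglongrightarrow> 0" by (rule tendsto_eventually)
    qed
  qed (use g2 in \<open>auto simp: gB_def\<close>)
  have "0 < e/6" using \<open>0 < e\<close> by simp
  from LIMSEQ_D[OF I this] obtain B where "norm ((LI t. (norm (g t - gB B t))\<^sup>2) - (\<integral>t. 0 \<partial>(lborel :: real measure))) < e/6"
    by blast
  then have B: "(LI t. (norm (g t - gB B t))\<^sup>2) < e/6" by simp
  let ?k = "gB B"
  have i1: "integrable lborel (\<lambda>t. (norm (g t - ?k t))\<^sup>2)"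
    by (rule integrableL_bound[OF g2]) (auto simp: gB_def)
  have i2: "integrable lborel (\<lambda>t. norm (?k (t - c) - ?k t))" for c
    by (intro integrable_norm integrableL_diff integrable_translate gB1)
  define b where "b = (\<lambda>n. 6 * B * (LI t. norm (?k (t - h n) - ?k t)))"
  have b0: "b \<longlonglongrightarrow> 0" unfolding b_def
    by (intro tendsto_mult_right_zero L1_translation_tendsto gB1 h)
  have "(LI t. (norm (g (t - h n) - g t))\<^sup>2) \<le> b n + e" for n
  proof -
    \<comment> \<open>The constants come from \<open>(x + y + z)\<^sup>2 \<le> 3 * (x\<^sup>2 +
      y\<^sup>2 + z\<^sup>2)\<close> and \<open>x\<^sup>2 \<le> 2 * B * x\<close>; the two error
      terms of weight 3 explain the choice of \<open>e/6\<close>.\<close>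
    have pt: "(norm (g (t - c) - g t))\<^sup>2 \<le> 6 * B * norm (?k (t - c) - ?k t) +
        ((\<lambda>t. 3 * (norm (g t - ?k t))\<^sup>2) (t - c) + 3 * (norm (g t - ?k t))\<^sup>2)" for t c
    proof -
      define x where "x = norm (?k (t - c) - ?k t)"
      define y where "y = norm (g (t - c) - ?k (t - c))"
      define z where "z = norm (g t - ?k t)"
      have "norm (?k t) \<le> B" for t by (auto simp: gB_def)
      from this[of "t - c"] this[of t] have x: "0 \<le> x" "x \<le> 2 * B"
        unfolding x_def using norm_triangle_ineq4[of "?k (t - c)" "?k t"] by (simp, linarith)
      have "g (t - c) - g t = (?k (t - c) - ?k t) + (g (t - c) - ?k (t - c)) - (g t - ?k t)" by simp
      then have "norm (g (t - c) - g t) \<le> x + y + z"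
        unfolding x_def y_def z_def by (metis norm_add_diff_le)
      then have "(norm (g (t - c) - g t))\<^sup>2 \<le> (x + y + z)\<^sup>2" by (intro power_mono) auto
      also have "\<dots> \<le> 3 * x\<^sup>2 + 3 * (y\<^sup>2 + z\<^sup>2)"
        using sum_squares_bound[of x y] sum_squares_bound[of x z] sum_squares_bound[of y z]
        by (simp add: power2_eq_square algebra_simps)
      also have "x\<^sup>2 \<le> 2 * B * x" using x by (simp add: power2_eq_square mult_right_mono)
      finally show ?thesis by (simp add: x_def y_def z_def)
    qed
    have iR: "integrable lborel (\<lambda>t. 6 * B * norm (?k (t - h n) - ?k t) +
        ((\<lambda>t. 3 * (norm (g t - ?k t))\<^sup>2) (t - h n) + 3 * (norm (g t - ?k t))\<^sup>2))"
      by (intro integrableL_add integrable_mult_right i2 integrable_translate[OF integrable_mult_right[OF i1]] i1)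
    have "(LI t. (norm (g (t - h n) - g t))\<^sup>2) \<le> (LI t. 6 * B * norm (?k (t - h n) - ?k t) +
        ((\<lambda>t. 3 * (norm (g t - ?k t))\<^sup>2) (t - h n) + 3 * (norm (g t - ?k t))\<^sup>2))"
      by (intro integral_mono iR pt integrableL_bound[OF iR])
         (use pt in \<open>auto intro!: AE_I2 intro: order_trans[OF _ abs_ge_self]\<close>)
    also have "\<dots> = b n + 6 * (LI t. (norm (g t - ?k t))\<^sup>2)"
      using integral_add_translate[OF integrable_mult_right[OF i2] integrable_mult_right[OF i1, of 3], of "6 * B" "h n" "h n"]
      by (simp add: b_def algebra_simps)
    finally show ?thesis using B by linarith
  qed
  with b0 show "\<exists>b. b \<longlonglongrightarrow> 0 \<and> (\<forall>n. (LI t. (norm (g (t - h n) - g t))\<^sup>2) \<le> b n + e)"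
    by blast
qed simp

section \<open>Plancherel's theorem\<close>

lemma borel_measurable_cnj [measurable (raw)]:
  "f \<in> borel_measurable M \<Longrightarrow> (\<lambda>x. cnj (f x)) \<in> borel_measurable M"
  by (rule borel_measurable_continuous_on[of cnj]) (auto intro: continuous_intros)

lemma integral_eq_mult:
  fixes c :: "'a::{real_normed_field, banach, second_countable_topology}"
  assumes "\<And>x. h x = c * f x"
  shows "integral\<^sup>L M h = c * integral\<^sup>L M f"
proof -
  have "h = (\<lambda>x. c * f x)" using assms by auto
  then show ?thesis by simp
qed

lemma integrable_lborel_pair_mult:
  fixes f g :: "real \<Rightarrow> complex"
  assumes f: "integrable lborel f" and g: "integrable lborel g"
  shows "integrable (lborel \<Otimes>\<^sub>M lborel) (\<lambda>(x, y). f x * g y)"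
proof -
  have [measurable]: "f \<in> borel_measurable borel" "g \<in> borel_measurable borel" using f g by auto
  show ?thesis
    by (rule lborel_pair.Fubini_integrable) (use f g in \<open>auto simp: norm_mult\<close>)
qed

lemma normal_density_0_scale: "0 < d \<Longrightarrow> normal_density 0 d x = std_normal_density (x / d) / d"
  by (simp add: normal_density_def std_normal_density_def real_sqrt_mult power_divide mult.commute)

text \<open>The characteristic function of the standard normal distribution, rescaled by the
  substitution of \<open>d * w\<close> for \<open>w\<close>. On the right stands an approximate
  identity for small \<open>d\<close>.\<close>

lemma integral_gaussian_exp:
  assumes "0 < d"
  shows "(LI w. exp (\<i> * of_real (w * x)) * of_real (exp (- (d * w)\<^sup>2 / 2)))
     = of_real (2 * pi * normal_density 0 d x)"
proof -
  have "char std_normal_distribution (x / d) = (LI w. of_real (std_normal_density w) * exp (\<i> * (of_real (x / d) * of_real w)))"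
    unfolding char_def by (subst integral_density) (auto simp: scaleR_conv_of_real)
  also have "\<dots> = \<bar>d\<bar> *\<^sub>R (LI w. of_real (std_normal_density (0 + d * w)) * exp (\<i> * (of_real (x / d) * of_real (0 + d * w))))"
    using assms by (intro lborel_integral_real_affine) auto
  also have "(\<lambda>w. of_real (std_normal_density (0 + d * w)) * exp (\<i> * (of_real (x / d) * of_real (0 + d * w))) :: complex)
     = (\<lambda>w. of_real (1 / sqrt (2 * pi)) * (exp (\<i> * of_real (w * x)) * of_real (exp (- (d * w)\<^sup>2 / 2))))"
  proof
    fix w
    have "of_real (x / d) * of_real (0 + d * w) = complex_of_real (w * x)"
      using assms unfolding of_real_mult[symmetric] of_real_eq_iff by simp
    moreover have "complex_of_real (std_normal_density (0 + d * w)) = of_real (1 / sqrt (2 * pi)) * of_real (exp (- (d * w)\<^sup>2 / 2))"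
      unfolding of_real_mult[symmetric] of_real_eq_iff by (simp only: std_normal_density_def add_0)
    ultimately show "of_real (std_normal_density (0 + d * w)) * exp (\<i> * (of_real (x / d) * of_real (0 + d * w))) =
       of_real (1 / sqrt (2 * pi)) * (exp (\<i> * of_real (w * x)) * complex_of_real (exp (- (d * w)\<^sup>2 / 2)))"
      by (simp only: mult_ac)
  qed
  finally have "of_real (exp (- ((x / d)\<^sup>2) / 2)) = of_real (d / sqrt (2 * pi)) *
      (LI w. exp (\<i> * of_real (w * x)) * of_real (exp (- (d * w)\<^sup>2 / 2)))"
    using assms unfolding char_std_normal_distribution scaleR_conv_of_real integral_mult_right_zero mult.assoc[symmetric] of_real_mult[symmetric]
    by simp
  moreover have "of_real (exp (- ((x / d)\<^sup>2) / 2)) = of_real (d / sqrt (2 * pi)) * complex_of_real (2 * pi * normal_density 0 d x)"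
  proof -
    define q where "q = sqrt (2 * pi)"
    have q: "q \<noteq> 0" "2 * pi = q * q" by (simp_all add: q_def)
    have "normal_density 0 d x = 1 / q * exp (- (x / d)\<^sup>2 / 2) / d"
      unfolding normal_density_0_scale[OF assms] std_normal_density_def q_def ..
    then have "exp (- ((x / d)\<^sup>2) / 2) = d / q * (2 * pi * normal_density 0 d x)"
      using assms q(1) unfolding q(2) by simp
    then have "exp (- ((x / d)\<^sup>2) / 2) = d / sqrt (2 * pi) * (2 * pi * normal_density 0 d x)"
      unfolding q_def .
    then show ?thesis unfolding of_real_mult[symmetric] of_real_eq_iff .
  qed
  moreover have "complex_of_real (d / sqrt (2 * pi)) \<noteq> 0" using assms by simp
  ultimately show ?thesis using mult_left_cancel[of "complex_of_real (d / sqrt (2 * pi))"] by simp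
qed

lemma integrable_gaussian: "d \<noteq> 0 \<Longrightarrow> integrable lborel (\<lambda>w. exp (- (d * w)\<^sup>2 / 2) :: real)"
proof -
  assume d: "d \<noteq> 0"
  have "(\<lambda>w. exp (- (d * w)\<^sup>2 / 2) :: real) = (\<lambda>w. sqrt (2 * pi) * std_normal_density (0 + d * w))"
    by (auto simp: std_normal_density_def)
  moreover have "integrable lborel (\<lambda>w. std_normal_density (0 + d * w))"
    using d by (intro lborel_integrable_real_affine) auto
  ultimately show ?thesis by simp
qed

text \<open>Unnormalised, so that a Laplace transform on the line Re s = a is exactly the Fourier
  transform of the function damped by \<open>exp (- (a * t))\<close>; the price is the factor
  \<open>2 * pi\<close> in Plancherel's identity.\<close>

definition fourier :: "(real \<Rightarrow> complex) \<Rightarrow> real \<Rightarrow> complex" where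
  "fourier g w = (LI t. g t * exp (- (\<i> * of_real (w * t))))"

lemma norm_exp_i_real [simp]: "norm (exp (- (\<i> * complex_of_real x))) = 1"
  by (metis norm_exp_i_times mult_minus_right of_real_minus)

lemma borel_measurable_fourier [measurable]:
  assumes "g \<in> borel_measurable borel"
  shows "fourier g \<in> borel_measurable borel"
  unfolding fourier_def[abs_def] using assms by measurable

lemma norm_fourier_le: "norm (fourier g w) \<le> (LI t. norm (g t))"
  unfolding fourier_def
  by (rule order_trans[OF integral_norm_bound]) (simp add: norm_mult del: of_real_mult)

text \<open>Expanding the squared modulus of \<open>g (t - h) - g t\<close> expresses the real part
  by the L2 modulus of continuity, so continuity of translation becomes continuity of the
  autocorrelation at \<open>h = 0\<close>.\<close>

lemma autocorrelation:
  fixes g :: "real \<Rightarrow> complex"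
  assumes g1: "integrable lborel g" and g2: "integrable lborel (\<lambda>t. (norm (g t))\<^sup>2)"
  shows "integrable lborel (\<lambda>t. g t * cnj (g (t - h)))"
    and "Re (LI t. g t * cnj (g (t - h))) =
      (LI t. (norm (g t))\<^sup>2) - (LI t. (norm (g (t - h) - g t))\<^sup>2) / 2"
    and "norm (LI t. g t * cnj (g (t - h))) \<le> (LI t. (norm (g t))\<^sup>2)"
    and "(LI t. norm (g t * cnj (g (t - h)))) \<le> (LI t. (norm (g t))\<^sup>2)"
proof -
  have [measurable]: "g \<in> borel_measurable borel" using g1 by auto
  let ?N = "\<lambda>t. (norm (g t))\<^sup>2"
  have g2h: "integrable lborel (\<lambda>t. (norm (g (t - h)))\<^sup>2)" by (rule integrable_translate[OF g2])
  have eqh: "(LI t. (norm (g (t - h)))\<^sup>2) = (LI t. (norm (g t))\<^sup>2)"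
    by (rule integral_translate)
  have le: "norm (g t) * norm (g (t - h)) \<le> (?N t + ?N (t - h)) / 2" for t
    using sum_squares_bound[of "norm (g t)" "norm (g (t - h))"] by simp
  have iS: "integrable lborel (\<lambda>t. (?N t + ?N (t - h)) / 2)" using g2 g2h by simp
  show i: "integrable lborel (\<lambda>t. g t * cnj (g (t - h)))"
    by (rule integrableL_bound[OF iS])
       (use le in \<open>auto simp: norm_mult abs_of_nonneg intro!: AE_I2\<close>)
  show n: "(LI t. norm (g t * cnj (g (t - h)))) \<le> (LI t. ?N t)"
  proof -
    have "(LI t. norm (g t * cnj (g (t - h)))) \<le> (LI t. (?N t + ?N (t - h)) / 2)"
      by (intro integral_mono iS integrable_norm i) (use le in \<open>simp add: norm_mult\<close>)
    also have "\<dots> = (LI t. ?N t)" using g2 g2h eqh by simp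
    finally show ?thesis .
  qed
  then show "norm (LI t. g t * cnj (g (t - h))) \<le> (LI t. ?N t)"
    by (rule order_trans[OF integral_norm_bound])
  have id: "integrable lborel (\<lambda>t. (norm (g (t - h) - g t))\<^sup>2)"
  proof (rule integrableL_bound[OF integrable_mult_right[OF iS, of 4]], goal_cases)
    case 2
    show ?case
    proof (rule AE_I2)
      fix t
      have "(norm (g (t - h) - g t))\<^sup>2 \<le> (norm (g (t - h)) + norm (g t))\<^sup>2"
        by (intro power_mono norm_triangle_ineq4) auto
      also have "\<dots> \<le> 4 * ((?N t + ?N (t - h)) / 2)"
        using sum_squares_bound[of "norm (g (t - h))" "norm (g t)"] by (simp add: power2_sum)
      finally show "norm ((norm (g (t - h) - g t))\<^sup>2) \<le> norm (4 * ((?N t + ?N (t - h)) / 2))" by simp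
    qed
  qed measurable
  have "Re (LI t. g t * cnj (g (t - h))) = (LI t. Re (g t * cnj (g (t - h))))"
    by (rule integral_Re[OF i, symmetric])
  also have "\<dots> = (LI t. (?N t + ?N (t - h)) / 2 - (norm (g (t - h) - g t))\<^sup>2 / 2)"
    by (rule integralL_cong) (simp_all only: cmod_power2, simp_all add: power2_eq_square field_simps)
  also have "\<dots> = (LI t. ?N t) - (LI t. (norm (g (t - h) - g t))\<^sup>2) / 2"
    using g2 g2h eqh id by simp
  finally show "Re (LI t. g t * cnj (g (t - h))) =
      (LI t. ?N t) - (LI t. (norm (g (t - h) - g t))\<^sup>2) / 2" .
qed

text \<open>The squared modulus of the transform is the transform of the autocorrelation, so the
  Gaussian can be moved to the time side as its own transform. The Gaussian also makes the integrals
  over \<open>w\<close> absolutely convergent, \<open>fourier g\<close> being so far only known to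
  be bounded.\<close>

lemma fourier_gaussian_weight_aux:
  fixes g :: "real \<Rightarrow> complex"
  assumes g1: "integrable lborel g" and g2: "integrable lborel (\<lambda>t. (norm (g t))\<^sup>2)" and d: "0 < d"
  shows "complex_of_real (LI w. (norm (fourier g w))\<^sup>2 * exp (- (d * w)\<^sup>2 / 2))
    = (LI h. complex_of_real (2 * pi * normal_density 0 d h) * (LI t. g t * cnj (g (t - h))))"
proof -
  have [measurable]: "g \<in> borel_measurable borel" using g1 by auto
  let ?e = "\<lambda>w. exp (- (d * w)\<^sup>2 / 2) :: real"
  let ?E = "\<lambda>w t. exp (- (\<i> * complex_of_real (w * t)))"
  have ie: "integrable lborel (\<lambda>w. complex_of_real (?e w))"
    using integrable_gaussian[of d] d by simp
  have iF: "integrable lborel (\<lambda>w. cnj (fourier g w) * of_real (?e w))"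
    by (rule integrableL_bound[OF integrable_mult_right[OF ie, of "of_real (LI t. norm (g t))"]])
       (auto simp: norm_mult intro!: AE_I2 mult_mono order_trans[OF norm_fourier_le])
  have J1: "integrable (lborel \<Otimes>\<^sub>M lborel) (\<lambda>(w, t). g t * ?E w t * (cnj (fourier g w) * of_real (?e w)))"
    by (rule integrableL_bound[OF integrable_lborel_pair_mult[OF iF g1]])
       (auto simp: norm_mult simp del: of_real_mult)
  have J2: "integrable (lborel \<Otimes>\<^sub>M lborel) (\<lambda>(w, s). cnj (g s) * cnj (?E w s) * (?E w t * of_real (?e w)))" for t
    by (rule integrableL_bound[OF integrable_lborel_pair_mult[OF ie g1]])
       (auto simp: norm_mult simp del: of_real_mult)
  let ?n = "\<lambda>h. complex_of_real (2 * pi * normal_density 0 d h)"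
  have inorm: "integrable lborel ?n" by (intro integrable_of_real integrable_mult_right integrable_normal_density d)
  \<comment> \<open>For fixed \<open>h\<close> the integral of the modulus over \<open>t\<close> is
    bounded by the energy of \<open>g\<close> uniformly in \<open>h\<close>, and the normal density
    is integrable in \<open>h\<close>.\<close>
  have J3: "integrable (lborel \<Otimes>\<^sub>M lborel) (\<lambda>(h, t). g t * (cnj (g (t - h)) * ?n h))"
  proof (rule lborel_pair.Fubini_integrable)
    have "integrable lborel (\<lambda>h. norm (?n h) * (LI t. norm (g t * cnj (g (t - h)))))"
    proof (rule integrableL_bound[OF integrable_mult_left[OF integrable_norm[OF inorm], of "LI t. (norm (g t))\<^sup>2"]])
      show "AE h in lborel. norm (norm (?n h) * (LI t. norm (g t * cnj (g (t - h))))) \<le>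
         norm (norm (?n h) * (LI t. (norm (g t))\<^sup>2))"
        using autocorrelation(4)[OF g1 g2]
        by (intro AE_I2) (auto simp: norm_mult abs_mult intro!: mult_left_mono mult_nonneg_nonneg)
    qed measurable
    also have "(\<lambda>h. norm (?n h) * (LI t. norm (g t * cnj (g (t - h))))) =
       (\<lambda>h. LI t. norm (case (h, t) of (h, t) \<Rightarrow> g t * (cnj (g (t - h)) * ?n h)))"
      by (intro ext integral_eq_mult[symmetric]) (simp only: prod.case norm_mult mult_ac)
    finally show "integrable lborel \<dots>" .
    show "AE h in lborel. integrable lborel (\<lambda>t. case (h, t) of (h, t) \<Rightarrow> g t * (cnj (g (t - h)) * ?n h))"
    proof (rule AE_I2)
      fix h
      show "integrable lborel (\<lambda>t. case (h, t) of (h, t) \<Rightarrow> g t * (cnj (g (t - h)) * ?n h))"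
        using integrable_mult_left[OF autocorrelation(1)[OF g1 g2], of h "?n h"]
        unfolding prod.case mult.assoc[symmetric] by simp
    qed
  qed measurable
  have "complex_of_real (LI w. (norm (fourier g w))\<^sup>2 * ?e w)
    = (LI w. complex_of_real ((norm (fourier g w))\<^sup>2 * ?e w))"
    by (rule integral_complex_of_real[symmetric])
  \<comment> \<open>Only one of the two factors is written out as an integral here; its conjugate
    stays a bounded function of \<open>w\<close> until the first exchange is done.\<close>
  also have "\<dots> = (LI w. (LI t. g t * ?E w t * (cnj (fourier g w) * of_real (?e w))))"
  proof (rule integralL_cong)
    fix w
    have "(LI t. g t * ?E w t * (cnj (fourier g w) * of_real (?e w))) = fourier g w * (cnj (fourier g w) * of_real (?e w))"
      unfolding fourier_def[of g w] by (rule integral_mult_left_zero)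
    then show "complex_of_real ((norm (fourier g w))\<^sup>2 * ?e w) = (LI t. g t * ?E w t * (cnj (fourier g w) * of_real (?e w)))"
      by (simp only: of_real_mult complex_norm_square mult.assoc)
  qed simp
  also have "\<dots> = (LI t. (LI w. g t * ?E w t * (cnj (fourier g w) * of_real (?e w))))"
    by (rule lborel_pair.Fubini_integral[OF J1, symmetric])
  also have "\<dots> = (LI t. g t * (LI w. (LI s. cnj (g s) * cnj (?E w s) * (?E w t * of_real (?e w)))))"
  proof (rule integralL_cong)
    fix t
    have "(LI w. g t * ?E w t * (cnj (fourier g w) * of_real (?e w))) =
        g t * (LI w. cnj (fourier g w) * (?E w t * of_real (?e w)))"
      by (intro integral_eq_mult) (simp only: mult_ac)
    also have "(\<lambda>w. cnj (fourier g w) * (?E w t * of_real (?e w))) = (\<lambda>w. LI s. cnj (g s) * cnj (?E w s) * (?E w t * of_real (?e w)))"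
      by (simp only: fourier_def Bochner_Integration.integral_cnj[symmetric] complex_cnj_mult integral_mult_left_zero)
    finally show "(LI w. g t * ?E w t * (cnj (fourier g w) * of_real (?e w))) =
        g t * (LI w. (LI s. cnj (g s) * cnj (?E w s) * (?E w t * of_real (?e w))))" .
  qed simp
  also have "\<dots> = (LI t. g t * (LI h. cnj (g (t - h)) * ?n h))"
  proof (rule integralL_cong)
    fix t
    have "(LI w. (LI s. cnj (g s) * cnj (?E w s) * (?E w t * of_real (?e w))))
       = (LI s. (LI w. cnj (g s) * cnj (?E w s) * (?E w t * of_real (?e w))))"
      by (rule lborel_pair.Fubini_integral[OF J2, symmetric])
    also have "\<dots> = (LI s. cnj (g s) * (LI w. exp (\<i> * of_real (w * (s - t))) * of_real (?e w)))"
    proof (rule integralL_cong[OF refl], rule integral_eq_mult)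
      fix s w
      have "cnj (?E w s) * ?E w t = exp (\<i> * of_real (w * (s - t)))"
        by (simp add: exp_cnj flip: exp_add) (simp add: algebra_simps)
      from this[symmetric] show "cnj (g s) * cnj (?E w s) * (?E w t * of_real (?e w)) =
          cnj (g s) * (exp (\<i> * of_real (w * (s - t))) * of_real (?e w))"
        by (simp only: mult.assoc)
    qed
    also have "\<dots> = (LI s. cnj (g s) * ?n (s - t))"
      by (subst integral_gaussian_exp[OF d]) simp
    also have "\<dots> = (LI h. cnj (g (t - h)) * ?n h)"
    proof -
      have "(LI s. cnj (g s) * ?n (s - t)) = \<bar>-1\<bar> *\<^sub>R (LI h. cnj (g (t + -1 * h)) * ?n ((t + -1 * h) - t))"
        by (rule lborel_integral_real_affine) simp
      also have "\<dots> = (LI h. cnj (g (t - h)) * ?n h)"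
        by (simp add: normal_density_def)
      finally show ?thesis .
    qed
    finally show "g t * (LI w. (LI s. cnj (g s) * cnj (?E w s) * (?E w t * of_real (?e w)))) =
       g t * (LI h. cnj (g (t - h)) * ?n h)"
      by (rule arg_cong)
  qed simp
  also have "\<dots> = (LI t. (LI h. g t * (cnj (g (t - h)) * ?n h)))"
    by (simp only: integral_mult_right_zero)
  also have "\<dots> = (LI h. (LI t. g t * (cnj (g (t - h)) * ?n h)))"
    by (rule lborel_pair.Fubini_integral[OF J3])
  also have "\<dots> = (LI h. ?n h * (LI t. g t * cnj (g (t - h))))"
    by (rule integralL_cong[OF refl], rule integral_eq_mult) (simp only: mult_ac)
  finally show ?thesis .
qed

text \<open>The substitution \<open>h = d * x\<close> freezes the density and moves \<open>d\<close>
  into the shift, so that letting \<open>d\<close> tend to 0 acts on the translation alone.\<close>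

lemma fourier_gaussian_weight:
  fixes g :: "real \<Rightarrow> complex"
  assumes g1: "integrable lborel g" and g2: "integrable lborel (\<lambda>t. (norm (g t))\<^sup>2)" and d: "0 < d"
  shows "(LI w. (norm (fourier g w))\<^sup>2 * exp (- (d * w)\<^sup>2 / 2))
    = 2 * pi * (LI x. std_normal_density x * ((LI t. (norm (g t))\<^sup>2) - (LI t. (norm (g (t - d * x) - g t))\<^sup>2) / 2))"
proof -
  have [measurable]: "g \<in> borel_measurable borel" using g1 by auto
  have eq: "complex_of_real (LI w. (norm (fourier g w))\<^sup>2 * exp (- (d * w)\<^sup>2 / 2)) =
     (LI x. complex_of_real (2 * pi * std_normal_density x) * (LI t. g t * cnj (g (t - d * x))))"
  proof -
    have scale: "d *\<^sub>R complex_of_real a = complex_of_real (d * a)" for a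
      by (simp add: scaleR_conv_of_real)
    have dn0: "d * (2 * pi * normal_density 0 d (d * x)) = 2 * pi * std_normal_density x" for x
      using d unfolding normal_density_0_scale[OF d] by simp
    have dn: "d *\<^sub>R complex_of_real (2 * pi * normal_density 0 d (d * x)) = complex_of_real (2 * pi * std_normal_density x)" for x
      by (simp only: scale dn0)
    have pt: "d *\<^sub>R (complex_of_real (2 * pi * normal_density 0 d (0 + d * x)) * (LI t. g t * cnj (g (t - (0 + d * x))))) = complex_of_real (2 * pi * std_normal_density x) * (LI t. g t * cnj (g (t - d * x)))" for x
      unfolding mult_scaleR_left[symmetric] add_0 dn ..
    have "(LI h. complex_of_real (2 * pi * normal_density 0 d h) * (LI t. g t * cnj (g (t - h)))) =
        \<bar>d\<bar> *\<^sub>R (LI x. complex_of_real (2 * pi * normal_density 0 d (0 + d * x)) * (LI t. g t * cnj (g (t - (0 + d * x)))))"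
      using d by (intro lborel_integral_real_affine) simp
    also have "\<dots> = (LI x. complex_of_real (2 * pi * std_normal_density x) * (LI t. g t * cnj (g (t - d * x))))"
      unfolding abs_of_pos[OF d] integral_scaleR_right[symmetric] by (simp only: pt)
    finally show ?thesis unfolding fourier_gaussian_weight_aux[OF assms] .
  qed
  have i: "integrable lborel (\<lambda>x. complex_of_real (2 * pi * std_normal_density x) * (LI t. g t * cnj (g (t - d * x))))"
  proof (rule integrableL_bound[where f="\<lambda>x. 2 * pi * std_normal_density x * (LI t. (norm (g t))\<^sup>2)"])
    show "AE x in lborel. norm (complex_of_real (2 * pi * std_normal_density x) * (LI t. g t * cnj (g (t - d * x)))) \<le>
       norm (2 * pi * std_normal_density x * (LI t. (norm (g t))\<^sup>2))"
      using autocorrelation(3)[OF g1 g2]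
      by (intro AE_I2) (auto simp: norm_mult abs_mult intro!: mult_left_mono mult_nonneg_nonneg)
  qed (auto intro!: integrable_normal_density)
  from arg_cong[OF eq, of Re] have "(LI w. (norm (fourier g w))\<^sup>2 * exp (- (d * w)\<^sup>2 / 2)) = Re (LI x. complex_of_real (2 * pi * std_normal_density x) * (LI t. g t * cnj (g (t - d * x))))"
    by (simp only: Re_complex_of_real)
  also have "\<dots> = (LI x. Re (complex_of_real (2 * pi * std_normal_density x) * (LI t. g t * cnj (g (t - d * x)))))"
    using i by (rule integral_Re[symmetric])
  also have "\<dots> = (LI x. 2 * pi * (std_normal_density x * ((LI t. (norm (g t))\<^sup>2) - (LI t. (norm (g (t - d * x) - g t))\<^sup>2) / 2)))"
    by (rule integralL_cong) (simp_all add: autocorrelation(2)[OF g1 g2])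
  finally show ?thesis by simp
qed

text \<open>As \<open>d\<close> decreases to 0 the Gaussian weights increase to 1, so monotone
  convergence settles the frequency side before the transform is known to be square integrable. The
  time side converges by dominated convergence and L2 continuity of translation.\<close>

theorem plancherel:
  fixes g :: "real \<Rightarrow> complex"
  assumes g1: "integrable lborel g" and g2: "integrable lborel (\<lambda>t. (norm (g t))\<^sup>2)"
  shows "(\<integral>\<^sup>+ w. ennreal ((norm (fourier g w))\<^sup>2) \<partial>lborel) = ennreal (2 * pi * (LI t. (norm (g t))\<^sup>2))"
proof -
  have [measurable]: "g \<in> borel_measurable borel" using g1 by auto
  define d where "d = (\<lambda>n. 1 / real (Suc n))"
  have d: "0 < d n" for n by (simp add: d_def)
  have dec: "d (Suc n) \<le> d n" for n by (simp add: d_def frac_le)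
  have d0: "d \<longlonglongrightarrow> 0" unfolding d_def by (rule LIMSEQ_Suc[OF lim_1_over_n])
  let ?I = "LI t. (norm (g t))\<^sup>2"
  let ?f = "\<lambda>n w. (norm (fourier g w))\<^sup>2 * exp (- (d n * w)\<^sup>2 / 2)"
  have ig: "integrable lborel (\<lambda>w. (LI t. norm (g t))\<^sup>2 * exp (- (d n * w)\<^sup>2 / 2))" for n
    using integrable_gaussian[of "d n"] d[of n] by (intro integrable_mult_right) simp
  have int: "integrable lborel (?f n)" for n
    by (rule integrableL_bound[OF ig[of n]])
       (use d[of n] in \<open>auto simp: abs_mult intro!: AE_I2 mult_right_mono power_mono norm_fourier_le\<close>)
  have inc: "incseq (\<lambda>n w. ennreal (?f n w))"
    by (intro incseq_SucI le_funI ennreal_leI mult_left_mono)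
       (use d dec in \<open>auto simp: power_mult_distrib intro!: mult_right_mono power_mono less_imp_le[OF d]\<close>)
  have pt: "(SUP n. ennreal (?f n w)) = ennreal ((norm (fourier g w))\<^sup>2)" for w
  proof (rule LIMSEQ_unique[OF LIMSEQ_SUP])
    show "incseq (\<lambda>n. ennreal (?f n w))" using inc by (simp add: incseq_def le_fun_def)
    have "(\<lambda>n. ?f n w) \<longlonglongrightarrow> (norm (fourier g w))\<^sup>2 * exp (- (0 * w)\<^sup>2 / 2)"
      by (intro tendsto_mult[OF tendsto_const] tendsto_exp tendsto_divide[OF _ tendsto_const] tendsto_minus tendsto_power
           tendsto_mult[OF d0 tendsto_const]) simp
    then show "(\<lambda>n. ennreal (?f n w)) \<longlonglongrightarrow> ennreal ((norm (fourier g w))\<^sup>2)"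
      by (intro tendsto_ennrealI) simp
  qed
  have "(\<lambda>n. LI x. std_normal_density x * (?I - (LI t. (norm (g (t - d n * x) - g t))\<^sup>2) / 2)) \<longlonglongrightarrow>
     (LI x. std_normal_density x * (?I - 0 / 2))"
  proof (rule integral_dominated_convergence[where w = "\<lambda>x. std_normal_density x * ?I"])
    show "AE x in lborel. (\<lambda>n. std_normal_density x * (?I - (LI t. (norm (g (t - d n * x) - g t))\<^sup>2) / 2)) \<longlonglongrightarrow> std_normal_density x * (?I - 0 / 2)"
      by (intro AE_I2 tendsto_mult[OF tendsto_const] tendsto_diff[OF tendsto_const] tendsto_divide[OF _ tendsto_const]
           L2_translation_tendsto g1 g2 tendsto_mult_left_zero d0) simp
    show "AE x in lborel. norm (std_normal_density x * (?I - (LI t. (norm (g (t - d n * x) - g t))\<^sup>2) / 2)) \<le> std_normal_density x * ?I" for n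
    proof (rule AE_I2)
      fix x
      have "\<bar>?I - (LI t. (norm (g (t - d n * x) - g t))\<^sup>2) / 2\<bar> \<le> ?I"
        using order_trans[OF abs_Re_le_cmod autocorrelation(3)[OF g1 g2, of "d n * x"]]
        unfolding autocorrelation(2)[OF g1 g2] .
      then show "norm (std_normal_density x * (?I - (LI t. (norm (g (t - d n * x) - g t))\<^sup>2) / 2)) \<le> std_normal_density x * ?I"
        by (simp add: abs_mult mult_left_mono)
    qed
  qed auto
  then have "(\<lambda>n. 2 * pi * (LI x. std_normal_density x * (?I - (LI t. (norm (g (t - d n * x) - g t))\<^sup>2) / 2))) \<longlonglongrightarrow> 2 * pi * ?I"
    by (intro tendsto_mult tendsto_const) simp
  then have "(\<lambda>n. LI w. ?f n w) \<longlonglongrightarrow> 2 * pi * ?I"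
    by (simp only: fourier_gaussian_weight[OF g1 g2 d])
  then have lim: "(\<lambda>n. \<integral>\<^sup>+ w. ennreal (?f n w) \<partial>lborel) \<longlonglongrightarrow> ennreal (2 * pi * ?I)"
    by (subst nn_integral_eq_integral[OF int]) (auto intro!: tendsto_ennrealI)
  have "(\<integral>\<^sup>+ w. ennreal ((norm (fourier g w))\<^sup>2) \<partial>lborel) = (\<integral>\<^sup>+ w. (SUP n. ennreal (?f n w)) \<partial>lborel)"
    by (simp only: pt)
  also have "\<dots> = (SUP n. \<integral>\<^sup>+ w. ennreal (?f n w) \<partial>lborel)"
    by (rule nn_integral_monotone_convergence_SUP[OF inc]) measurable
  also have "\<dots> = ennreal (2 * pi * ?I)"
    by (rule LIMSEQ_unique[OF LIMSEQ_SUP lim])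
       (use inc in \<open>auto simp: incseq_def le_fun_def intro!: nn_integral_mono\<close>)
  finally show ?thesis .
qed

section \<open>Differentiation under the Laplace integral\<close>

lemma norm_exp_minus_one_le: "norm (exp z - 1) \<le> norm z * exp (norm z)" for z :: complex
proof -
  have "norm (exp z - exp 0) \<le> exp (norm z) * norm (z - 0)"
  proof (rule field_differentiable_bound[where S = "cball 0 (norm z)" and f' = exp])
    fix w :: complex assume "w \<in> cball 0 (norm z)"
    then have "norm w \<le> norm z" by simp
    then show "norm (exp w) \<le> exp (norm z)"
      using norm_exp[of w] by (meson exp_le_cancel_iff order_trans)
  qed (auto intro!: derivative_eq_intros)
  then show ?thesis by (simp add: mult.commute)
qed

text \<open>The difference quotients at \<open>s\<close> are dominated by the integrand at
  \<open>s - e\<close> and \<open>s + e\<close>. Since \<open>k\<close> may have any support, this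
  covers transforms on the half-plane as well as entire transforms of functions of bounded
  support.\<close>

lemma holomorphic_laplace_integral:
  fixes k :: "real \<Rightarrow> complex"
  assumes k [measurable]: "k \<in> borel_measurable borel" and U: "open U"
    and int: "\<And>s. s \<in> U \<Longrightarrow> integrable lborel (\<lambda>t. k t * exp (- (s * of_real t)))"
  shows "(\<lambda>s. LI t. k t * exp (- (s * of_real t))) holomorphic_on U"
  unfolding holomorphic_on_open[OF U]
proof
  fix s assume s: "s \<in> U"
  then obtain e where e: "0 < e" "cball s e \<subseteq> U" using U open_contains_cball by blast
  \<comment> \<open>One half of \<open>e\<close> absorbs the factor \<open>\<bar>t\<bar>\<close>
    through \<open>d * \<bar>t\<bar> \<le> exp (d * \<bar>t\<bar>)\<close>; the other half covers
    the growth \<open>exp (d * \<bar>t\<bar>)\<close> of the difference quotient.\<close>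
  define d where "d = e / 2"
  have d: "0 < d" "2 * d = e" using e by (auto simp: d_def)
  let ?F = "\<lambda>s t. k t * exp (- (s * of_real t))"
  define D where "D = (LI t. - of_real t * ?F s t)"
  define w where "w = (\<lambda>t. (1 / d) * (norm (?F (s - of_real e) t) + norm (?F (s + of_real e) t)))"
  have iw: "integrable lborel w" unfolding w_def
    using e by (intro integrable_mult_right integrableL_add integrable_norm int) (auto simp: dist_norm subset_eq)
  have bound: "norm (?F s t) * (\<bar>t\<bar> * exp (d * \<bar>t\<bar>)) \<le> w t" for t
  proof -
    have "d * \<bar>t\<bar> \<le> exp (d * \<bar>t\<bar>)" using exp_ge_add_one_self[of "d * \<bar>t\<bar>"] by linarith
    then have "\<bar>t\<bar> \<le> exp (d * \<bar>t\<bar>) / d" using d by (simp add: field_simps)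
    then have "\<bar>t\<bar> * exp (d * \<bar>t\<bar>) \<le> exp (d * \<bar>t\<bar>) / d * exp (d * \<bar>t\<bar>)" by (intro mult_right_mono) auto
    also have "\<dots> = (1 / d) * exp (e * \<bar>t\<bar>)"
      by (simp add: d(2)[symmetric] flip: exp_add)
    also have "\<dots> \<le> (1 / d) * (exp (e * t) + exp (- (e * t)))"
      using d by (intro mult_left_mono) (auto simp: abs_if)
    finally have "norm (?F s t) * (\<bar>t\<bar> * exp (d * \<bar>t\<bar>)) \<le> norm (?F s t) * ((1 / d) * (exp (e * t) + exp (- (e * t))))"
      by (intro mult_left_mono) auto
    also have "\<dots> = w t"
    proof -
      have "norm (?F z t) = norm (k t) * exp (- (Re z * t))" for z by (simp add: norm_mult)
      then show ?thesis unfolding w_def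
        by (simp only: minus_complex.sel plus_complex.sel Re_complex_of_real) (simp add: algebra_simps flip: exp_add)
    qed
    finally show ?thesis .
  qed
  have "((\<lambda>h. ((LI t. ?F (s + h) t) - (LI t. ?F s t)) / h) \<longlongrightarrow> D) (at 0)"
    unfolding LIMSEQ_SEQ_conv[symmetric]
  proof (intro allI impI, elim conjE)
    fix S :: "nat \<Rightarrow> complex" assume S: "\<forall>n. S n \<noteq> 0" "S \<longlonglongrightarrow> 0"
    from LIMSEQ_D[OF S(2) d(1)] obtain N where N: "\<And>n. n \<ge> N \<Longrightarrow> norm (S n) < d" by auto
    let ?S = "\<lambda>n. S (n + N)"
    have S0: "?S \<longlonglongrightarrow> 0" using S(2) by (rule LIMSEQ_ignore_initial_segment)
    have Sn: "?S n \<noteq> 0" "norm (?S n) \<le> d" for n using S N[of "n + N"] by auto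
    have "(\<lambda>n. LI t. (?F (s + ?S n) t - ?F s t) / ?S n) \<longlonglongrightarrow> D"
      unfolding D_def
    proof (rule integral_dominated_convergence[where w = w])
      show "AE t in lborel. (\<lambda>n. (?F (s + ?S n) t - ?F s t) / ?S n) \<longlonglongrightarrow> - of_real t * ?F s t"
      proof (rule AE_I2)
        fix t :: real
        have "((\<lambda>z. exp (- (z * of_real t))) has_field_derivative (- of_real t * exp (- (s * of_real t)))) (at s)"
          by (auto intro!: derivative_eq_intros)
        then have "((\<lambda>h. (exp (- ((s + h) * of_real t)) - exp (- (s * of_real t))) / h) \<longlongrightarrow> - of_real t * exp (- (s * of_real t))) (at 0)"
          by (simp add: DERIV_def)
        then have "(\<lambda>n. (exp (- ((s + ?S n) * of_real t)) - exp (- (s * of_real t))) / ?S n) \<longlonglongrightarrow> - of_real t * exp (- (s * of_real t))"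
          using Sn(1) S0 unfolding LIMSEQ_SEQ_conv[symmetric] by (auto simp: o_def)
        then have "(\<lambda>n. k t * ((exp (- ((s + ?S n) * of_real t)) - exp (- (s * of_real t))) / ?S n)) \<longlonglongrightarrow> k t * (- of_real t * exp (- (s * of_real t)))"
          by (rule tendsto_mult_left)
        then show "(\<lambda>n. (?F (s + ?S n) t - ?F s t) / ?S n) \<longlonglongrightarrow> - of_real t * ?F s t"
          by (simp add: algebra_simps diff_divide_distrib)
      qed
      fix n
      show "AE t in lborel. norm ((?F (s + ?S n) t - ?F s t) / ?S n) \<le> w t"
      proof (rule AE_I2)
        fix t :: real
        have eq: "(?F (s + ?S n) t - ?F s t) / ?S n = ?F s t * ((exp (- (?S n * of_real t)) - 1) / ?S n)"
          by (simp add: algebra_simps exp_add exp_diff exp_minus divide_inverse)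
        have le: "norm ((exp (- (?S n * of_real t)) - 1) / ?S n) \<le> \<bar>t\<bar> * exp (d * \<bar>t\<bar>)"
        proof -
          have "norm (exp (- (?S n * of_real t)) - 1) \<le> norm (?S n) * \<bar>t\<bar> * exp (norm (?S n) * \<bar>t\<bar>)"
            using norm_exp_minus_one_le[of "- (?S n * of_real t)"] by (simp add: norm_mult)
          also have "\<dots> \<le> norm (?S n) * \<bar>t\<bar> * exp (d * \<bar>t\<bar>)"
            using Sn[of n] by (intro mult_left_mono) (auto intro: mult_right_mono)
          finally show ?thesis using Sn(1)[of n] by (simp add: norm_divide field_simps)
        qed
        have "norm ((?F (s + ?S n) t - ?F s t) / ?S n) \<le> norm (?F s t) * (\<bar>t\<bar> * exp (d * \<bar>t\<bar>))"
          unfolding eq norm_mult[of "?F s t"] by (intro mult_left_mono le norm_ge_zero)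
        then show "norm ((?F (s + ?S n) t - ?F s t) / ?S n) \<le> w t" using bound[of t] by linarith
      qed
    qed (use iw in measurable)
    moreover have "(LI t. (?F (s + ?S n) t - ?F s t) / ?S n) = ((LI t. ?F (s + ?S n) t) - (LI t. ?F s t)) / ?S n" for n
    proof -
      have "s + ?S n \<in> U" using e Sn(2)[of n] d by (auto simp: subset_eq dist_norm)
      then show ?thesis
        unfolding integral_divide_zero by (subst integralL_diff[OF int int[OF s]]) auto
    qed
    ultimately have "(\<lambda>n. ((LI t. ?F (s + ?S n) t) - (LI t. ?F s t)) / ?S n) \<longlonglongrightarrow> D"
      by (simp only:)
    then show "(\<lambda>n. ((LI t. ?F (s + S n) t) - (LI t. ?F s t)) / S n) \<longlonglongrightarrow> D"
      by (rule LIMSEQ_offset)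
  qed
  then show "\<exists>f'. ((\<lambda>s. LI t. ?F s t) has_field_derivative f') (at s)"
    unfolding DERIV_def by blast
qed

lemma exponential_halfline:
  assumes "0 < c"
  shows "integrable lborel (\<lambda>t. indicator {0..} t * exp (- (c * t)) :: real)"
    and "(LI t. indicator {0..} t * exp (- (c * t))) = 1 / c"
proof -
  have "(\<integral>\<^sup>+t. ennreal (exponential_density c t) \<partial>lborel) = 1"
    using nn_integral_erlang_ith_moment[of c 0 0] assms by simp
  then have h: "has_bochner_integral lborel (exponential_density c) 1"
    using assms by (intro has_bochner_integral_nn_integral) (auto simp: exponential_density_def)
  have eq: "(\<lambda>t. indicator {0..} t * exp (- (c * t)) :: real) = (\<lambda>t. (1 / c) * exponential_density c t)"
    using assms by (auto simp: exponential_density_def indicator_def mult.commute)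
  show "integrable lborel (\<lambda>t. indicator {0..} t * exp (- (c * t)) :: real)"
    unfolding eq using h by (intro integrable_mult_right) (auto simp: has_bochner_integral_iff)
  show "(LI t. indicator {0..} t * exp (- (c * t))) = 1 / c"
    unfolding eq using h by (simp add: has_bochner_integral_iff)
qed

section \<open>Square-integrable functions and their Laplace transforms\<close>

text \<open>Everywhere defined Borel representatives that vanish before time 0: integrals over the
  half-line become integrals over \<open>lborel\<close>, and delays and truncations become pointwise
  operations.\<close>

definition sqint :: "(real \<Rightarrow> complex ^ 'm) \<Rightarrow> bool" where
  "sqint f \<longleftrightarrow> f \<in> borel_measurable borel \<and> (\<forall>t<0. f t = 0) \<and> integrable lborel (\<lambda>t. (norm (f t))\<^sup>2)"

definition Lap :: "(real \<Rightarrow> complex ^ 'm) \<Rightarrow> complex \<Rightarrow> complex ^ 'm" where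
  "Lap f s = (\<chi> i. LI t. f t $ i * exp (- (s * of_real t)))"

lemma sqint_measurable [measurable_dest]: "sqint f \<Longrightarrow> f \<in> borel_measurable borel"
  by (simp add: sqint_def)

lemma borel_measurable_cvec_nth [measurable (raw)]:
  fixes f :: "'a \<Rightarrow> complex ^ 'm"
  assumes "f \<in> borel_measurable M"
  shows "(\<lambda>x. f x $ i) \<in> borel_measurable M"
  by (rule borel_measurable_continuous_on[OF _ assms]) (intro continuous_intros)

lemma norm_cvec_power2: "(norm v)\<^sup>2 = (\<Sum>i\<in>UNIV. (norm (v $ i))\<^sup>2)" for v :: "complex ^ 'm"
  by (simp add: norm_vec_def L2_set_def sum_nonneg)

lemma sqint_diff:
  assumes "sqint f" "sqint g"
  shows "sqint (\<lambda>t. f t - g t)"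
proof -
  note [measurable] = sqint_measurable[OF assms(1)] sqint_measurable[OF assms(2)]
  have "integrable lborel (\<lambda>t. (norm (f t - g t))\<^sup>2)"
  proof (rule integrableL_bound)
    show "integrable lborel (\<lambda>t. 2 * ((norm (f t))\<^sup>2 + (norm (g t))\<^sup>2))"
      using assms by (simp add: sqint_def)
    show "AE t in lborel. norm ((norm (f t - g t))\<^sup>2) \<le> norm (2 * ((norm (f t))\<^sup>2 + (norm (g t))\<^sup>2))"
    proof (rule AE_I2)
      fix t
      have "(norm (f t - g t))\<^sup>2 \<le> (norm (f t) + norm (g t))\<^sup>2"
        by (intro power_mono norm_triangle_ineq4) simp
      also have "\<dots> \<le> 2 * ((norm (f t))\<^sup>2 + (norm (g t))\<^sup>2)"
        using sum_squares_bound[of "norm (f t)" "norm (g t)"] by (simp add: power2_sum)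
      finally show "norm ((norm (f t - g t))\<^sup>2) \<le> norm (2 * ((norm (f t))\<^sup>2 + (norm (g t))\<^sup>2))" by simp
    qed
  qed measurable
  then show ?thesis using assms by (simp add: sqint_def)
qed

lemma sqint_restrict:
  assumes "sqint f" and [measurable]: "A \<in> sets borel"
  shows "sqint (\<lambda>t. if t \<in> A then f t else 0)"
proof -
  note [measurable] = sqint_measurable[OF assms(1)]
  have "integrable lborel (\<lambda>t. (norm (if t \<in> A then f t else 0))\<^sup>2)"
    by (rule integrableL_bound[where f = "\<lambda>t. (norm (f t))\<^sup>2"])
       (use assms in \<open>auto simp: sqint_def\<close>)
  then show ?thesis using assms by (simp add: sqint_def)
qed

lemma sqint_shift:
  assumes "sqint f" "0 \<le> h"
  shows "sqint (\<lambda>t. f (t - h))"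
  using assms integrable_translate[of "\<lambda>t. (norm (f t))\<^sup>2" h] by (auto simp: sqint_def)

lemma sqint_weighted:
  fixes f :: "real \<Rightarrow> complex ^ 'm"
  assumes f: "sqint f" and a: "0 \<le> a"
  shows "(norm (f t))\<^sup>2 * exp (- (2 * a * t)) \<le> (norm (f t))\<^sup>2"
    and "integrable lborel (\<lambda>t. (norm (f t))\<^sup>2 * exp (- (2 * a * t)))"
proof -
  note [measurable] = sqint_measurable[OF f]
  show le: "(norm (f t))\<^sup>2 * exp (- (2 * a * t)) \<le> (norm (f t))\<^sup>2" for t
    using f a by (cases "t < 0") (auto simp: sqint_def mult_left_le)
  show "integrable lborel (\<lambda>t. (norm (f t))\<^sup>2 * exp (- (2 * a * t)))"
    by (rule integrableL_bound[where f = "\<lambda>t. (norm (f t))\<^sup>2"])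
       (use f le in \<open>auto simp: sqint_def\<close>)
qed

text \<open>Cauchy-Schwarz in its pointwise form, the arithmetic-geometric mean inequality with a
  free weight \<open>c\<close>. Integrability takes \<open>c = 1\<close>; the decay estimate
  optimises \<open>c\<close>.\<close>

lemma sqint_exp_bound:
  fixes f :: "real \<Rightarrow> complex ^ 'm"
  assumes f: "sqint f" and v: "\<And>t. t < \<tau> \<Longrightarrow> f t = 0" and c: "0 < c"
  shows "norm (f t $ i * exp (- (s * of_real t))) \<le>
     ((norm (f t))\<^sup>2 / c + c * (indicator {0..} (t - \<tau>) * exp (- (2 * Re s * t)))) / 2"
proof (cases "t < \<tau>")
  case True
  then show ?thesis using v[OF True] c by (simp add: indicator_def)
next
  case False
  let ?a = "norm (f t)" and ?b = "exp (- (Re s * t))"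
  have "norm (f t $ i * exp (- (s * of_real t))) \<le> ?a * ?b"
    by (simp add: norm_mult Finite_Cartesian_Product.norm_nth_le mult_right_mono)
  also have "2 * (?a / sqrt c) * (sqrt c * ?b) \<le> (?a / sqrt c)\<^sup>2 + (sqrt c * ?b)\<^sup>2"
    by (rule sum_squares_bound)
  then have "?a * ?b \<le> (?a\<^sup>2 / c + c * ?b\<^sup>2) / 2"
    using c by (simp add: power_divide power_mult_distrib)
  also have "?b\<^sup>2 = indicator {0..} (t - \<tau>) * exp (- (2 * Re s * t))"
    using False by (simp add: power2_eq_square flip: exp_add)
  finally show ?thesis .
qed

lemma exponential_halfline_shift:
  assumes "0 < c"
  shows "integrable lborel (\<lambda>t. indicator {0..} (t - \<tau>) * exp (- (c * t)) :: real)"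
    and "(LI t. indicator {0..} (t - \<tau>) * exp (- (c * t))) = exp (- (c * \<tau>)) / c"
proof -
  have eq: "(\<lambda>t. indicator {0..} (t - \<tau>) * exp (- (c * t)) :: real) = 
     (\<lambda>t. exp (- (c * \<tau>)) * (\<lambda>t. indicator {0..} t * exp (- (c * t))) (t - \<tau>))"
    by (auto simp: algebra_simps simp flip: exp_add)
  show "integrable lborel (\<lambda>t. indicator {0..} (t - \<tau>) * exp (- (c * t)) :: real)"
    unfolding eq by (intro integrable_mult_right integrable_translate exponential_halfline assms)
  show "(LI t. indicator {0..} (t - \<tau>) * exp (- (c * t))) = exp (- (c * \<tau>)) / c"
    unfolding eq integral_mult_right_zero
    using integral_translate[of "\<lambda>t. indicator {0..} t * exp (- (c * t))" \<tau>] exponential_halfline(2)[OF assms] by simp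
qed

lemma sqint_laplace_integrable:
  fixes f :: "real \<Rightarrow> complex ^ 'm"
  assumes f: "sqint f" and s: "0 < Re s"
  shows "integrable lborel (\<lambda>t. f t $ i * exp (- (s * of_real t)))"
proof -
  note [measurable] = sqint_measurable[OF f]
  have "integrable lborel (\<lambda>t. ((norm (f t))\<^sup>2 / 1 + 1 * (indicator {0..} (t - 0) * exp (- (2 * Re s * t)))) / 2)"
    using f s by (intro Bochner_Integration.integrable_divide integrableL_add integrable_mult_right exponential_halfline_shift)
       (auto simp: sqint_def)
  moreover have "AE t in lborel. norm (f t $ i * exp (- (s * of_real t))) \<le> norm (((norm (f t))\<^sup>2 / 1 + 1 * (indicator {0..} (t - 0) * exp (- (2 * Re s * t)))) / 2)"
  proof (rule AE_I2, rule order_trans)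
    fix t
    show "norm (f t $ i * exp (- (s * of_real t))) \<le> ((norm (f t))\<^sup>2 / 1 + 1 * (indicator {0..} (t - 0) * exp (- (2 * Re s * t)))) / 2"
      by (rule sqint_exp_bound[OF f]) (use f in \<open>auto simp: sqint_def\<close>)
  qed (simp only: real_norm_def abs_ge_self)
  ultimately show ?thesis
    by (intro integrableL_bound[where g = "\<lambda>t. f t $ i * exp (- (s * of_real t))"]) measurable
qed

text \<open>A function that starts at time \<open>\<tau>\<close> has a transform decaying like that
  of a delay, and \<open>1 / sqrt (Re s)\<close> is the order of the L2 norm of
  \<open>exp (- (s * t))\<close> on the half-line. This is the decay that the contour argument for
  causality exploits.\<close>

lemma Lap_bound:
  fixes f :: "real \<Rightarrow> complex ^ 'm"
  assumes f: "sqint f" and v: "\<And>t. t < \<tau> \<Longrightarrow> f t = 0"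
  shows "\<exists>C\<ge>0. \<forall>s. 0 < Re s \<longrightarrow> norm (Lap f s) \<le> C * exp (- (\<tau> * Re s)) / sqrt (Re s)"
proof -
  note [measurable] = sqint_measurable[OF f]
  let ?I = "LI t. (norm (f t))\<^sup>2"
  have I: "0 \<le> ?I" by simp
  have "norm (Lap f s $ i) \<le> (?I + 1) * exp (- (\<tau> * Re s)) / sqrt (Re s)" if s: "0 < Re s" for s i
  proof -
    \<comment> \<open>This value gives both terms of the weighted inequality the order
      \<open>exp (- (\<tau> * Re s)) / sqrt (Re s)\<close>.\<close>
    define c where "c = sqrt (Re s) * exp (\<tau> * Re s)"
    have c: "0 < c" using s by (simp add: c_def)
    have i2: "integrable lborel (\<lambda>t. ((norm (f t))\<^sup>2 / c + c * (indicator {0..} (t - \<tau>) * exp (- (2 * Re s * t)))) / 2)"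
      using f s by (intro Bochner_Integration.integrable_divide integrableL_add integrable_mult_right exponential_halfline_shift)
         (auto simp: sqint_def)
    have "norm (Lap f s $ i) \<le> (LI t. norm (f t $ i * exp (- (s * of_real t))))"
      unfolding Lap_def vec_lambda_beta by (rule integral_norm_bound)
    also have "\<dots> \<le> (LI t. ((norm (f t))\<^sup>2 / c + c * (indicator {0..} (t - \<tau>) * exp (- (2 * Re s * t)))) / 2)"
      by (intro integral_mono i2 integrable_norm sqint_laplace_integrable f s sqint_exp_bound v c)
    also have "\<dots> = (?I / c + c * (exp (- (2 * Re s * \<tau>)) / (2 * Re s))) / 2"
      using f s exponential_halfline_shift[of "2 * Re s" \<tau>] by (simp add: sqint_def)
    also have "c * (exp (- (2 * Re s * \<tau>)) / (2 * Re s)) = (1 / 2) * (exp (- (\<tau> * Re s)) / sqrt (Re s))"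
    proof -
      define r e where "r = sqrt (Re s)" and "e = exp (- (\<tau> * Re s))"
      have r: "Re s = r * r" "0 < r" and e: "exp (- (2 * Re s * \<tau>)) = e * e" "exp (\<tau> * Re s) = 1 / e" "0 < e"
        using s by (simp_all add: r_def e_def exp_minus field_simps flip: exp_add)
      have "r * (1 / e) * (e * e / (2 * (r * r))) = 1 / 2 * (e / r)"
        using r(2) e(3) by simp
      then show ?thesis unfolding c_def r_def[symmetric] e(1,2) e_def[symmetric] r(1)[symmetric] .
    qed
    also have "?I / c = ?I * (exp (- (\<tau> * Re s)) / sqrt (Re s))"
      by (simp add: c_def exp_minus divide_inverse)
    also have "(?I * (exp (- (\<tau> * Re s)) / sqrt (Re s)) + 1 / 2 * (exp (- (\<tau> * Re s)) / sqrt (Re s))) / 2 =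
       ((?I + 1/2) / 2) * (exp (- (\<tau> * Re s)) / sqrt (Re s))"
    proof -
      have "(x * y + 1 / 2 * y) / 2 = ((x + 1/2) / 2) * y" for x y :: real
        by (simp add: algebra_simps)
      then show ?thesis .
    qed
    also have "\<dots> \<le> (?I + 1) * (exp (- (\<tau> * Re s)) / sqrt (Re s))"
      using I s by (intro mult_right_mono) auto
    finally show ?thesis by simp
  qed
  note b = this
  have "norm (Lap f s) \<le> (real CARD('m) * (?I + 1)) * exp (- (\<tau> * Re s)) / sqrt (Re s)" if s: "0 < Re s" for s
  proof -
    have "norm (Lap f s) \<le> (\<Sum>i\<in>UNIV. norm (Lap f s $ i))" unfolding norm_vec_def by (rule L2_set_le_sum) simp
    also have "\<dots> \<le> (\<Sum>i\<in>(UNIV::'m set). (?I + 1) * exp (- (\<tau> * Re s)) / sqrt (Re s))"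
      by (intro sum_mono b s)
    finally show ?thesis by (simp add: mult.assoc)
  qed
  moreover have "0 \<le> real CARD('m) * (?I + 1)" using I by simp
  ultimately show ?thesis by blast
qed

lemma Lap_diff:
  assumes "sqint f" "sqint g" "0 < Re s"
  shows "Lap (\<lambda>t. f t - g t) s = Lap f s - Lap g s"
  unfolding Lap_def vec_eq_iff
  by (simp add: left_diff_distrib integralL_diff sqint_laplace_integrable assms)

lemma Lap_shift:
  fixes f :: "real \<Rightarrow> complex ^ 'm"
  shows "Lap (\<lambda>t. f (t - h)) s = exp (- (s * of_real h)) *s Lap f s"
proof -
  have "(LI t. f (t - h) $ i * exp (- (s * of_real t))) = exp (- (s * of_real h)) * (LI t. f t $ i * exp (- (s * of_real t)))" for i
  proof -
    have "(LI t. f (t - h) $ i * exp (- (s * of_real t))) =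
        (LI t. (\<lambda>t. exp (- (s * of_real h)) * (f t $ i * exp (- (s * of_real t)))) (t - h))"
    proof (rule integralL_cong[OF refl])
      fix t
      have "- (s * of_real t) = - (s * of_real h) + - (s * of_real (t - h))" by (simp add: algebra_simps)
      then have "exp (- (s * of_real t)) = exp (- (s * of_real h)) * exp (- (s * of_real (t - h)))"
        by (simp only: exp_add)
      then show "f (t - h) $ i * exp (- (s * of_real t)) = (\<lambda>t. exp (- (s * of_real h)) * (f t $ i * exp (- (s * of_real t)))) (t - h)"
        by (simp only: mult_ac)
    qed
    also have "\<dots> = (LI t. exp (- (s * of_real h)) * (f t $ i * exp (- (s * of_real t))))"
      by (rule integral_translate)
    finally show ?thesis by (simp only: integral_mult_right_zero)
  qed
  then show ?thesis by (simp add: Lap_def vec_eq_iff)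
qed

lemma Lap_holomorphic:
  fixes f :: "real \<Rightarrow> complex ^ 'm"
  assumes "sqint f"
  shows "(\<lambda>s. Lap f s $ i) holomorphic_on rhp"
  unfolding Lap_def vec_lambda_beta
proof (rule holomorphic_laplace_integral)
  show "open rhp" unfolding rhp_def by (rule open_halfspace_Re_gt)
qed (use assms sqint_laplace_integrable[OF assms] in \<open>auto simp: rhp_def\<close>)

text \<open>Damping by \<open>exp (- (a * t))\<close> with \<open>a > 0\<close> puts each component
  into both L1 and L2, where Plancherel's identity applies; the components are then summed.\<close>

lemma Lap_plancherel:
  fixes f :: "real \<Rightarrow> complex ^ 'm"
  assumes f: "sqint f" and a: "0 < a"
  shows "(\<integral>\<^sup>+ w. ennreal ((norm (Lap f (Complex a w)))\<^sup>2) \<partial>lborel) =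
     ennreal (2 * pi * (LI t. (norm (f t))\<^sup>2 * exp (- (2 * a * t))))"
proof -
  note [measurable] = sqint_measurable[OF f]
  define g where "g = (\<lambda>i t. f t $ i * exp (- (of_real a * complex_of_real t)))"
  have gm[measurable]: "g i \<in> borel_measurable borel" for i unfolding g_def by measurable
  have g1: "integrable lborel (g i)" for i
    unfolding g_def using sqint_laplace_integrable[OF f, of "of_real a" i] a by simp
  have gn: "(norm (g i t))\<^sup>2 = (norm (f t $ i))\<^sup>2 * exp (- (2 * a * t))" for i t
    by (simp add: g_def norm_mult power_mult_distrib power2_eq_square[of "exp _"] flip: exp_add)
  have gs: "(\<Sum>i\<in>UNIV. (norm (g i t))\<^sup>2) = (norm (f t))\<^sup>2 * exp (- (2 * a * t))" for t
    unfolding gn by (simp add: norm_cvec_power2 sum_distrib_right)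
  have g2: "integrable lborel (\<lambda>t. (norm (g i t))\<^sup>2)" for i
  proof (rule integrableL_bound[where f = "\<lambda>t. (norm (f t))\<^sup>2"])
    show "AE t in lborel. norm ((norm (g i t))\<^sup>2) \<le> norm ((norm (f t))\<^sup>2)"
    proof (rule AE_I2)
      fix t
      have "(norm (g i t))\<^sup>2 \<le> (\<Sum>i\<in>UNIV. (norm (g i t))\<^sup>2)" by (rule member_le_sum) auto
      also have "\<dots> \<le> (norm (f t))\<^sup>2" unfolding gs by (rule sqint_weighted(1)[OF f less_imp_le[OF a]])
      finally show "norm ((norm (g i t))\<^sup>2) \<le> norm ((norm (f t))\<^sup>2)" by simp
    qed
  qed (use f in \<open>auto simp: sqint_def\<close>)
  have L: "Lap f (Complex a w) $ i = fourier (g i) w" for w i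
    unfolding Lap_def fourier_def g_def vec_lambda_beta
  proof (rule integralL_cong[OF refl])
    fix t
    have "Complex a w * of_real t = of_real a * of_real t + \<i> * of_real (w * t)"
      by (simp add: complex_eq_iff)
    then show "f t $ i * exp (- (Complex a w * of_real t)) = f t $ i * exp (- (of_real a * of_real t)) * exp (- (\<i> * of_real (w * t)))"
      by (simp only: minus_add_distrib exp_add mult.assoc)
  qed
  have "(\<integral>\<^sup>+ w. ennreal ((norm (Lap f (Complex a w)))\<^sup>2) \<partial>lborel) = (\<integral>\<^sup>+ w. (\<Sum>i\<in>UNIV. ennreal ((norm (fourier (g i) w))\<^sup>2)) \<partial>lborel)"
    unfolding norm_cvec_power2 L by simp
  also have "\<dots> = (\<Sum>i\<in>UNIV. (\<integral>\<^sup>+ w. ennreal ((norm (fourier (g i) w))\<^sup>2) \<partial>lborel))"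
    by (rule nn_integral_sum) measurable
  also have "\<dots> = ennreal (2 * pi * (\<Sum>i\<in>UNIV. LI t. (norm (g i t))\<^sup>2))"
    unfolding plancherel[OF g1 g2] sum_distrib_left by (rule sum_ennreal) simp
  also have "(\<Sum>i\<in>UNIV. LI t. (norm (g i t))\<^sup>2) = (LI t. (norm (f t))\<^sup>2 * exp (- (2 * a * t)))"
    unfolding gs[symmetric] by (rule Bochner_Integration.integral_sum[symmetric]) (rule g2)
  finally show ?thesis .
qed

section \<open>Borel representatives of L2 classes\<close>

definition repr :: "('m::finite) L2 \<Rightarrow> (real \<Rightarrow> complex ^ 'm) \<Rightarrow> bool" where
  "repr u f \<longleftrightarrow> sqint f \<and> u = abs_L2 f"

lemma integrable_halfline_iff:
  fixes g :: "real \<Rightarrow> 'a::{banach, second_countable_topology}"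
  assumes [measurable]: "g \<in> borel_measurable borel" and "\<And>t. t < 0 \<Longrightarrow> g t = 0"
  shows "integrable halfline g \<longleftrightarrow> integrable lborel g"
    and "integral\<^sup>L halfline g = integral\<^sup>L lborel g"
proof -
  have eq: "(\<lambda>t. indicator {0..} t *\<^sub>R g t) = g" using assms(2) by (auto simp: indicator_def)
  have "integrable halfline g \<longleftrightarrow> integrable lebesgue (\<lambda>t. indicator {0..} t *\<^sub>R g t)"
    by (rule integrable_restrict_space) simp
  also have "\<dots> \<longleftrightarrow> integrable lborel g" unfolding eq by (rule integrable_completion) simp
  finally show "integrable halfline g \<longleftrightarrow> integrable lborel g" .
  have "integral\<^sup>L halfline g = integral\<^sup>L lebesgue (\<lambda>t. indicator {0..} t *\<^sub>R g t)"
    by (rule integral_restrict_space) simp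
  also have "\<dots> = integral\<^sup>L lborel g" unfolding eq by (rule integral_completion) simp
  finally show "integral\<^sup>L halfline g = integral\<^sup>L lborel g" .
qed

lemma borel_measurable_halflineI [intro]: 
  "g \<in> borel_measurable borel \<Longrightarrow> g \<in> borel_measurable halfline"
  by (rule measurable_restrict_space1) (rule measurable_completion, simp)

lemma sqint_square_integrable:
  fixes f :: "real \<Rightarrow> complex ^ 'm"
  assumes "sqint f" shows "square_integrable f"
proof -
  note [measurable] = sqint_measurable[OF assms]
  have "integrable halfline (\<lambda>t. (norm (f t))\<^sup>2)"
    by (subst integrable_halfline_iff) (use assms in \<open>auto simp: sqint_def\<close>)
  then show ?thesis using assms by (auto simp: square_integrable_def sqint_def)
qed

lemma sqint_L2_eq: "sqint f \<Longrightarrow> L2_eq f f"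
  by (simp add: L2_eq_def sqint_square_integrable)

lemma sqint_reprI: "sqint f \<Longrightarrow> repr (abs_L2 f) f"
  by (simp add: repr_def)

text \<open>The real-valued case is applied to the finitely many real coordinates, so the
  exceptional null sets are finite in number.\<close>

lemma lebesgue_ex_borel_vec:
  fixes f :: "real \<Rightarrow> complex ^ 'm"
  assumes f: "f \<in> borel_measurable lebesgue"
  shows "\<exists>g\<in>borel_measurable borel. AE t in lborel. f t = g t"
proof -
  have "\<exists>g\<in>borel_measurable lborel. AE t in lborel. f t \<bullet> b = g t" for b
    by (rule completion_ex_borel_measurable_real) (intro borel_measurable_inner f borel_measurable_const)
  then have "\<forall>b. \<exists>g. g \<in> borel_measurable lborel \<and> (AE t in lborel. f t \<bullet> b = g t)"
    unfolding Bex_def by (rule allI)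
  from choice[OF this] obtain g
    where g: "\<And>b. g b \<in> borel_measurable lborel" "\<And>b. AE t in lborel. f t \<bullet> b = g b t" by blast
  have "AE t in lborel. \<forall>b\<in>Basis. f t \<bullet> b = g b t"
    by (rule AE_finite_allI[OF finite_Basis]) (rule g(2))
  then have "AE t in lborel. f t = (\<Sum>b\<in>Basis. g b t *\<^sub>R b)"
  proof eventually_elim
    case (elim t)
    then have "(\<Sum>b\<in>Basis. g b t *\<^sub>R b) = (\<Sum>b\<in>Basis. (f t \<bullet> b) *\<^sub>R b)"
      by (intro sum.cong refl) simp
    then show ?case unfolding euclidean_representation by (rule sym)
  qed
  moreover have "(\<lambda>t. \<Sum>b\<in>Basis. g b t *\<^sub>R b) \<in> borel_measurable borel"
  proof (rule borel_measurable_sum)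
    fix b :: "complex ^ 'm"
    have "g b \<in> borel_measurable borel" using g(1)[of b] by simp
    then show "(\<lambda>t. g b t *\<^sub>R b) \<in> borel_measurable borel"
      by (intro borel_measurable_scaleR borel_measurable_const)
  qed
  ultimately show ?thesis by (rule bexI)
qed

text \<open>The classes consist of Lebesgue measurable functions whose values before time 0 are
  arbitrary: the function is cut off at 0, changed on a null set to become Borel, and cut off once
  more.\<close>

lemma repr_exists: "\<exists>f. repr u f"
proof -
  define f0 where "f0 = rep_L2 u"
  have f0: "L2_eq f0 f0" "u = abs_L2 f0"
    unfolding f0_def by (rule Quotient_rep_reflp[OF Quotient_L2], rule Quotient_abs_rep[OF Quotient_L2, symmetric])
  then have sq: "f0 \<in> borel_measurable halfline" "integrable halfline (\<lambda>t. (norm (f0 t))\<^sup>2)"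
    by (auto simp: L2_eq_def square_integrable_def)
  define f1 where "f1 = (\<lambda>t. indicator {0..} t *\<^sub>R f0 t)"
  have "f1 \<in> borel_measurable lebesgue"
    unfolding f1_def using sq(1) by (subst (asm) borel_measurable_restrict_space_iff) auto
  from lebesgue_ex_borel_vec[OF this] obtain g where g: "g \<in> borel_measurable borel" "AE t in lborel. f1 t = g t" by blast
  note [measurable] = g(1)
  define f where "f = (\<lambda>t. indicator {0..} t *\<^sub>R g t)"
  have fm[measurable]: "f \<in> borel_measurable borel" unfolding f_def by measurable
  have "AE t in lborel. t \<in> {0..} \<longrightarrow> f0 t = f t"
    using g(2) by eventually_elim (auto simp: f1_def f_def indicator_def split: if_splits)
  then have "AE t in lebesgue. t \<in> {0..} \<longrightarrow> f0 t = f t" by (rule AE_completion)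
  then have ae: "AE t in halfline. f0 t = f t"
    by (subst AE_restrict_space_iff) auto
  have int: "integrable halfline (\<lambda>t. (norm (f t))\<^sup>2)"
  proof (rule integrable_cong_AE_imp[OF sq(2)])
    show "(\<lambda>t. (norm (f t))\<^sup>2) \<in> borel_measurable halfline"
      by (rule borel_measurable_halflineI) measurable
    show "AE t in halfline. (norm (f0 t))\<^sup>2 = (norm (f t))\<^sup>2"
      using ae by eventually_elim simp
  qed
  have "sqint f" unfolding sqint_def
    using int by (subst (asm) integrable_halfline_iff) (auto simp: f_def)
  moreover have "L2_eq f0 f" using f0 ae sqint_square_integrable[OF \<open>sqint f\<close>] by (auto simp: L2_eq_def)
  then have "abs_L2 f0 = abs_L2 f" by (rule Quotient_rel_abs[OF Quotient_L2])
  ultimately show ?thesis using f0 by (auto simp: repr_def)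
qed

lemma repr_norm: "repr u f \<Longrightarrow> (norm u)\<^sup>2 = (LI t. (norm (f t))\<^sup>2)"
proof -
  assume r: "repr u f"
  then have f: "sqint f" "u = abs_L2 f" by (auto simp: repr_def)
  note [measurable] = sqint_measurable[OF f(1)]
  have "(norm u)\<^sup>2 = u \<bullet> u" by (simp add: power2_norm_eq_inner)
  also have "\<dots> = integral\<^sup>L halfline (\<lambda>t. f t \<bullet> f t)"
    unfolding f(2) by (rule inner_L2.abs_eq) (use sqint_L2_eq f in auto)
  also have "\<dots> = integral\<^sup>L lborel (\<lambda>t. f t \<bullet> f t)"
    by (rule integrable_halfline_iff) (use f in \<open>auto simp: sqint_def\<close>)
  finally show ?thesis by (simp add: power2_norm_eq_inner)
qed

lemma repr_diff: "repr u f \<Longrightarrow> repr v g \<Longrightarrow> repr (u - v) (\<lambda>t. f t - g t)"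
  unfolding repr_def using sqint_diff minus_L2.abs_eq[OF sqint_L2_eq sqint_L2_eq, of f g] by auto

lemma repr_trunc: "repr u f \<Longrightarrow> repr (P_trunc \<tau> u) (\<lambda>t. if t \<le> \<tau> then f t else 0)"
  unfolding repr_def using sqint_restrict[of f "{..\<tau>}"] P_trunc.abs_eq[OF sqint_L2_eq, of f \<tau>] by auto

lemma repr_laplace:
  fixes u :: "('m::finite) L2"
  assumes "repr u f" "0 < Re s"
  shows "laplace u s = Lap f s"
proof -
  have f: "sqint f" "u = abs_L2 f" using assms by (auto simp: repr_def)
  note [measurable] = sqint_measurable[OF f(1)]
  have e: "(\<lambda>t. exp (- (s * complex_of_real t))) \<in> borel_measurable borel"
    by (intro borel_measurable_continuous_onI continuous_intros)
  have "laplace u s = (\<chi> i. integral\<^sup>L halfline (\<lambda>t. exp (- (s * of_real t)) * f t $ i))"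
    unfolding f(2) laplace.abs_eq[OF sqint_L2_eq[OF f(1)]] using assms(2) by (simp add: rhp_def)
  also have "\<dots> = (\<chi> i. integral\<^sup>L lborel (\<lambda>t. exp (- (s * of_real t)) * f t $ i))"
    by (subst integrable_halfline_iff(2)) (use f(1) e in \<open>auto simp: sqint_def\<close>)
  also have "\<dots> = Lap f s"
    unfolding Lap_def by (simp only: mult.commute)
  finally show ?thesis .
qed

lemma laplace_outside: "\<not> 0 < Re s \<Longrightarrow> laplace u s = 0"
proof -
  assume s: "\<not> 0 < Re s"
  obtain f where "repr u f" using repr_exists by blast
  then have f: "sqint f" "u = abs_L2 f" by (auto simp: repr_def)
  show ?thesis unfolding f(2) laplace.abs_eq[OF sqint_L2_eq[OF f(1)]] using s by (simp add: rhp_def)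
qed

text \<open>The single line Re s = 1 already determines the class: by Plancherel the damped
  difference has energy 0, and the damping factor never vanishes.\<close>

lemma laplace_injective:
  fixes u v :: "('m::finite) L2"
  assumes eq: "laplace u = laplace v"
  shows "u = v"
proof -
  obtain f g where f: "repr u f" and g: "repr v g" using repr_exists by metis
  let ?d = "\<lambda>t. f t - g t"
  have d: "repr (u - v) ?d" by (rule repr_diff[OF f g])
  have sd: "sqint ?d" and sf: "sqint f" and sg: "sqint g" using d f g by (auto simp: repr_def)
  note [measurable] = sqint_measurable[OF sd] sqint_measurable[OF sf] sqint_measurable[OF sg]
  have z: "Lap ?d (Complex 1 w) = 0" for w
    using Lap_diff[OF sf sg, of "Complex 1 w"] repr_laplace[OF f, of "Complex 1 w"] repr_laplace[OF g, of "Complex 1 w"] eq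
    by simp
  have "ennreal (2 * pi * (LI t. (norm (?d t))\<^sup>2 * exp (- (2 * 1 * t)))) = 0"
    unfolding Lap_plancherel[OF sd zero_less_one, symmetric] z by simp
  then have le: "(LI t. (norm (?d t))\<^sup>2 * exp (- (2 * 1 * t))) \<le> 0"
    using pi_gt_zero by (auto simp: ennreal_eq_0_iff mult_le_0_iff)
  have int: "integrable lborel (\<lambda>t. (norm (?d t))\<^sup>2 * exp (- (2 * 1 * t)))"
    by (rule sqint_weighted(2)[OF sd zero_le_one])
  have "AE t in lborel. (norm (?d t))\<^sup>2 * exp (- (2 * 1 * t)) = 0"
    using le by (subst integral_nonneg_eq_0_iff_AE[OF int, symmetric]) (auto intro!: antisym)
  then have "AE t in lborel. (norm (?d t))\<^sup>2 = 0"
    by eventually_elim simp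
  then have "(LI t. (norm (?d t))\<^sup>2) = (\<integral>t. 0 \<partial>(lborel :: real measure))"
    by (intro integral_cong_AE) auto
  then have "(norm (u - v))\<^sup>2 = 0" using repr_norm[OF d] by simp
  then show ?thesis by simp
qed

text \<open>The norm identity is formulated for truncations, with the window lengthened by
  \<open>h\<close>, because it serves to compare gains of truncations at different times.\<close>

lemma shift_exists:
  fixes u :: "('m::finite) L2"
  assumes h: "0 \<le> h"
  shows "\<exists>v. (\<forall>s. laplace v s = exp (- (s * of_real h)) *s laplace u s) \<and>
     (\<forall>\<tau>. norm (P_trunc (\<tau> + h) v) = norm (P_trunc \<tau> u))"
proof -
  obtain f where f: "repr u f" using repr_exists by blast
  then have sf: "sqint f" by (simp add: repr_def)
  define v where "v = abs_L2 (\<lambda>t. f (t - h))"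
  have v: "repr v (\<lambda>t. f (t - h))" unfolding v_def by (intro sqint_reprI sqint_shift sf h)
  have "laplace v s = exp (- (s * of_real h)) *s laplace u s" for s
    by (cases "0 < Re s") (simp_all add: repr_laplace[OF f] repr_laplace[OF v] Lap_shift laplace_outside)
  moreover have "norm (P_trunc (\<tau> + h) v) = norm (P_trunc \<tau> u)" for \<tau>
  proof -
    have "(norm (P_trunc (\<tau> + h) v))\<^sup>2 = (LI t. (\<lambda>t. (norm (if t \<le> \<tau> then f t else 0))\<^sup>2) (t - h))"
      unfolding repr_norm[OF repr_trunc[OF v]] by (simp add: algebra_simps)
    also have "\<dots> = (norm (P_trunc \<tau> u))\<^sup>2"
      unfolding repr_norm[OF repr_trunc[OF f]] by (rule integral_translate)
    finally show ?thesis by simp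
  qed
  ultimately show ?thesis by blast
qed

section \<open>Integrals along vertical lines\<close>

lemma open_rhp: "open rhp" and convex_rhp: "convex rhp"
  unfolding rhp_def by (simp_all add: open_halfspace_Re_gt convex_halfspace_Re_gt)

lemma rectangle_contour:
  fixes H :: "complex \<Rightarrow> complex"
  assumes hol: "H holomorphic_on S" and S: "convex S" and sub: "{a1, a2, a3, a4} \<subseteq> S"
  shows "contour_integral (linepath a1 a2) H + contour_integral (linepath a2 a3) H +
     contour_integral (linepath a3 a4) H + contour_integral (linepath a4 a1) H = 0"
proof -
  have seg: "closed_segment a b \<subseteq> S" if "a \<in> S" "b \<in> S" for a b
    using that S by (rule closed_segment_subset)
  have ci: "(H has_contour_integral contour_integral (linepath a b) H) (linepath a b)" if "a \<in> S" "b \<in> S" for a b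
    by (intro has_contour_integral_integral contour_integrable_continuous_linepath
        continuous_on_subset[OF holomorphic_on_imp_continuous_on[OF hol] seg] that)
  let ?p = "linepath a1 a2 +++ (linepath a2 a3 +++ (linepath a3 a4 +++ linepath a4 a1))"
  have "(H has_contour_integral contour_integral (linepath a1 a2) H + (contour_integral (linepath a2 a3) H +
     (contour_integral (linepath a3 a4) H + contour_integral (linepath a4 a1) H))) ?p"
    using sub by (intro has_contour_integral_join ci valid_path_join valid_path_linepath) auto
  moreover have "(H has_contour_integral 0) ?p"
  proof (rule Cauchy_theorem_convex_simple[OF hol S])
    show "path_image ?p \<subseteq> S" using sub seg by (simp add: path_image_join)
  qed (auto intro!: valid_path_join)
  ultimately show ?thesis using contour_integral_unique by (metis add.assoc)
qed

text \<open>Cauchy's theorem on rectangles whose left side lies on the line Re s =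
  \<open>\<sigma>\<close>: the other three sides contribute nothing in the limit if the rectangle
  grows at suitable rates.\<close>

lemma line_integral_eq_0:
  fixes H :: "complex \<Rightarrow> complex"
  assumes hol: "H holomorphic_on rhp" and bd: "\<And>s. s \<in> rhp \<Longrightarrow> norm (H s) \<le> K / (sqrt (Re s) * norm s)"
    and \<sigma>: "0 < \<sigma>" and int: "integrable lborel (\<lambda>w. H (Complex \<sigma> w))"
  shows "(LI w. H (Complex \<sigma> w)) = 0"
proof -
  have K: "0 \<le> K" using order_trans[OF norm_ge_zero bd[of 1]] by (simp add: rhp_def)
  \<comment> \<open>The horizontal sides contribute of order \<open>X / Y\<close> and the right side
    of order \<open>Y / (X * sqrt X)\<close>, so \<open>Y\<close> has to grow strictly between
    \<open>X\<close> and its power 3/2. Exponents 4 and 5 make both contributions of order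
    \<open>1 / (n + 1)\<close>.\<close>
  define X where "X = (\<lambda>n. real (Suc n) ^ 4)"
  define Y where "Y = (\<lambda>n. real (Suc n) ^ 5)"
  have XY: "0 < X n" "0 < Y n" for n by (simp_all add: X_def Y_def)
  define J where "J = (\<lambda>n. LI w. indicator {- Y n..Y n} w *\<^sub>R H (Complex \<sigma> w))"
  have "J \<longlonglongrightarrow> (LI w. H (Complex \<sigma> w))"
    unfolding J_def
  proof (rule integral_dominated_convergence[where w = "\<lambda>w. norm (H (Complex \<sigma> w))"])
    show "AE w in lborel. (\<lambda>n. indicator {- Y n..Y n} w *\<^sub>R H (Complex \<sigma> w)) \<longlonglongrightarrow> H (Complex \<sigma> w)"
    proof (rule AE_I2)
      fix w :: real
      have "eventually (\<lambda>n. indicator {- Y n..Y n} w *\<^sub>R H (Complex \<sigma> w) = H (Complex \<sigma> w)) sequentially"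
        using eventually_ge_at_top[of "nat \<lceil>\<bar>w\<bar>\<rceil>"]
      proof eventually_elim
        case (elim n)
        then have "\<bar>w\<bar> \<le> real (Suc n)" by linarith
        also have "\<dots> \<le> Y n" unfolding Y_def by (rule self_le_power) auto
        finally show ?case by (auto simp: indicator_def)
      qed
      then show "(\<lambda>n. indicator {- Y n..Y n} w *\<^sub>R H (Complex \<sigma> w)) \<longlonglongrightarrow> H (Complex \<sigma> w)"
        by (rule tendsto_eventually)
    qed
    show "AE w in lborel. norm (indicator {- Y n..Y n} w *\<^sub>R H (Complex \<sigma> w)) \<le> norm (H (Complex \<sigma> w))" for n
      by (auto simp: indicator_def)
  qed (use int in auto)
  moreover have "J \<longlonglongrightarrow> 0"
  proof (rule Lim_null_comparison)
    have "norm (J n) \<le> (2 * K / sqrt \<sigma> + 2 * K) * inverse (real (Suc n))" for n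
    proof -
      define k where "k = real (Suc n)"
      have k: "0 < k" "X n = k ^ 4" "Y n = k ^ 5" by (simp_all add: k_def X_def Y_def)
      define a1 a2 a3 a4 where a_defs: "a1 = Complex \<sigma> (- Y n)" "a2 = Complex (\<sigma> + X n) (- Y n)"
        "a3 = Complex (\<sigma> + X n) (Y n)" "a4 = Complex \<sigma> (Y n)"
      have Srhp: "{a1, a2, a3, a4} \<subseteq> rhp" using \<sigma> XY[of n] by (auto simp: a_defs rhp_def)
      have ci: "H contour_integrable_on linepath a b" if "a \<in> rhp" "b \<in> rhp" for a b
        by (intro contour_integrable_continuous_linepath
          continuous_on_subset[OF holomorphic_on_imp_continuous_on[OF hol] closed_segment_subset[OF _ _ convex_rhp]] that)
      have hor: "norm (H s) \<le> K / (sqrt \<sigma> * Y n)" if "\<sigma> \<le> Re s" "\<bar>Im s\<bar> = Y n" for s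
      proof -
        have "norm (H s) \<le> K / (sqrt (Re s) * norm s)" using that \<sigma> by (intro bd) (simp add: rhp_def)
        also have "\<dots> \<le> K / (sqrt \<sigma> * Y n)"
          using that \<sigma> XY(2)[of n] abs_Im_le_cmod[of s] K
          by (intro divide_left_mono mult_mono mult_pos_pos) (auto intro: less_le_trans)
        finally show ?thesis .
      qed
      have ver: "norm (H s) \<le> K / (sqrt (X n) * X n)" if "X n \<le> Re s" for s
      proof -
        have "norm (H s) \<le> K / (sqrt (Re s) * norm s)" using that XY(1)[of n] by (intro bd) (simp add: rhp_def)
        also have "\<dots> \<le> K / (sqrt (X n) * X n)"
          using that XY(1)[of n] complex_Re_le_cmod[of s] K
          by (intro divide_left_mono mult_mono mult_pos_pos) (auto intro: less_le_trans order_trans)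
        finally show ?thesis .
      qed
      have b1: "norm (contour_integral (linepath a1 a2) H) \<le> K / (sqrt \<sigma> * Y n) * norm (a2 - a1)"
      proof (rule contour_integral_bound_linepath)
        fix s assume "s \<in> closed_segment a1 a2"
        then have "Re s \<in> closed_segment \<sigma> (\<sigma> + X n)" "Im s = - Y n"
          by (auto simp: closed_segment_same_Im a_defs)
        then show "norm (H s) \<le> K / (sqrt \<sigma> * Y n)"
          using XY[of n] by (intro hor) (auto simp: closed_segment_eq_real_ivl)
      qed (use ci Srhp K XY[of n] \<sigma> in auto)
      have b3: "norm (contour_integral (linepath a3 a4) H) \<le> K / (sqrt \<sigma> * Y n) * norm (a4 - a3)"
      proof (rule contour_integral_bound_linepath)
        fix s assume "s \<in> closed_segment a3 a4"
        then have "Re s \<in> closed_segment (\<sigma> + X n) \<sigma>" "Im s = Y n"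
          by (auto simp: closed_segment_same_Im a_defs)
        then show "norm (H s) \<le> K / (sqrt \<sigma> * Y n)"
          using XY[of n] by (intro hor) (auto simp: closed_segment_eq_real_ivl)
      qed (use ci Srhp K XY[of n] \<sigma> in auto)
      have b2: "norm (contour_integral (linepath a2 a3) H) \<le> K / (sqrt (X n) * X n) * norm (a3 - a2)"
      proof (rule contour_integral_bound_linepath)
        fix s assume "s \<in> closed_segment a2 a3"
        then have "Re s = \<sigma> + X n"
          by (auto simp: closed_segment_same_Re a_defs)
        then show "norm (H s) \<le> K / (sqrt (X n) * X n)"
          using \<sigma> by (intro ver) auto
      qed (use ci Srhp K XY[of n] \<sigma> in auto)
      have set: "set_integrable lborel {- Y n..Y n} (\<lambda>w. H (Complex \<sigma> w))"
        unfolding set_integrable_def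
        by (rule integrableL_bound[OF int]) (use int in \<open>auto simp: indicator_def\<close>)
      have "contour_integral (linepath a1 a4) H = \<i> * integral {- Y n..Y n} (\<lambda>w. H (Complex \<sigma> w))"
        using XY(2)[of n] by (intro contour_integral_linepath_same_Re) (simp_all add: a_defs)
      also have "integral {- Y n..Y n} (\<lambda>w. H (Complex \<sigma> w)) = J n"
        unfolding J_def using set_borel_integral_eq_integral(2)[OF set] by (simp add: set_lebesgue_integral_def)
      finally have left: "contour_integral (linepath a4 a1) H = - (\<i> * J n)"
        using contour_integral_reversepath[of "linepath a1 a4" H] by simp
      have "norm (J n) = norm (contour_integral (linepath a4 a1) H)" unfolding left by (simp add: norm_mult)
      also have "contour_integral (linepath a4 a1) H = - (contour_integral (linepath a1 a2) H +
           contour_integral (linepath a2 a3) H + contour_integral (linepath a3 a4) H)"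
        using rectangle_contour[OF hol convex_rhp Srhp] by (simp add: add_eq_0_iff2 add_eq_0_iff)
      also have "norm \<dots> \<le> K / (sqrt \<sigma> * Y n) * norm (a2 - a1) + K / (sqrt (X n) * X n) * norm (a3 - a2) + K / (sqrt \<sigma> * Y n) * norm (a4 - a3)"
        unfolding norm_minus_cancel by (intro norm_triangle_mono b1 b2 b3)
      also have "norm (a2 - a1) = X n" using XY[of n] by (simp add: a_defs norm_complex_def)
      also have "norm (a4 - a3) = X n" using XY[of n] by (simp add: a_defs norm_complex_def)
      also have "norm (a3 - a2) = 2 * Y n" using XY[of n] by (simp add: a_defs norm_complex_def real_sqrt_mult)
      also have "K / (sqrt \<sigma> * Y n) * X n + K / (sqrt (X n) * X n) * (2 * Y n) + K / (sqrt \<sigma> * Y n) * X n =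
         (2 * K / sqrt \<sigma> + 2 * K) * inverse k"
      proof -
        have sX: "sqrt (X n) = k ^ 2" unfolding k(2) using k(1) by (intro real_sqrt_unique) auto
        have "K / (r * k ^ 5) * k ^ 4 = (K / r) * inverse k" for r
          using k(1) by (simp add: field_simps eval_nat_numeral)
        moreover have "K / (k ^ 2 * k ^ 4) * (2 * k ^ 5) = 2 * K * inverse k"
          using k(1) by (simp add: field_simps eval_nat_numeral)
        ultimately show ?thesis unfolding sX unfolding k(2,3) by (simp add: algebra_simps)
      qed
      finally show ?thesis unfolding k_def .
    qed
    then show "eventually (\<lambda>n. norm (J n) \<le> (2 * K / sqrt \<sigma> + 2 * K) * inverse (real (Suc n))) sequentially"
      by (intro always_eventually allI)
    show "(\<lambda>n. (2 * K / sqrt \<sigma> + 2 * K) * inverse (real (Suc n))) \<longlonglongrightarrow> 0"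
      by (intro tendsto_mult_right_zero LIMSEQ_inverse_real_of_nat)
  qed
  ultimately show ?thesis by (rule LIMSEQ_unique)
qed

lemma Complex_measurable_rhp:
  assumes "F holomorphic_on rhp" "0 < \<sigma>"
  shows "(\<lambda>w. F (Complex \<sigma> w)) \<in> borel_measurable borel"
proof (rule borel_measurable_continuous_onI)
  have "continuous_on UNIV (\<lambda>w. of_real \<sigma> + \<i> * of_real w)" by (intro continuous_intros)
  moreover have "(\<lambda>w. of_real \<sigma> + \<i> * of_real w) ` UNIV \<subseteq> rhp" using assms(2) by (auto simp: rhp_def)
  ultimately have "continuous_on UNIV (\<lambda>w. F (of_real \<sigma> + \<i> * of_real w))"
    by (intro continuous_on_compose2[OF holomorphic_on_imp_continuous_on[OF assms(1)]])
  then show "continuous_on UNIV (\<lambda>w. F (Complex \<sigma> w))"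
    by (simp add: Complex_eq)
qed

lemma norm_one_plus_ge:
  assumes "0 \<le> d" "0 \<le> Re s"
  shows "d * norm s \<le> norm (1 + of_real d * s)"
proof (rule power2_le_imp_le)
  have "(norm (1 + of_real d * s))\<^sup>2 = 1 + 2 * d * Re s + (d * norm s)\<^sup>2"
    unfolding cmod_power2 power_mult_distrib by (simp add: power2_eq_square algebra_simps)
  then show "(d * norm s)\<^sup>2 \<le> (norm (1 + of_real d * s))\<^sup>2" using assms by simp
qed simp

text \<open>Dividing by \<open>1 + \<delta> s\<close> supplies the decay needed to close the contour.\<close>

lemma line_integral_eq_0':
  fixes H :: "complex \<Rightarrow> complex"
  assumes hol: "H holomorphic_on rhp" and bd: "\<And>s. s \<in> rhp \<Longrightarrow> norm (H s) \<le> K / sqrt (Re s)"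
    and \<sigma>: "0 < \<sigma>" and int: "integrable lborel (\<lambda>w. H (Complex \<sigma> w))"
  shows "(LI w. H (Complex \<sigma> w)) = 0"
proof -
  let ?D = "\<lambda>n s. 1 + of_real (1 / real (Suc n)) * s"
  let ?H = "\<lambda>n s. H s / ?D n s"
  \<comment> \<open>A divisor of modulus at least 1 leaves \<open>H\<close> itself as dominating
    function for the limit. The second estimate supplies the factor \<open>1 / norm s\<close>; its
    constant may grow with \<open>n\<close>, since each integral is exactly 0.\<close>
  have D1: "1 \<le> norm (?D n s)" if "s \<in> rhp" for n s
    using that complex_Re_le_cmod[of "?D n s"] by (simp add: rhp_def) (smt (verit) divide_nonneg_pos of_nat_0_le_iff)
  have D2: "norm s / real (Suc n) \<le> norm (?D n s)" if "s \<in> rhp" for n s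
    using norm_one_plus_ge[of "1 / real (Suc n)" s] that by (simp add: rhp_def)
  have meas: "(\<lambda>w. ?H n (Complex \<sigma> w)) \<in> borel_measurable borel" for n
  proof (rule Complex_measurable_rhp[OF _ \<sigma>])
    show "?H n holomorphic_on rhp"
      using D1[of _ n] by (intro holomorphic_intros hol) fastforce
  qed
  have dom: "norm (?H n (Complex \<sigma> w)) \<le> norm (H (Complex \<sigma> w))" for n w
    using D1[of "Complex \<sigma> w" n] \<sigma> by (simp add: norm_divide rhp_def mult_left_le divide_le_eq)
      (metis mult.right_neutral mult_left_mono norm_ge_zero)
  have z: "(LI w. ?H n (Complex \<sigma> w)) = 0" for n
  proof (rule line_integral_eq_0[OF _ _ \<sigma>])
    show "?H n holomorphic_on rhp"
      using D1[of _ n] by (intro holomorphic_intros hol) fastforce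
    show "integrable lborel (\<lambda>w. ?H n (Complex \<sigma> w))"
      by (rule integrableL_bound[OF int]) (use meas dom in auto)
    fix s assume s: "s \<in> rhp"
    then have s0: "0 < Re s" "0 < norm s" by (auto simp: rhp_def)
    have "norm (?H n s) = norm (H s) / norm (?D n s)" by (rule norm_divide)
    also have "\<dots> \<le> (K / sqrt (Re s)) / (norm s / real (Suc n))"
      using s0 by (intro frac_le bd s D2 order_trans[OF norm_ge_zero bd[OF s]]) auto
    also have "\<dots> = (K * real (Suc n)) / (sqrt (Re s) * norm s)" by simp
    finally show "norm (?H n s) \<le> (K * real (Suc n)) / (sqrt (Re s) * norm s)" .
  qed
  have "(\<lambda>n. LI w. ?H n (Complex \<sigma> w)) \<longlonglongrightarrow> (LI w. H (Complex \<sigma> w))"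
  proof (rule integral_dominated_convergence[where w = "\<lambda>w. norm (H (Complex \<sigma> w))"])
    show "AE w in lborel. (\<lambda>n. ?H n (Complex \<sigma> w)) \<longlonglongrightarrow> H (Complex \<sigma> w)"
    proof (rule AE_I2)
      fix w
      have "(\<lambda>n. of_real (1 / real (Suc n)) :: complex) \<longlonglongrightarrow> of_real 0"
        by (intro tendsto_of_real LIMSEQ_Suc[OF lim_1_over_n])
      then have "(\<lambda>n. ?H n (Complex \<sigma> w)) \<longlonglongrightarrow> H (Complex \<sigma> w) / (1 + of_real 0 * Complex \<sigma> w)"
        by (intro tendsto_divide tendsto_const tendsto_add tendsto_mult) auto
      then show "(\<lambda>n. ?H n (Complex \<sigma> w)) \<longlonglongrightarrow> H (Complex \<sigma> w)" by simp
    qed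
  qed (use meas dom int in auto)
  then show ?thesis unfolding z by (simp add: LIMSEQ_const_iff)
qed

lemma Lap_line_L2:
  fixes f :: "real \<Rightarrow> complex ^ 'm"
  assumes f: "sqint f" and a: "0 < a"
  shows "(\<lambda>w. Lap f (Complex a w)) \<in> borel_measurable borel"
    and "integrable lborel (\<lambda>w. (norm (Lap f (Complex a w)))\<^sup>2)"
    and "(LI w. (norm (Lap f (Complex a w)))\<^sup>2) = 2 * pi * (LI t. (norm (f t))\<^sup>2 * exp (- (2 * a * t)))"
proof -
  have "(\<lambda>w. Lap f (Complex a w) $ i) \<in> borel_measurable borel" for i
    using Complex_measurable_rhp[OF Lap_holomorphic[OF f] a] .
  then have "(\<lambda>w. Lap f (Complex a w) \<bullet> axis i x) \<in> borel_measurable borel" for i x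
    by (simp add: inner_axis) measurable
  then show m[measurable]: "(\<lambda>w. Lap f (Complex a w)) \<in> borel_measurable borel"
    by (subst borel_measurable_euclidean_space) (auto simp: Basis_vec_def)
  have "has_bochner_integral lborel (\<lambda>w. (norm (Lap f (Complex a w)))\<^sup>2) (2 * pi * (LI t. (norm (f t))\<^sup>2 * exp (- (2 * a * t))))"
    by (rule has_bochner_integral_nn_integral) (use Lap_plancherel[OF f a] in auto)
  then show "integrable lborel (\<lambda>w. (norm (Lap f (Complex a w)))\<^sup>2)"
    and "(LI w. (norm (Lap f (Complex a w)))\<^sup>2) = 2 * pi * (LI t. (norm (f t))\<^sup>2 * exp (- (2 * a * t)))"
    by (simp_all add: has_bochner_integral_iff)
qed

section \<open>Bounded multipliers act causally\<close>

lemma cvec_inner_eq: "x \<bullet> y = Re (\<Sum>i\<in>UNIV. x $ i * cnj (y $ i))" for x y :: "complex ^ 'm"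
  by (simp add: inner_vec_def inner_complex_def)

lemma norm_sum_mult_le:
  fixes x :: "complex ^ 'm"
  assumes "norm x \<le> a" "\<And>i. norm (y i) \<le> b" "0 \<le> b"
  shows "norm (\<Sum>i\<in>UNIV. x $ i * y i) \<le> real CARD('m) * (a * b)"
proof -
  have "norm (\<Sum>i\<in>UNIV. x $ i * y i) \<le> (\<Sum>i\<in>(UNIV::'m set). a * b)"
  proof (rule sum_norm_le)
    fix i
    have "norm (x $ i) \<le> a" using Finite_Cartesian_Product.norm_nth_le[of x i] assms(1) by linarith
    then show "norm (x $ i * y i) \<le> a * b" unfolding norm_mult
      using assms(2,3) by (intro mult_mono) (auto intro: order_trans[OF norm_ge_zero])
  qed
  then show ?thesis by simp
qed

lemma sqint_bounded_support_integrable: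
  fixes z :: "real \<Rightarrow> complex ^ 'm"
  assumes z: "sqint z" and v: "\<And>t. \<tau> < t \<Longrightarrow> z t = 0"
  shows "integrable lborel (\<lambda>t. norm (z t))"
proof -
  note [measurable] = sqint_measurable[OF z]
  have i: "integrable lborel (indicator {0..\<tau>} :: real \<Rightarrow> real)" 
    by (simp add: emeasure_lborel_Icc_eq)
  show ?thesis
  proof (rule integrableL_bound[where f = "\<lambda>t. (norm (z t))\<^sup>2 + indicator {0..\<tau>} t"])
    show "AE t in lborel. norm (norm (z t)) \<le> norm ((norm (z t))\<^sup>2 + indicator {0..\<tau>} t)"
    proof (rule AE_I2)
      fix t
      have "norm (z t) \<le> (norm (z t))\<^sup>2 + 1"
        using sum_squares_bound[of "norm (z t)" 1] norm_ge_zero[of "z t"] by (simp del: norm_ge_zero)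
      then show "norm (norm (z t)) \<le> norm ((norm (z t))\<^sup>2 + indicator {0..\<tau>} t)"
        using z v[of t] by (auto simp: indicator_def sqint_def)
    qed
  qed (use z i in \<open>auto simp: sqint_def\<close>)
qed

text \<open>
  Write \<open>z = P\<^sub>\<tau> g\<close>, \<open>r = g - z\<close>, \<open>u1 = P\<^sub>\<tau> f\<close>, \<open>u2 = f - u1\<close> and \<open>q = S u2^ - r^\<close>, so that
  \<open>z^ = S u1^ + q\<close>. On a line \<open>Re s = \<sigma>\<close> the conjugate of \<open>z^\<close> is the restriction of an entire
  function (\<open>zt\<close> below) growing like \<open>exp (\<tau> Re s)\<close>, while \<open>q\<close> decays like
  \<open>exp (- \<tau> Re s)\<close>. Pushing the contour to the right shows that \<open>q\<close> is orthogonal to \<open>z^\<close>, and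
  \<open>z^\<close> is thus bounded by \<open>S u1^\<close> alone.
\<close>

lemma causal_norm_bound:
  fixes S :: "complex \<Rightarrow> complex ^ 'm ^ 'm" and f g :: "real \<Rightarrow> complex ^ 'm"
  assumes S: "\<And>i j. (\<lambda>s. S s $ i $ j) holomorphic_on rhp"
    and Sb: "\<And>s x. s \<in> rhp \<Longrightarrow> norm (S s *v x) \<le> \<gamma> * norm x" and \<gamma>: "0 \<le> \<gamma>"
    and f: "sqint f" and g: "sqint g"
    and eq: "\<And>s. s \<in> rhp \<Longrightarrow> Lap g s = S s *v Lap f s" and \<tau>: "0 \<le> \<tau>"
  shows "(LI t. (norm (if t \<le> \<tau> then g t else 0))\<^sup>2) \<le> \<gamma>\<^sup>2 * (LI t. (norm (if t \<le> \<tau> then f t else 0))\<^sup>2)"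
proof -
  define z where "z = (\<lambda>t. if t \<le> \<tau> then g t else 0)"
  define r where "r = (\<lambda>t. g t - z t)"
  define u1 where "u1 = (\<lambda>t. if t \<le> \<tau> then f t else 0)"
  define u2 where "u2 = (\<lambda>t. f t - u1 t)"
  have z: "sqint z" and u1: "sqint u1"
    using sqint_restrict[OF g, of "{..\<tau>}"] sqint_restrict[OF f, of "{..\<tau>}"] by (simp_all add: z_def u1_def)
  have r: "sqint r" and u2: "sqint u2" unfolding r_def u2_def by (intro sqint_diff f g z u1)+
  note [measurable] = sqint_measurable[OF z] sqint_measurable[OF u1] sqint_measurable[OF r] sqint_measurable[OF u2]
  have z1: "integrable lborel (\<lambda>t. norm (z t))"
    by (rule sqint_bounded_support_integrable[OF z, of \<tau>]) (simp add: z_def)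
  define B where "B = (LI t. norm (z t))"
  have B: "0 \<le> B" by (simp add: B_def)
  define q where "q = (\<lambda>s. S s *v Lap u2 s - Lap r s)"
  have zq: "Lap z s = S s *v Lap u1 s + q s" if "s \<in> rhp" for s
  proof -
    have s: "0 < Re s" using that by (simp add: rhp_def)
    have "Lap r s = Lap g s - Lap z s" unfolding r_def by (rule Lap_diff[OF g z s])
    moreover have "Lap u2 s = Lap f s - Lap u1 s" unfolding u2_def by (rule Lap_diff[OF f u1 s])
    ultimately show ?thesis unfolding q_def using eq[OF that]
      by (simp add: matrix_vector_mult_diff_distrib)
  qed
  have Sv_hol: "(\<lambda>s. (S s *v v s) $ i) holomorphic_on rhp" if "\<And>j. (\<lambda>s. v s $ j) holomorphic_on rhp" for v :: "complex \<Rightarrow> complex ^ 'm" and i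
    unfolding matrix_vector_mult_def vec_lambda_beta by (intro holomorphic_intros S that)
  have q_hol: "(\<lambda>s. q s $ i) holomorphic_on rhp" for i
    unfolding q_def vector_minus_component by (intro holomorphic_intros Sv_hol Lap_holomorphic u2 r)
  obtain C1 where C1: "0 \<le> C1" "\<And>s. 0 < Re s \<Longrightarrow> norm (Lap u2 s) \<le> C1 * exp (- (\<tau> * Re s)) / sqrt (Re s)"
    using Lap_bound[OF u2, of \<tau>] by (auto simp: u2_def u1_def)
  obtain C2 where C2: "0 \<le> C2" "\<And>s. 0 < Re s \<Longrightarrow> norm (Lap r s) \<le> C2 * exp (- (\<tau> * Re s)) / sqrt (Re s)"
    using Lap_bound[OF r, of \<tau>] by (auto simp: r_def z_def)
  define C where "C = \<gamma> * C1 + C2"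
  have qb: "norm (q s) \<le> C * exp (- (\<tau> * Re s)) / sqrt (Re s)" if "s \<in> rhp" for s
  proof -
    have s: "0 < Re s" using that by (simp add: rhp_def)
    have "norm (q s) \<le> norm (S s *v Lap u2 s) + norm (Lap r s)" unfolding q_def by (rule norm_triangle_ineq4)
    also have "\<dots> \<le> \<gamma> * (C1 * exp (- (\<tau> * Re s)) / sqrt (Re s)) + C2 * exp (- (\<tau> * Re s)) / sqrt (Re s)"
      using order_trans[OF Sb[OF that] mult_left_mono[OF C1(2)[OF s] \<gamma>]] C2(2)[OF s] by (rule add_mono)
    also have "\<dots> = C * exp (- (\<tau> * Re s)) / sqrt (Re s)" by (simp add: C_def algebra_simps add_divide_distrib)
    finally show ?thesis .
  qed
  have main: "(LI t. (norm (z t))\<^sup>2 * exp (- (2 * \<sigma> * t))) \<le> \<gamma>\<^sup>2 * (LI t. (norm (u1 t))\<^sup>2 * exp (- (2 * \<sigma> * t)))"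
    if \<sigma>: "0 < \<sigma>" for \<sigma>
  proof -
    \<comment> \<open>On the line Re s = \<open>\<sigma>\<close> the conjugate of \<open>s\<close>
      is \<open>2 * \<sigma> - s\<close>, so the conjugate of \<open>exp (- (s * t))\<close> is
      \<open>exp (- (2 * \<sigma> * t)) * exp (s * t)\<close>, which is entire in
      \<open>s\<close>.\<close>
    define k where "k = (\<lambda>i t. cnj (z t $ i) * exp (- (2 * of_real (\<sigma> * t))))"
    have km[measurable]: "k i \<in> borel_measurable borel" for i unfolding k_def by measurable
    define zt where "zt = (\<lambda>i s. LI t. k i t * exp (- (s * of_real t)))"
    have kb: "norm (k i t * exp (- (- s * of_real t))) \<le> exp (\<tau> * \<bar>Re s\<bar>) * norm (z t)" for i s t
    proof (cases "0 \<le> t \<and> t \<le> \<tau>")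
      case True
      have "norm (k i t * exp (- (- s * of_real t))) = norm (z t $ i) * exp (Re s * t - 2 * \<sigma> * t)"
        by (simp add: k_def norm_mult mult.assoc flip: exp_add)
      also have "\<dots> \<le> norm (z t) * exp (\<tau> * \<bar>Re s\<bar>)"
      proof (rule mult_mono)
        have "Re s * t \<le> \<bar>Re s\<bar> * \<tau>" using True by (intro mult_mono) auto
        moreover have "0 \<le> 2 * \<sigma> * t" using True \<sigma> by simp
        ultimately have "Re s * t - 2 * \<sigma> * t \<le> \<bar>Re s\<bar> * \<tau>" by linarith
        then show "exp (Re s * t - 2 * \<sigma> * t) \<le> exp (\<tau> * \<bar>Re s\<bar>)" by (simp add: mult.commute)
      qed (auto simp: Finite_Cartesian_Product.norm_nth_le)
      finally show ?thesis by (simp add: mult.commute)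
    next
      case False
      then have "z t = 0" using g by (auto simp: z_def sqint_def)
      then show ?thesis by (simp add: k_def)
    qed
    have ki: "integrable lborel (\<lambda>t. k i t * exp (- (- s * of_real t)))" for i s
      by (rule integrableL_bound[OF integrable_mult_right[OF z1, of "exp (\<tau> * \<bar>Re s\<bar>)"]])
         (use kb in auto)
    have zt_hol: "(\<lambda>s. zt i (- s)) holomorphic_on rhp" for i
    proof -
      have "zt i holomorphic_on UNIV" unfolding zt_def
        by (rule holomorphic_laplace_integral) (use ki[of i "- _"] in auto)
      moreover have "(\<lambda>s. - s :: complex) holomorphic_on rhp" by (intro holomorphic_intros)
      ultimately show ?thesis
        using holomorphic_on_compose_gen[of "\<lambda>s. - s" rhp "zt i" UNIV] by (simp add: o_def)
    qed
    have zt_b: "norm (zt i (- s)) \<le> exp (\<tau> * Re s) * B" if "s \<in> rhp" for i s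
    proof -
      have "norm (zt i (- s)) \<le> (LI t. norm (k i t * exp (- (- s * of_real t))))"
        unfolding zt_def by (rule integral_norm_bound)
      also have "\<dots> \<le> (LI t. exp (\<tau> * \<bar>Re s\<bar>) * norm (z t))"
        by (intro integral_mono integrable_norm ki integrable_mult_right z1 kb)
      finally show ?thesis using that by (simp add: B_def rhp_def)
    qed
    have zt_line: "zt i (- Complex \<sigma> w) = cnj (Lap z (Complex \<sigma> w) $ i)" for i w
    proof -
      have "zt i (- Complex \<sigma> w) = (LI t. cnj (z t $ i * exp (- (Complex \<sigma> w * of_real t))))"
        unfolding zt_def
      proof (rule integralL_cong[OF refl])
        fix t
        have "- (2 * of_real (\<sigma> * t)) + - (- Complex \<sigma> w * of_real t) = cnj (- (Complex \<sigma> w * of_real t))"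
          by (simp add: complex_eq_iff algebra_simps)
        then have "exp (- (2 * of_real (\<sigma> * t))) * exp (- (- Complex \<sigma> w * of_real t)) = cnj (exp (- (Complex \<sigma> w * of_real t)))"
          unfolding exp_add[symmetric] exp_cnj by (rule arg_cong)
        then show "k i t * exp (- (- Complex \<sigma> w * of_real t)) = cnj (z t $ i * exp (- (Complex \<sigma> w * of_real t)))"
          unfolding k_def complex_cnj_mult mult.assoc by simp
      qed
      also have "\<dots> = cnj (Lap z (Complex \<sigma> w) $ i)"
        unfolding Lap_def vec_lambda_beta by (rule Bochner_Integration.integral_cnj)
      finally show ?thesis .
    qed
    \<comment> \<open>The growth of \<open>zt\<close> and the decay of \<open>q\<close> cancel in
      the product and leave \<open>1 / sqrt (Re s)\<close>, the bound under which integrals along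
      vertical lines vanish.\<close>
    define h where "h = (\<lambda>s. \<Sum>i\<in>UNIV. q s $ i * zt i (- s))"
    have h_hol: "h holomorphic_on rhp" unfolding h_def by (intro holomorphic_intros q_hol zt_hol)
    have h_b: "norm (h s) \<le> real CARD('m) * (C * B) / sqrt (Re s)" if "s \<in> rhp" for s
    proof -
      have "norm (h s) \<le> real CARD('m) * ((C * exp (- (\<tau> * Re s)) / sqrt (Re s)) * (exp (\<tau> * Re s) * B))"
        unfolding h_def using B by (intro norm_sum_mult_le qb zt_b that) simp
      also have "\<dots> = real CARD('m) * (C * B) / sqrt (Re s)" by (simp add: exp_minus field_simps)
      finally show ?thesis .
    qed
    let ?s = "\<lambda>w. Complex \<sigma> w"
    have srhp: "?s w \<in> rhp" for w using \<sigma> by (simp add: rhp_def)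
    note Lm = Lap_line_L2(1)[OF z \<sigma>] Lap_line_L2(1)[OF u1 \<sigma>] Lap_line_L2(1)[OF u2 \<sigma>] Lap_line_L2(1)[OF r \<sigma>]
    note Li = Lap_line_L2(2)[OF z \<sigma>] Lap_line_L2(2)[OF u1 \<sigma>] Lap_line_L2(2)[OF u2 \<sigma>] Lap_line_L2(2)[OF r \<sigma>]
    have h_line: "h (?s w) = (\<Sum>i\<in>UNIV. q (?s w) $ i * cnj (Lap z (?s w) $ i))" for w
      unfolding h_def zt_line ..
    have q2: "(norm (q (?s w)))\<^sup>2 \<le> 2 * \<gamma>\<^sup>2 * (norm (Lap u2 (?s w)))\<^sup>2 + 2 * (norm (Lap r (?s w)))\<^sup>2" for w
    proof -
      have "(norm (q (?s w)))\<^sup>2 \<le> (\<gamma> * norm (Lap u2 (?s w)) + norm (Lap r (?s w)))\<^sup>2"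
        unfolding q_def using Sb[OF srhp] by (intro power_mono order_trans[OF norm_triangle_ineq4] add_mono) auto
      also have "\<dots> \<le> 2 * (\<gamma> * norm (Lap u2 (?s w)))\<^sup>2 + 2 * (norm (Lap r (?s w)))\<^sup>2"
        using sum_squares_bound[of "\<gamma> * norm (Lap u2 (?s w))" "norm (Lap r (?s w))"] by (simp add: power2_sum)
      finally show ?thesis by (simp add: power_mult_distrib)
    qed
    have h_int: "integrable lborel (\<lambda>w. h (?s w))"
    proof (rule integrableL_bound[where f = "\<lambda>w. real CARD('m) * (2 * \<gamma>\<^sup>2 * (norm (Lap u2 (?s w)))\<^sup>2 + 2 * (norm (Lap r (?s w)))\<^sup>2 + (norm (Lap z (?s w)))\<^sup>2)"])
      show "(\<lambda>w. h (?s w)) \<in> borel_measurable lborel"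
        using Complex_measurable_rhp[OF h_hol \<sigma>] by simp
      show "AE w in lborel. norm (h (?s w)) \<le> norm (real CARD('m) * (2 * \<gamma>\<^sup>2 * (norm (Lap u2 (?s w)))\<^sup>2 + 2 * (norm (Lap r (?s w)))\<^sup>2 + (norm (Lap z (?s w)))\<^sup>2))"
      proof (rule AE_I2)
        fix w
        have "norm (h (?s w)) \<le> real CARD('m) * (norm (q (?s w)) * norm (Lap z (?s w)))"
          unfolding h_line by (intro norm_sum_mult_le) (auto simp: Finite_Cartesian_Product.norm_nth_le)
        also have "norm (q (?s w)) * norm (Lap z (?s w)) \<le> (norm (q (?s w)))\<^sup>2 + (norm (Lap z (?s w)))\<^sup>2"
        proof -
          have "0 \<le> norm (q (?s w)) * norm (Lap z (?s w))" by simp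
          then show ?thesis using sum_squares_bound[of "norm (q (?s w))" "norm (Lap z (?s w))"] by linarith
        qed
        also note q2
        finally show "norm (h (?s w)) \<le> norm (real CARD('m) * (2 * \<gamma>\<^sup>2 * (norm (Lap u2 (?s w)))\<^sup>2 + 2 * (norm (Lap r (?s w)))\<^sup>2 + (norm (Lap z (?s w)))\<^sup>2))"
          by (simp add: mult_left_mono)
      qed
    qed (intro integrable_mult_right integrableL_add Li)
    have h0: "(LI w. h (?s w)) = 0"
      by (rule line_integral_eq_0'[OF h_hol h_b \<sigma> h_int])
    \<comment> \<open>With \<open>Z = D + R\<close> and \<open>D \<le> (N + Z) / 2\<close> one gets
      \<open>Z \<le> N + 2 * R\<close>, where \<open>R\<close>, the real part of \<open>h\<close>,
      integrates to 0. Completing the square pointwise takes the place of Cauchy-Schwarz for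
      integrals.\<close>
    have pt: "(norm (Lap z (?s w)))\<^sup>2 \<le> \<gamma>\<^sup>2 * (norm (Lap u1 (?s w)))\<^sup>2 + 2 * Re (h (?s w))" for w
    proof -
      let ?z = "Lap z (?s w)" and ?a = "S (?s w) *v Lap u1 (?s w)"
      have "(norm ?z)\<^sup>2 = ?z \<bullet> ?z" by (simp add: power2_norm_eq_inner)
      also have "\<dots> = (?a + q (?s w)) \<bullet> ?z" using zq[OF srhp] by simp
      also have "\<dots> = ?a \<bullet> ?z + Re (h (?s w))" unfolding inner_add_left h_line cvec_inner_eq[symmetric] ..
      finally have e: "(norm ?z)\<^sup>2 = ?a \<bullet> ?z + Re (h (?s w))" .
      have i: "?a \<bullet> ?z \<le> ((norm ?a)\<^sup>2 + (norm ?z)\<^sup>2) / 2"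
        using norm_cauchy_schwarz[of ?a ?z] sum_squares_bound[of "norm ?a" "norm ?z"] by simp
      have "(norm ?a)\<^sup>2 \<le> (\<gamma> * norm (Lap u1 (?s w)))\<^sup>2" by (intro power_mono Sb srhp) simp
      then have j: "(norm ?a)\<^sup>2 \<le> \<gamma>\<^sup>2 * (norm (Lap u1 (?s w)))\<^sup>2" unfolding power_mult_distrib .
      have "Z \<le> G + 2 * R" if "Z = D + R" "D \<le> (N + Z) / 2" "N \<le> G" for Z D R N G :: real
      proof -
        have "2 * D \<le> N + Z" using that(2) by simp
        then show ?thesis using that(1,3) by simp
      qed
      from this[OF e i j] show ?thesis .
    qed
    have ihr: "integrable lborel (\<lambda>w. 2 * Re (h (?s w)))" using h_int by simp
    have "2 * pi * (LI t. (norm (z t))\<^sup>2 * exp (- (2 * \<sigma> * t))) = (LI w. (norm (Lap z (?s w)))\<^sup>2)"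
      by (rule Lap_line_L2(3)[OF z \<sigma>, symmetric])
    also have "\<dots> \<le> (LI w. \<gamma>\<^sup>2 * (norm (Lap u1 (?s w)))\<^sup>2 + 2 * Re (h (?s w)))"
      by (intro integral_mono integrableL_add integrable_mult_right Li ihr pt)
    also have "\<dots> = \<gamma>\<^sup>2 * (LI w. (norm (Lap u1 (?s w)))\<^sup>2) + (LI w. 2 * Re (h (?s w)))"
      by (subst integralL_add[OF integrable_mult_right[OF Li(2)] ihr]) (simp only: integral_mult_right_zero)
    also have "(LI w. 2 * Re (h (?s w))) = 2 * Re (LI w. h (?s w))"
      unfolding integral_mult_right_zero integral_Re[OF h_int] ..
    also have "(LI w. (norm (Lap u1 (?s w)))\<^sup>2) = 2 * pi * (LI t. (norm (u1 t))\<^sup>2 * exp (- (2 * \<sigma> * t)))"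
      by (rule Lap_line_L2(3)[OF u1 \<sigma>])
    finally have "2 * pi * (LI t. (norm (z t))\<^sup>2 * exp (- (2 * \<sigma> * t))) \<le>
       2 * pi * (\<gamma>\<^sup>2 * (LI t. (norm (u1 t))\<^sup>2 * exp (- (2 * \<sigma> * t))))"
      unfolding h0 by (simp add: mult_ac)
    then show ?thesis using mult_le_cancel_left_pos[of "2 * pi"] pi_gt_zero by simp
  qed
  \<comment> \<open>On the support of \<open>z\<close> the weight is at least
    \<open>exp (- (2 * \<sigma> * \<tau>))\<close>, and for \<open>u1\<close> it is at most 1;
    letting \<open>\<sigma>\<close> tend to 0 then removes it from both sides.\<close>
  have dec: "exp (- (2 * \<sigma> * \<tau>)) * (LI t. (norm (z t))\<^sup>2) \<le> \<gamma>\<^sup>2 * (LI t. (norm (u1 t))\<^sup>2)" if \<sigma>: "0 < \<sigma>" for \<sigma>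
  proof -
    note w = sqint_weighted[OF _ less_imp_le[OF \<sigma>]]
    have le: "(LI t. (norm (u1 t))\<^sup>2 * exp (- (2 * \<sigma> * t))) \<le> (LI t. (norm (u1 t))\<^sup>2)"
      using u1 by (intro integral_mono w) (auto simp: sqint_def)
    have "exp (- (2 * \<sigma> * \<tau>)) * (LI t. (norm (z t))\<^sup>2) = (LI t. exp (- (2 * \<sigma> * \<tau>)) * (norm (z t))\<^sup>2)"
      by simp
    also have "\<dots> \<le> (LI t. (norm (z t))\<^sup>2 * exp (- (2 * \<sigma> * t)))"
    proof (rule integral_mono)
      show "exp (- (2 * \<sigma> * \<tau>)) * (norm (z t))\<^sup>2 \<le> (norm (z t))\<^sup>2 * exp (- (2 * \<sigma> * t))" for t
        using \<sigma> by (auto simp: z_def mult.commute intro!: mult_left_mono)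
    qed (use z w(2)[OF z] in \<open>auto simp: sqint_def\<close>)
    also have "\<dots> \<le> \<gamma>\<^sup>2 * (LI t. (norm (u1 t))\<^sup>2 * exp (- (2 * \<sigma> * t)))" by (rule main[OF \<sigma>])
    also have "\<dots> \<le> \<gamma>\<^sup>2 * (LI t. (norm (u1 t))\<^sup>2)" by (intro mult_left_mono le) simp
    finally show ?thesis .
  qed
  have "(LI t. (norm (z t))\<^sup>2) \<le> \<gamma>\<^sup>2 * (LI t. (norm (u1 t))\<^sup>2)"
  proof (rule LIMSEQ_le_const2)
    have "(\<lambda>n. exp (- (2 * inverse (real (Suc n)) * \<tau>)) * (LI t. (norm (z t))\<^sup>2)) \<longlonglongrightarrow>
        exp (- (2 * 0 * \<tau>)) * (LI t. (norm (z t))\<^sup>2)"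
      by (intro tendsto_mult tendsto_exp tendsto_minus tendsto_const LIMSEQ_inverse_real_of_nat)
    then show "(\<lambda>n. exp (- (2 * inverse (real (Suc n)) * \<tau>)) * (LI t. (norm (z t))\<^sup>2)) \<longlonglongrightarrow> (LI t. (norm (z t))\<^sup>2)"
      by simp
    show "\<exists>N. \<forall>n\<ge>N. exp (- (2 * inverse (real (Suc n)) * \<tau>)) * (LI t. (norm (z t))\<^sup>2) \<le> \<gamma>\<^sup>2 * (LI t. (norm (u1 t))\<^sup>2)"
      using dec by (metis inverse_positive_iff_positive of_nat_0_less_iff zero_less_Suc)
  qed
  then show ?thesis unfolding z_def u1_def .
qed

section \<open>Singular values and the operator norm\<close>

lemma inner_conj_transpose: "(A *v x) \<bullet> y = x \<bullet> (conj_transpose A *v y)"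
  for A :: "complex ^ 'm ^ 'm"
proof -
  have "(\<Sum>i\<in>UNIV. (A *v x) $ i * cnj (y $ i)) = (\<Sum>i\<in>UNIV. \<Sum>j\<in>UNIV. A $ i $ j * x $ j * cnj (y $ i))"
    by (simp add: matrix_vector_mult_def sum_distrib_right)
  also have "\<dots> = (\<Sum>j\<in>UNIV. \<Sum>i\<in>UNIV. A $ i $ j * x $ j * cnj (y $ i))" by (rule sum.swap)
  also have "\<dots> = (\<Sum>j\<in>UNIV. x $ j * cnj ((conj_transpose A *v y) $ j))"
    by (simp add: matrix_vector_mult_def conj_transpose_def cnj_sum sum_distrib_left mult_ac)
  finally show ?thesis unfolding cvec_inner_eq by simp
qed

lemma of_real_vscale: "complex_of_real r *s x = r *\<^sub>R x" for x :: "complex ^ 'm"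
  unfolding vec_eq_iff vector_scaleR_component vector_smult_component by (simp add: scaleR_conv_of_real)

definition gram :: "complex ^ 'm ^ 'm \<Rightarrow> complex ^ 'm ^ 'm" where
  "gram A = conj_transpose A ** A"

lemma inner_gram: "x \<bullet> (gram A *v y) = (A *v x) \<bullet> (A *v y)"
  by (simp add: gram_def inner_conj_transpose flip: matrix_vector_mul_assoc)

lemma gram_linear:
  fixes x y :: "complex ^ 'm"
  shows "gram A *v (x + y) = gram A *v x + gram A *v y" "gram A *v (r *\<^sub>R x) = r *\<^sub>R (gram A *v x)"
proof -
  show "gram A *v (x + y) = gram A *v x + gram A *v y" by (rule matrix_vector_right_distrib)
  show "gram A *v (r *\<^sub>R x) = r *\<^sub>R (gram A *v x)"
    unfolding of_real_vscale[symmetric] by (simp add: vec_eq_iff matrix_vector_mult_def sum_distrib_left mult_ac)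
qed

lemma singular_values_iff:
  "\<sigma> \<in> singular_values A \<longleftrightarrow> 0 \<le> \<sigma> \<and> (\<exists>x. x \<noteq> 0 \<and> gram A *v x = \<sigma>\<^sup>2 *\<^sub>R x)"
  unfolding singular_values_def gram_def of_real_vscale by simp

lemma singular_value_vector:
  assumes "\<sigma> \<in> singular_values A"
  obtains x where "x \<noteq> 0" "norm (A *v x) = \<sigma> * norm x"
proof -
  from assms obtain x where x: "0 \<le> \<sigma>" "x \<noteq> 0" "gram A *v x = \<sigma>\<^sup>2 *\<^sub>R x"
    by (auto simp: singular_values_iff)
  have "(norm (A *v x))\<^sup>2 = (\<sigma> * norm x)\<^sup>2"
    using inner_gram[of x A x] unfolding x(3) by (simp add: power2_norm_eq_inner power_mult_distrib)
  then have "norm (A *v x) = \<sigma> * norm x" using x(1) by (simp add: power2_eq_iff_nonneg)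
  with x(2) show ?thesis by (rule that)
qed

text \<open>A zero of a nonnegative quadratic form is a minimum, so the gradient
  \<open>2 * L x0\<close> has to vanish; otherwise a small step against the gradient makes the form
  negative.\<close>

lemma psd_kernel:
  fixes L :: "'a::real_inner \<Rightarrow> 'a"
  assumes lin: "\<And>x y. L (x + y) = L x + L y" "\<And>r x. L (r *\<^sub>R x) = r *\<^sub>R L x"
    and sym: "\<And>x y. L x \<bullet> y = x \<bullet> L y" and psd: "\<And>x. 0 \<le> x \<bullet> L x" and z: "x0 \<bullet> L x0 = 0"
  shows "L x0 = 0"
proof (rule ccontr)
  assume "L x0 \<noteq> 0"
  define v where "v = L x0"
  define n where "n = v \<bullet> v"
  define q where "q = v \<bullet> L v"
  have n: "0 < n" using \<open>L x0 \<noteq> 0\<close> by (simp add: n_def v_def)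
  have q: "0 \<le> q" unfolding q_def by (rule psd)
  \<comment> \<open>The form at \<open>x0 + t *\<^sub>R v\<close> equals
    \<open>2 * t * n + t\<^sup>2 * q\<close>. The denominator \<open>q + 1\<close> instead of
    \<open>q\<close> also serves the case \<open>q = 0\<close>.\<close>
  define t where "t = - n / (q + 1)"
  have "0 \<le> (x0 + t *\<^sub>R v) \<bullet> L (x0 + t *\<^sub>R v)" by (rule psd)
  also have "\<dots> = 2 * t * n + t\<^sup>2 * q"
    using sym[of x0 v] z unfolding lin n_def q_def v_def[symmetric]
    by (simp add: inner_add_left inner_add_right v_def[symmetric] inner_commute power2_eq_square algebra_simps)
  also have "\<dots> = t * (2 * n + t * q)" by (simp add: power2_eq_square algebra_simps)
  also have "\<dots> < 0"
  proof (rule mult_neg_pos)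
    show "t < 0" using n q by (simp add: t_def divide_neg_pos)
    have "n * q / (q + 1) \<le> n" using n q by (simp add: field_simps)
    then show "0 < 2 * n + t * q" using n by (simp add: t_def)
  qed
  finally show False by simp
qed

text \<open>The gain attains its extrema on the unit sphere by compactness. At an extremal vector
  \<open>x0\<close> with squared gain \<open>M\<close>, the form of \<open>M\<close> times the
  identity minus \<open>gram A\<close>, with sign \<open>\<epsilon> = 1\<close> for the maximum and
  \<open>\<epsilon> = -1\<close> for the minimum, is nonnegative and vanishes, so \<open>x0\<close>
  is an eigenvector of \<open>gram A\<close>.\<close>

lemma extremal_singular_values:
  fixes A :: "complex ^ 'm ^ 'm"
  shows "\<exists>\<sigma>\<in>singular_values A. \<forall>x. norm (A *v x) \<le> \<sigma> * norm x"
    and "\<exists>\<sigma>\<in>singular_values A. \<forall>x. \<sigma> * norm x \<le> norm (A *v x)"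
proof -
  let ?S = "sphere 0 1 :: (complex ^ 'm) set"
  have "continuous_on UNIV (\<lambda>x. A *v x)"
    unfolding matrix_vector_mult_def by (intro continuous_intros)
  then have cont: "continuous_on ?S (\<lambda>x. norm (A *v x))"
    by (intro continuous_on_norm) (rule continuous_on_subset, auto)
  have ne: "?S \<noteq> {}" by simp
  have scaled: "norm (A *v x) = norm x * norm (A *v (inverse (norm x) *\<^sub>R x))" if "x \<noteq> 0" for x
  proof -
    have "A *v (inverse (norm x) *\<^sub>R x) = inverse (norm x) *\<^sub>R (A *v x)"
      unfolding of_real_vscale[symmetric] by (simp add: vec_eq_iff matrix_vector_mult_def sum_distrib_left mult_ac)
    then show ?thesis using that by simp
  qed
  have sph: "inverse (norm x) *\<^sub>R x \<in> ?S" if "x \<noteq> 0" for x :: "complex ^ 'm" using that by simp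
  have eig: "norm (A *v x0) \<in> singular_values A"
    if x0: "x0 \<in> ?S" and \<epsilon>: "\<epsilon> = 1 \<or> \<epsilon> = -1" and ext: "\<And>x. 0 \<le> \<epsilon> * ((norm (A *v x0) * norm x)\<^sup>2 - (norm (A *v x))\<^sup>2)" for x0 and \<epsilon> :: real
  proof -
    define M where "M = (norm (A *v x0))\<^sup>2"
    let ?L = "\<lambda>x. \<epsilon> *\<^sub>R (M *\<^sub>R x - gram A *v x)"
    have Lx: "x \<bullet> ?L x = \<epsilon> * ((norm (A *v x0) * norm x)\<^sup>2 - (norm (A *v x))\<^sup>2)" for x
      by (simp add: inner_diff_right inner_gram M_def power2_norm_eq_inner power_mult_distrib)
    have "?L x0 = 0"
    proof (rule psd_kernel[of ?L])
      show "?L (x + y) = ?L x + ?L y" for x y by (simp add: gram_linear algebra_simps)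
      show "?L (r *\<^sub>R x) = r *\<^sub>R ?L x" for r x by (simp add: gram_linear algebra_simps)
      show "?L x \<bullet> y = x \<bullet> ?L y" for x y
        using inner_gram[of y A x] inner_gram[of x A y] by (simp add: inner_diff_left inner_diff_right inner_commute)
      show "0 \<le> x \<bullet> ?L x" for x unfolding Lx by (rule ext)
      show "x0 \<bullet> ?L x0 = 0" unfolding Lx using x0 by simp
    qed
    then have "gram A *v x0 = (norm (A *v x0))\<^sup>2 *\<^sub>R x0" using \<epsilon> by (auto simp: M_def)
    moreover have "x0 \<noteq> 0" using x0 by auto
    ultimately show ?thesis unfolding singular_values_iff by auto
  qed
  obtain x1 where x1: "x1 \<in> ?S" "\<And>x. x \<in> ?S \<Longrightarrow> norm (A *v x) \<le> norm (A *v x1)"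
    using continuous_attains_sup[OF compact_sphere ne cont] by blast
  have b1: "norm (A *v x) \<le> norm (A *v x1) * norm x" for x
    using scaled[of x] mult_left_mono[OF x1(2)[OF sph[of x]], of "norm x"] by (cases "x = 0") (auto simp: mult.commute)
  have "norm (A *v x1) \<in> singular_values A"
    by (rule eig[OF x1(1), of 1]) (use b1 in \<open>auto intro: power_mono\<close>)
  with b1 show "\<exists>\<sigma>\<in>singular_values A. \<forall>x. norm (A *v x) \<le> \<sigma> * norm x" by blast
  obtain x2 where x2: "x2 \<in> ?S" "\<And>x. x \<in> ?S \<Longrightarrow> norm (A *v x2) \<le> norm (A *v x)"
    using continuous_attains_inf[OF compact_sphere ne cont] by blast
  have b2: "norm (A *v x2) * norm x \<le> norm (A *v x)" for x
    using scaled[of x] mult_left_mono[OF x2(2)[OF sph[of x]], of "norm x"] by (cases "x = 0") (auto simp: mult.commute)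
  have "norm (A *v x2) \<in> singular_values A"
    by (rule eig[OF x2(1), of "-1"]) (use b2 in \<open>auto intro: power_mono\<close>)
  with b2 show "\<exists>\<sigma>\<in>singular_values A. \<forall>x. \<sigma> * norm x \<le> norm (A *v x)" by blast
qed

text \<open>Eigenvectors of the symmetric map \<open>gram A\<close> for different eigenvalues are
  orthogonal, hence independent. Finiteness is what gives \<open>Max\<close> and \<open>Min\<close>
  in \<open>sigma_max\<close> and \<open>sigma_min\<close> their meaning.\<close>

lemma finite_singular_values: "finite (singular_values A)"
proof -
  have "\<forall>\<sigma>\<in>singular_values A. \<exists>x. x \<noteq> 0 \<and> gram A *v x = \<sigma>\<^sup>2 *\<^sub>R x" by (simp add: singular_values_iff)
  from bchoice[OF this] obtain e where e: "\<And>\<sigma>. \<sigma> \<in> singular_values A \<Longrightarrow> e \<sigma> \<noteq> 0 \<and> gram A *v e \<sigma> = \<sigma>\<^sup>2 *\<^sub>R e \<sigma>"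
    by blast
  have orth: "e \<sigma> \<bullet> e \<tau> = 0" if "\<sigma> \<in> singular_values A" "\<tau> \<in> singular_values A" "\<sigma> \<noteq> \<tau>" for \<sigma> \<tau>
  proof -
    have "\<tau>\<^sup>2 * (e \<sigma> \<bullet> e \<tau>) = \<sigma>\<^sup>2 * (e \<sigma> \<bullet> e \<tau>)"
      using inner_gram[of "e \<sigma>" A "e \<tau>"] inner_gram[of "e \<tau>" A "e \<sigma>"] e[OF that(1)] e[OF that(2)]
      by (simp add: inner_commute)
    moreover have "\<sigma>\<^sup>2 \<noteq> \<tau>\<^sup>2" using that by (auto simp: singular_values_iff power2_eq_iff_nonneg)
    ultimately show ?thesis by auto
  qed
  have inj: "inj_on e (singular_values A)"
  proof (rule inj_onI, rule ccontr)
    fix \<sigma> \<tau> assume h: "\<sigma> \<in> singular_values A" "\<tau> \<in> singular_values A" "e \<sigma> = e \<tau>" "\<sigma> \<noteq> \<tau>"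
    then have "e \<sigma> \<bullet> e \<sigma> = 0" using orth[of \<sigma> \<tau>] by simp
    then show False using e[OF h(1)] by simp
  qed
  have "pairwise orthogonal (e ` singular_values A)"
    unfolding pairwise_def orthogonal_def using orth by auto
  moreover have "0 \<notin> e ` singular_values A" using e by force
  ultimately have "finite (e ` singular_values A)"
    by (intro independent_imp_finite pairwise_orthogonal_independent)
  then show ?thesis using inj by (rule finite_imageD)
qed

lemma sigma_max_le_iff: "0 \<le> c \<Longrightarrow> sigma_max A \<le> c \<longleftrightarrow> (\<forall>x. norm (A *v x) \<le> c * norm x)"
proof -
  assume c: "0 \<le> c"
  obtain s where s: "s \<in> singular_values A" "\<And>x. norm (A *v x) \<le> s * norm x"
    using extremal_singular_values(1)[of A] by blast
  show ?thesis
  proof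
    assume "sigma_max A \<le> c"
    then have "s \<le> c" using Max_ge[OF finite_singular_values s(1)] unfolding sigma_max_def by linarith
    then show "\<forall>x. norm (A *v x) \<le> c * norm x"
      by (intro allI order_trans[OF s(2)] mult_right_mono norm_ge_zero)
  next
    assume b: "\<forall>x. norm (A *v x) \<le> c * norm x"
    have "t \<le> c" if t: "t \<in> singular_values A" for t
    proof -
      obtain x where x: "x \<noteq> 0" "norm (A *v x) = t * norm x" by (rule singular_value_vector[OF t])
      then have "t * norm x \<le> c * norm x" using b[rule_format, of x] by simp
      then show ?thesis using x(1) by simp
    qed
    then show "sigma_max A \<le> c" unfolding sigma_max_def using s(1) finite_singular_values
      by (subst Max_le_iff) auto
  qed
qed

lemma sigma_min_ge_iff: "c \<le> sigma_min A \<longleftrightarrow> (\<forall>x. c * norm x \<le> norm (A *v x))"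
proof -
  obtain s where s: "s \<in> singular_values A" "\<And>x. s * norm x \<le> norm (A *v x)"
    using extremal_singular_values(2)[of A] by blast
  show ?thesis
  proof
    assume "c \<le> sigma_min A"
    then have "c \<le> s" using Min_le[OF finite_singular_values s(1)] unfolding sigma_min_def by linarith
    then show "\<forall>x. c * norm x \<le> norm (A *v x)"
      by (intro allI order_trans[OF _ s(2)] mult_right_mono norm_ge_zero)
  next
    assume b: "\<forall>x. c * norm x \<le> norm (A *v x)"
    have "c \<le> t" if t: "t \<in> singular_values A" for t
    proof -
      obtain x where x: "x \<noteq> 0" "norm (A *v x) = t * norm x" by (rule singular_value_vector[OF t])
      then have "c * norm x \<le> t * norm x" using b[rule_format, of x] by simp
      then show ?thesis using x(1) by simp
    qed
    then show "c \<le> sigma_min A" unfolding sigma_min_def using s(1) finite_singular_values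
      by (subst Min_ge_iff) auto
  qed
qed

lemma sigma_nonneg: "0 \<le> sigma_max A" "0 \<le> sigma_min A"
proof -
  show "0 \<le> sigma_min A" unfolding sigma_min_ge_iff by simp
  obtain s where s: "s \<in> singular_values A" using extremal_singular_values(1)[of A] by blast
  then have "0 \<le> s" "s \<le> sigma_max A" using Max_ge[OF finite_singular_values s]
    by (auto simp: singular_values_def sigma_max_def)
  then show "0 \<le> sigma_max A" by simp
qed

section \<open>Matrix functions on the half-plane\<close>

lemma det_holomorphic:
  fixes B :: "complex \<Rightarrow> complex ^ 'm ^ 'm"
  assumes "\<And>i j. (\<lambda>s. B s $ i $ j) holomorphic_on S"
  shows "(\<lambda>s. det (B s)) holomorphic_on S"
  unfolding det_def by (intro holomorphic_intros assms)

lemma eventually_nonzero: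
  assumes "d holomorphic_on rhp" "s1 \<in> rhp" "d s1 \<noteq> 0" "s \<in> rhp"
  shows "eventually (\<lambda>z. d z \<noteq> 0 \<and> z \<in> rhp) (at s)"
  using non_zero_neighbour_alt[OF assms(1) open_rhp convex_connected[OF convex_rhp] assms(4) assms(2) assms(3)] .

text \<open>The zeros of \<open>d\<close> are isolated, so every point of the half-plane is a limit
  of points where the inequality is known. This is how statements obtained by inverting a matrix
  reach the zeros of its determinant.\<close>

lemma nonneg_by_density:
  fixes \<phi> :: "complex \<Rightarrow> real"
  assumes d: "d holomorphic_on rhp" "s1 \<in> rhp" "d s1 \<noteq> 0" and s: "s \<in> rhp"
    and c: "isCont \<phi> s" and nn: "\<And>z. z \<in> rhp \<Longrightarrow> d z \<noteq> 0 \<Longrightarrow> 0 \<le> \<phi> z"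
  shows "0 \<le> \<phi> s"
proof (rule tendsto_lowerbound)
  show "(\<phi> \<longlongrightarrow> \<phi> s) (at s)" using c by (simp add: isCont_def)
  show "eventually (\<lambda>z. 0 \<le> \<phi> z) (at s)"
    using eventually_nonzero[OF d s] by eventually_elim (auto intro: nn)
qed simp

text \<open>Riemann's theorem on removable singularities: the quotient is meromorphic, and a pole of
  it would contradict the bound at nearby points where \<open>d\<close> does not vanish.\<close>

lemma bounded_quotient_extends:
  assumes p: "p holomorphic_on rhp" and d: "d holomorphic_on rhp" and s1: "s1 \<in> rhp" "d s1 \<noteq> 0"
    and b: "\<And>s. s \<in> rhp \<Longrightarrow> d s \<noteq> 0 \<Longrightarrow> norm (p s / d s) \<le> c"
  shows "\<exists>g. g holomorphic_on rhp \<and> (\<forall>s\<in>rhp. d s \<noteq> 0 \<longrightarrow> g s = p s / d s)"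
proof -
  define f where "f = (\<lambda>s. p s / d s)"
  have an: "f analytic_on {s}" if "s \<in> rhp" "d s \<noteq> 0" for s
    unfolding f_def using that by (intro analytic_intros holomorphic_on_imp_analytic_at[OF p open_rhp] holomorphic_on_imp_analytic_at[OF d open_rhp]) auto
  have mero: "f meromorphic_on rhp"
    unfolding f_def using p d open_rhp
    by (intro meromorphic_intros analytic_on_imp_meromorphic_on) (auto simp: analytic_on_open)
  let ?g = "remove_sings f"
  have eq: "?g s = p s / d s" if "s \<in> rhp" "d s \<noteq> 0" for s
    using remove_sings_at_analytic[OF an[OF that]] by (simp add: f_def)
  have nopole: "\<not> is_pole ?g s" if "s \<in> rhp" for s
  proof
    assume "is_pole ?g s"
    then have "eventually (\<lambda>z. c + 1 \<le> norm (?g z)) (at s)"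
      unfolding is_pole_def by (intro filterlim_at_top[THEN iffD1, rule_format] filterlim_at_infinity_imp_norm_at_top)
    then have "eventually (\<lambda>z. False) (at s)"
      using eventually_nonzero[OF d s1 that]
    proof eventually_elim
      case (elim z)
      then show ?case using b[of z] eq[of z] by auto
    qed
    then show False by simp
  qed
  have "?g analytic_on rhp"
    by (rule nicely_meromorphic_without_singularities[OF remove_sings_nicely_meromorphic[OF mero]]) (use nopole in blast)
  then have "?g holomorphic_on rhp" by (rule analytic_imp_holomorphic)
  with eq show ?thesis by blast
qed

lemma isCont_holomorphic_rhp: "f holomorphic_on rhp \<Longrightarrow> s \<in> rhp \<Longrightarrow> isCont f s"
  using continuous_on_eq_continuous_at[OF open_rhp] holomorphic_on_imp_continuous_on by auto

lemma isCont_matrix_vector: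
  fixes A :: "complex \<Rightarrow> complex ^ 'm ^ 'm" and v :: "complex \<Rightarrow> complex ^ 'm"
  assumes A: "\<And>i j. isCont (\<lambda>s. A s $ i $ j) s" and v: "isCont v s"
  shows "isCont (\<lambda>s. A s *v v s) s"
  unfolding isCont_def
proof (rule vec_tendstoI)
  fix i
  have "((\<lambda>s. A s $ i $ j * v s $ j) \<longlongrightarrow> A s $ i $ j * v s $ j) (at s)" for j
    by (rule tendsto_mult[OF A[unfolded isCont_def] tendsto_vec_nth[OF v[unfolded isCont_def]]])
  then have "((\<lambda>s. \<Sum>j\<in>UNIV. A s $ i $ j * v s $ j) \<longlongrightarrow> (\<Sum>j\<in>UNIV. A s $ i $ j * v s $ j)) (at s)"
    by (rule tendsto_sum)
  then show "((\<lambda>s. (A s *v v s) $ i) \<longlongrightarrow> (A s *v v s) $ i) (at s)"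
    by (simp add: matrix_vector_mult_def)
qed

lemma matrix_inv_right_left:
  fixes A :: "'a::field ^ 'm ^ 'm"
  assumes "det A \<noteq> 0"
  shows "A ** matrix_inv A = mat 1" "matrix_inv A ** A = mat 1"
proof -
  have "\<exists>A'. A ** A' = mat 1 \<and> A' ** A = mat 1"
    using assms unfolding invertible_det_nz[symmetric] invertible_def .
  from someI_ex[OF this] show "A ** matrix_inv A = mat 1" "matrix_inv A ** A = mat 1"
    unfolding matrix_inv_def by blast+
qed

text \<open>The numerator comes from Cramer's rule for the inverse of \<open>B\<close>.\<close>

lemma right_fraction_entry:
  fixes A B :: "complex \<Rightarrow> complex ^ 'm ^ 'm"
  assumes A: "\<And>i j. (\<lambda>s. A s $ i $ j) holomorphic_on rhp"
    and B: "\<And>i j. (\<lambda>s. B s $ i $ j) holomorphic_on rhp"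
  shows "\<exists>p. p holomorphic_on rhp \<and>
     (\<forall>s. det (B s) \<noteq> 0 \<longrightarrow> (A s ** matrix_inv (B s)) $ i $ j = p s / det (B s))"
proof -
  define C where "C = (\<lambda>k s. det (\<chi> a b. if b = k then (axis j 1 :: complex ^ 'm) $ a else B s $ a $ b))"
  have C_hol: "C k holomorphic_on rhp" for k
    unfolding C_def
  proof (rule det_holomorphic, unfold vec_lambda_beta)
    fix a b show "(\<lambda>s. if b = k then (axis j 1 :: complex ^ 'm) $ a else B s $ a $ b) holomorphic_on rhp"
      by (cases "b = k") (simp_all add: B)
  qed
  have "(A s ** matrix_inv (B s)) $ i $ j = (\<Sum>k\<in>UNIV. A s $ i $ k * C k s) / det (B s)" if d: "det (B s) \<noteq> 0" for s
  proof -
    have "B s *v (matrix_inv (B s) *v axis j 1) = axis j 1"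
      by (simp add: matrix_vector_mul_assoc matrix_inv_right_left[OF d])
    then have "matrix_inv (B s) *v axis j 1 = (\<chi> k. C k s / det (B s))"
      unfolding cramer[OF d] C_def .
    moreover have "(matrix_inv (B s) *v axis j 1) $ k = matrix_inv (B s) $ k $ j" for k
      by (simp add: matrix_vector_mult_def axis_def if_distrib cong: if_cong)
    ultimately have "matrix_inv (B s) $ k $ j = C k s / det (B s)" for k
      by (metis vec_lambda_beta)
    then show ?thesis by (simp add: matrix_matrix_mult_def sum_divide_distrib)
  qed
  then show ?thesis
    by (intro exI[of _ "\<lambda>s. \<Sum>k\<in>UNIV. A s $ i $ k * C k s"] conjI holomorphic_intros A C_hol allI impI)
qed

text \<open>Where \<open>det (B s) \<noteq> 0\<close> the multiplier must be
  \<open>A s ** matrix_inv (B s)\<close>. The assumed inequality bounds its entries by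
  \<open>c\<close>, so they extend holomorphically across the zeros of the determinant, and both
  conclusions follow there by continuity.\<close>

lemma holomorphic_matrix_division:
  fixes A B :: "complex \<Rightarrow> complex ^ 'm ^ 'm"
  assumes A: "\<And>i j. (\<lambda>s. A s $ i $ j) holomorphic_on rhp"
    and B: "\<And>i j. (\<lambda>s. B s $ i $ j) holomorphic_on rhp"
    and s1: "s1 \<in> rhp" "det (B s1) \<noteq> 0"
    and b: "\<And>s x. s \<in> rhp \<Longrightarrow> norm (A s *v x) \<le> c * norm (B s *v x)"
  shows "\<exists>S. (\<forall>i j. (\<lambda>s. S s $ i $ j) holomorphic_on rhp) \<and>
     (\<forall>s\<in>rhp. \<forall>x. norm (S s *v x) \<le> c * norm x) \<and> (\<forall>s\<in>rhp. \<forall>x. A s *v x = S s *v (B s *v x))"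
proof -
  let ?d = "\<lambda>s. det (B s)"
  have d: "?d holomorphic_on rhp" by (rule det_holomorphic[OF B])
  let ?Q = "\<lambda>s. A s ** matrix_inv (B s)"
  have Qb: "norm (?Q s *v x) \<le> c * norm x" if "s \<in> rhp" "?d s \<noteq> 0" for s x
  proof -
    have "norm (?Q s *v x) \<le> c * norm (B s *v (matrix_inv (B s) *v x))"
      using b[OF that(1), of "matrix_inv (B s) *v x"] by (simp add: matrix_vector_mul_assoc)
    also have "B s *v (matrix_inv (B s) *v x) = x"
      by (simp add: matrix_vector_mul_assoc matrix_inv_right_left[OF that(2)])
    finally show ?thesis .
  qed
  have entry: "norm (?Q s $ i $ j) \<le> c" if "s \<in> rhp" "?d s \<noteq> 0" for s i j
  proof -
    have "?Q s $ i $ j = (?Q s *v axis j 1) $ i"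
      unfolding matrix_vector_mult_def vec_lambda_beta by (simp add: axis_def if_distrib cong: if_cong)
    then show ?thesis
      using order_trans[OF Finite_Cartesian_Product.norm_nth_le Qb[OF that, of "axis j 1"], of i] by (simp add: norm_axis_1)
  qed
  have ex: "\<exists>g. g holomorphic_on rhp \<and> (\<forall>s\<in>rhp. ?d s \<noteq> 0 \<longrightarrow> g s = ?Q s $ i $ j)" for i j
  proof -
    obtain p where p: "p holomorphic_on rhp" "\<And>s. ?d s \<noteq> 0 \<Longrightarrow> ?Q s $ i $ j = p s / ?d s"
      using right_fraction_entry[of A B i j, OF A B] by blast
    have "norm (p s / ?d s) \<le> c" if "s \<in> rhp" "?d s \<noteq> 0" for s
      using entry[OF that, of i j] p(2)[OF that(2)] by simp
    from bounded_quotient_extends[OF p(1) d s1 this] p(2) show ?thesis by auto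
  qed
  define g where "g = (\<lambda>i j. SOME g. g holomorphic_on rhp \<and> (\<forall>s\<in>rhp. ?d s \<noteq> 0 \<longrightarrow> g s = ?Q s $ i $ j))"
  have g': "g i j holomorphic_on rhp \<and> (\<forall>s\<in>rhp. ?d s \<noteq> 0 \<longrightarrow> g i j s = ?Q s $ i $ j)" for i j
    unfolding g_def by (rule someI_ex[OF ex])
  have g: "g i j holomorphic_on rhp" for i j using g'[of i j] by (rule conjunct1)
  have g2: "g i j s = ?Q s $ i $ j" if "s \<in> rhp" "?d s \<noteq> 0" for i j s
    using g'[of i j] that by blast
  define S where "S = (\<lambda>s. (\<chi> i j. g i j s) :: complex ^ 'm ^ 'm)"
  have S_hol: "(\<lambda>s. S s $ i $ j) holomorphic_on rhp" for i j by (simp add: S_def g)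
  have S_eq: "S s = ?Q s" if "s \<in> rhp" "?d s \<noteq> 0" for s
  proof -
    have "S s $ i $ j = ?Q s $ i $ j" for i j
      unfolding S_def vec_lambda_beta by (rule g2[OF that])
    then show ?thesis unfolding vec_eq_iff by blast
  qed
  have "norm (S s *v x) \<le> c * norm x" if s: "s \<in> rhp" for s x
  proof -
    have cSx: "isCont (\<lambda>s. S s *v x) s" by (rule isCont_matrix_vector[OF isCont_holomorphic_rhp[OF S_hol s] continuous_const])
    have "0 \<le> c * norm x - norm (S s *v x)"
    proof (rule nonneg_by_density[OF d s1 s])
      show "isCont (\<lambda>s. c * norm x - norm (S s *v x)) s"
        by (intro isCont_diff continuous_const isCont_norm cSx)
      show "0 \<le> c * norm x - norm (S z *v x)" if "z \<in> rhp" "?d z \<noteq> 0" for z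
        using Qb[OF that, of x] S_eq[OF that] by simp
    qed
    then show ?thesis by simp
  qed
  moreover have "A s *v x = S s *v (B s *v x)" if s: "s \<in> rhp" for s x
  proof -
    have "0 \<le> - norm (A s *v x - S s *v (B s *v x))"
    proof (rule nonneg_by_density[OF d s1 s])
      show "isCont (\<lambda>s. - norm (A s *v x - S s *v (B s *v x))) s"
        by (intro isCont_diff isCont_minus isCont_norm isCont_matrix_vector[OF isCont_holomorphic_rhp[OF A s] continuous_const] isCont_matrix_vector[OF isCont_holomorphic_rhp[OF S_hol s] isCont_matrix_vector[OF isCont_holomorphic_rhp[OF B s] continuous_const]])
      show "0 \<le> - norm (A z *v x - S z *v (B z *v x))" if "z \<in> rhp" "?d z \<noteq> 0" for z
      proof -
        have "S z *v (B z *v x) = A z *v x"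
          unfolding S_eq[OF that] by (simp add: matrix_vector_mul_assoc matrix_inv_right_left[OF that(2)] flip: matrix_mul_assoc)
        then show ?thesis by simp
      qed
    qed
    then show ?thesis by simp
  qed
  ultimately show ?thesis using S_hol by blast
qed

section \<open>Frequency-domain bounds from truncated energies\<close>

lemma integrable_inverse_square_line:
  shows "integrable lborel (\<lambda>w::real. inverse (1 + (w - w0)\<^sup>2))"
proof -
  have "integrable lborel (\<lambda>w::real. inverse (1 + w\<^sup>2))"
    using integrable_inverse_1_plus_square by (simp add: set_integrable_def)
  from integrable_translate[OF this, of w0] show ?thesis .
qed

text \<open>High powers of the weight concentrate the integral near \<open>w0\<close>, where the weight is largest.\<close>

lemma concentration_nonpos:
  fixes F :: "real \<Rightarrow> real" and a w0 :: real
  assumes a: "1 \<le> a" and F: "F \<in> borel_measurable borel" and cont: "isCont F w0" and bd: "\<And>w. \<bar>F w\<bar> \<le> B"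
    and int: "\<And>k. (LI w. F w * (1 / (a\<^sup>2 + (w - w0)\<^sup>2)) ^ Suc k) \<le> 0"
  shows "F w0 \<le> 0"
proof (rule ccontr)
  assume "\<not> F w0 \<le> 0"
  define c where "c = F w0 / 2"
  have c: "0 < c" using \<open>\<not> F w0 \<le> 0\<close> by (simp add: c_def)
  have B: "0 \<le> B" using order_trans[OF abs_ge_zero bd] .
  have "eventually (\<lambda>w. c < F w) (at w0)"
    using cont c unfolding isCont_def by (intro order_tendstoD(1)) (auto simp: c_def)
  then obtain d where d: "0 < d" "\<And>w. w \<noteq> w0 \<Longrightarrow> dist w w0 < d \<Longrightarrow> c < F w"
    unfolding eventually_at by auto
  have near: "c \<le> F w" if "\<bar>w - w0\<bar> < d" for w
    using d(2)[of w] that c by (cases "w = w0") (auto simp: dist_real_def c_def)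
  define \<phi> where "\<phi> = (\<lambda>w. 1 / (a\<^sup>2 + (w - w0)\<^sup>2))"
  have a2: "0 < a\<^sup>2" "1 \<le> a\<^sup>2" using a by (auto simp: one_le_power)
  have \<phi>pos: "0 < \<phi> w" for w using a2 by (simp add: \<phi>_def add_pos_nonneg)
  have \<phi>m[measurable]: "\<phi> \<in> borel_measurable borel" unfolding \<phi>_def by measurable
  have \<phi>le: "\<phi> w \<le> inverse (1 + (w - w0)\<^sup>2)" for w
    using a2 unfolding \<phi>_def inverse_eq_divide by (intro divide_left_mono) (auto intro!: mult_pos_pos add_pos_nonneg)
  have \<phi>1: "\<phi> w \<le> 1" for w
  proof -
    have "1 \<le> a\<^sup>2 + (w - w0)\<^sup>2" using a2(2) zero_le_power2[of "w - w0"] by linarith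
    then show ?thesis by (simp add: \<phi>_def)
  qed
  have \<phi>i: "integrable lborel \<phi>"
    by (rule integrableL_bound[OF integrable_inverse_square_line[of w0]])
       (use \<phi>pos \<phi>le in \<open>auto intro!: AE_I2 simp: abs_of_pos less_imp_le intro: order_trans[OF _ abs_ge_self]\<close>)
  \<comment> \<open>The weight is at most \<open>\<rho>\<close> at distance \<open>d\<close> or more
    from \<open>w0\<close> and at least \<open>\<rho>'\<close> within distance \<open>d/2\<close>.
    The gap between the two makes the near part win geometrically in \<open>k\<close>.\<close>
  define \<rho> where "\<rho> = 1 / (a\<^sup>2 + d\<^sup>2)"
  define \<rho>' where "\<rho>' = 1 / (a\<^sup>2 + (d/2)\<^sup>2)"
  have \<rho>: "0 < \<rho>" "\<rho> < \<rho>'" "0 < \<rho>'"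
    using a2 d(1) unfolding \<rho>_def \<rho>'_def
    by (auto intro!: divide_strict_left_mono mult_pos_pos add_pos_pos simp: power_divide)
  have far: "\<phi> w \<le> \<rho>" if "d \<le> \<bar>w - w0\<bar>" for w
  proof -
    have "d\<^sup>2 \<le> (w - w0)\<^sup>2" using that d(1) abs_le_square_iff[of d "w - w0"] by simp
    then show ?thesis unfolding \<phi>_def \<rho>_def using a2 by (intro divide_left_mono) (auto intro!: mult_pos_pos add_pos_nonneg)
  qed
  have inside: "\<rho>' \<le> \<phi> w" if "\<bar>w - w0\<bar> < d/2" for w
  proof -
    have "(w - w0)\<^sup>2 \<le> (d/2)\<^sup>2" using that d(1) abs_le_square_iff[of "w - w0" "d/2"] by simp
    then show ?thesis unfolding \<phi>_def \<rho>'_def using a2 by (intro divide_left_mono) (auto intro!: mult_pos_pos add_pos_nonneg)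
  qed
  let ?I = "LI w. \<phi> w"
  have key: "c * \<rho>' * d * \<rho>' ^ k \<le> B * ?I * \<rho> ^ k" for k
  proof -
    let ?A = "{w0 - d/2 <..< w0 + d/2}"
    have iA: "integrable lborel (indicator ?A :: real \<Rightarrow> real)" using d(1) by simp
    \<comment> \<open>In the far region one factor \<open>\<phi> w\<close> is left unestimated to
      keep the bound integrable; at distance between \<open>d/2\<close> and \<open>d\<close>
      nonnegativity of \<open>F\<close> suffices.\<close>
    have pw: "c * \<rho>' ^ Suc k * indicator ?A w - B * \<rho> ^ k * \<phi> w \<le> F w * \<phi> w ^ Suc k" for w
    proof (cases "\<bar>w - w0\<bar> < d")
      case True
      have p: "0 \<le> B * \<rho> ^ k * \<phi> w" using B \<rho>(1) \<phi>pos[of w] by simp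
      have q: "c * \<phi> w ^ Suc k \<le> F w * \<phi> w ^ Suc k" using near[OF True] \<phi>pos[of w] by (intro mult_right_mono) auto
      have r: "c * \<rho>' ^ Suc k * indicator ?A w \<le> c * \<phi> w ^ Suc k"
      proof (cases "w \<in> ?A")
        case True
        then have "\<bar>w - w0\<bar> < d/2" unfolding greaterThanLessThan_iff abs_less_iff by linarith
        from inside[OF this] have "\<rho>' ^ Suc k \<le> \<phi> w ^ Suc k" using \<rho>(3) by (intro power_mono) auto
        then show ?thesis using True c by simp
      next
        case False then show ?thesis using c \<phi>pos[of w] by simp
      qed
      show ?thesis using p q r by linarith
    next
      case False
      then have "w \<notin> ?A" using d(1) by auto
      have "B * \<phi> w ^ Suc k \<le> B * (\<rho> ^ k * \<phi> w)"
        using far[of w] False \<phi>pos[of w] B by (auto intro!: mult_left_mono mult_right_mono power_mono simp: mult.commute)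
      moreover have "- (B * \<phi> w ^ Suc k) \<le> F w * \<phi> w ^ Suc k"
        using bd[of w] \<phi>pos[of w] mult_right_mono[of "- B" "F w" "\<phi> w ^ Suc k"] by (simp add: abs_le_iff)
      ultimately show ?thesis using \<open>w \<notin> ?A\<close> by (simp add: mult.assoc)
    qed
    have iF: "integrable lborel (\<lambda>w. F w * \<phi> w ^ Suc k)"
    proof (rule integrableL_bound[OF integrable_mult_right[OF \<phi>i, of B]])
      show "AE w in lborel. norm (F w * \<phi> w ^ Suc k) \<le> norm (B * \<phi> w)"
      proof (rule AE_I2)
        fix w
        have "\<phi> w ^ Suc k \<le> \<phi> w" using \<phi>pos[of w] \<phi>1[of w] by (simp add: mult_left_le power_le_one)
        then have "\<bar>F w\<bar> * \<phi> w ^ Suc k \<le> B * \<phi> w" using bd[of w] \<phi>pos[of w] B by (intro mult_mono) auto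
        then show "norm (F w * \<phi> w ^ Suc k) \<le> norm (B * \<phi> w)"
          using \<phi>pos[of w] B by (simp add: abs_mult)
      qed
    qed (use F in measurable)
    have "c * \<rho>' ^ Suc k * d - B * \<rho> ^ k * ?I = (LI w. c * \<rho>' ^ Suc k * indicator ?A w - B * \<rho> ^ k * \<phi> w)"
      using iA \<phi>i d(1) by (subst integralL_diff) auto
    also have "\<dots> \<le> (LI w. F w * \<phi> w ^ Suc k)"
      by (intro integral_mono pw iF integrableL_diff integrable_mult_right iA \<phi>i)
    also have "\<dots> \<le> 0" unfolding \<phi>_def by (rule int)
    finally show ?thesis by (simp add: mult_ac)
  qed
  define r where "r = \<rho>' / \<rho>"
  have r: "1 < r" using \<rho> by (simp add: r_def)
  define K where "K = c * \<rho>' * d"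
  have K: "0 < K" using c \<rho> d(1) by (simp add: K_def)
  have "r ^ k \<le> B * ?I / K" for k
  proof -
    have "K * \<rho>' ^ k \<le> B * ?I * \<rho> ^ k" using key[of k] unfolding K_def .
    then show ?thesis using \<rho> K unfolding r_def power_divide by (simp add: field_simps)
  qed
  moreover obtain k where "B * ?I / K < r ^ k" using real_arch_pow[OF r] by blast
  ultimately show False using linorder_not_le by blast
qed

text \<open>This uses \<open>exp (- 2 a t) = \<integral>\<^sub>t\<^sup>\<infinity> 2 a exp (- 2 a \<tau>) d\<tau>\<close>.\<close>

lemma exponential_weight_bound:
  fixes f g :: "real \<Rightarrow> complex ^ 'm"
  assumes f: "sqint f" and g: "sqint g" and a: "0 < a"
    and le: "\<And>\<tau>. 0 < \<tau> \<Longrightarrow> (LI t. (norm (if t \<le> \<tau> then g t else 0))\<^sup>2) \<le> C * (LI t. (norm (if t \<le> \<tau> then f t else 0))\<^sup>2)"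
    and C: "0 \<le> C"
  shows "(LI t. (norm (g t))\<^sup>2 * exp (- (2 * a * t))) \<le> C * (LI t. (norm (f t))\<^sup>2 * exp (- (2 * a * t)))"
proof -
  let ?E = "\<lambda>h \<tau>. LI t. (norm (if t \<le> \<tau> then h t else 0))\<^sup>2"
  \<comment> \<open>The order of integration is exchanged by Tonelli's theorem, hence the
    nonnegative integrals. The factor \<open>indicator {0..} (\<tau> - t)\<close> expresses
    \<open>t \<le> \<tau>\<close>, which turns the tail integral over \<open>\<tau>\<close> into a
    truncation in \<open>t\<close>.\<close>
  have rep: "ennreal (LI t. (norm (h t))\<^sup>2 * exp (- (2 * a * t))) = (\<integral>\<^sup>+\<tau>. ennreal (2 * a * (indicator {0..} \<tau> * exp (- (2 * a * \<tau>))) * ?E h \<tau>) \<partial>lborel)"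
    if h: "sqint h" for h :: "real \<Rightarrow> complex ^ 'm"
  proof -
    note [measurable] = sqint_measurable[OF h]
    note i2 = sqint_weighted(2)[OF h less_imp_le[OF a]]
    have tail: "(\<integral>\<^sup>+\<tau>. ennreal (indicator {0..} (\<tau> - t) * exp (- (2 * a * \<tau>))) \<partial>lborel) = ennreal (exp (- (2 * a * t)) / (2 * a))" for t
      using exponential_halfline_shift[of "2 * a" t] a by (subst nn_integral_eq_integral) auto
    have "ennreal (LI t. (norm (h t))\<^sup>2 * exp (- (2 * a * t))) = (\<integral>\<^sup>+t. ennreal ((norm (h t))\<^sup>2 * exp (- (2 * a * t))) \<partial>lborel)"
      using i2 by (subst nn_integral_eq_integral) auto
    also have "\<dots> = (\<integral>\<^sup>+t. (\<integral>\<^sup>+\<tau>. ennreal ((norm (h t))\<^sup>2 * (2 * a)) * ennreal (indicator {0..} (\<tau> - t) * exp (- (2 * a * \<tau>))) \<partial>lborel) \<partial>lborel)"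
    proof (rule nn_integral_cong)
      fix t :: real
      have "(\<integral>\<^sup>+\<tau>. ennreal ((norm (h t))\<^sup>2 * (2 * a)) * ennreal (indicator {0..} (\<tau> - t) * exp (- (2 * a * \<tau>))) \<partial>lborel)
         = ennreal ((norm (h t))\<^sup>2 * (2 * a)) * ennreal (exp (- (2 * a * t)) / (2 * a))"
        by (subst nn_integral_cmult) (simp_all add: tail)
      also have "\<dots> = ennreal ((norm (h t))\<^sup>2 * exp (- (2 * a * t)))"
        using a by (simp flip: ennreal_mult')
      finally show "ennreal ((norm (h t))\<^sup>2 * exp (- (2 * a * t))) = (\<integral>\<^sup>+\<tau>. ennreal ((norm (h t))\<^sup>2 * (2 * a)) * ennreal (indicator {0..} (\<tau> - t) * exp (- (2 * a * \<tau>))) \<partial>lborel)" by simp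
    qed
    also have "\<dots> = (\<integral>\<^sup>+\<tau>. (\<integral>\<^sup>+t. ennreal ((norm (h t))\<^sup>2 * (2 * a)) * ennreal (indicator {0..} (\<tau> - t) * exp (- (2 * a * \<tau>))) \<partial>lborel) \<partial>lborel)"
      by (rule lborel_pair.Fubini'[symmetric]) measurable
    also have "\<dots> = (\<integral>\<^sup>+\<tau>. ennreal (2 * a * (indicator {0..} \<tau> * exp (- (2 * a * \<tau>))) * ?E h \<tau>) \<partial>lborel)"
    proof (rule nn_integral_cong)
      fix \<tau> :: real
      have sr: "sqint (\<lambda>t. if t \<le> \<tau> then h t else 0)"
        using sqint_restrict[OF h, of "{..\<tau>}"] by simp
      have "(\<integral>\<^sup>+t. ennreal ((norm (h t))\<^sup>2 * (2 * a)) * ennreal (indicator {0..} (\<tau> - t) * exp (- (2 * a * \<tau>))) \<partial>lborel)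
         = (\<integral>\<^sup>+t. ennreal (2 * a * (indicator {0..} \<tau> * exp (- (2 * a * \<tau>)))) * ennreal ((norm (if t \<le> \<tau> then h t else 0))\<^sup>2) \<partial>lborel)"
      proof (rule nn_integral_cong)
        fix t :: real
        have "(norm (h t))\<^sup>2 * (2 * a) * (indicator {0..} (\<tau> - t) * exp (- (2 * a * \<tau>))) =
          2 * a * (indicator {0..} \<tau> * exp (- (2 * a * \<tau>))) * (norm (if t \<le> \<tau> then h t else 0))\<^sup>2"
          using h by (cases "t < 0") (auto simp: sqint_def indicator_def)
        then show "ennreal ((norm (h t))\<^sup>2 * (2 * a)) * ennreal (indicator {0..} (\<tau> - t) * exp (- (2 * a * \<tau>))) =
          ennreal (2 * a * (indicator {0..} \<tau> * exp (- (2 * a * \<tau>)))) * ennreal ((norm (if t \<le> \<tau> then h t else 0))\<^sup>2)"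
          using a by (simp flip: ennreal_mult')
      qed
      also have "\<dots> = ennreal (2 * a * (indicator {0..} \<tau> * exp (- (2 * a * \<tau>)))) * ennreal (?E h \<tau>)"
        using sr by (subst nn_integral_cmult) (auto simp: nn_integral_eq_integral sqint_def)
      also have "\<dots> = ennreal (2 * a * (indicator {0..} \<tau> * exp (- (2 * a * \<tau>))) * ?E h \<tau>)"
        using a by (intro ennreal_mult'[symmetric]) simp
      finally show "(\<integral>\<^sup>+t. ennreal ((norm (h t))\<^sup>2 * (2 * a)) * ennreal (indicator {0..} (\<tau> - t) * exp (- (2 * a * \<tau>))) \<partial>lborel) =
         ennreal (2 * a * (indicator {0..} \<tau> * exp (- (2 * a * \<tau>))) * ?E h \<tau>)" .
    qed
    finally show ?thesis .
  qed
  have Em: "(\<lambda>\<tau>. ?E f \<tau>) \<in> borel_measurable borel"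
  proof -
    note [measurable] = sqint_measurable[OF f]
    show ?thesis by measurable
  qed
  have "ennreal (LI t. (norm (g t))\<^sup>2 * exp (- (2 * a * t))) = (\<integral>\<^sup>+\<tau>. ennreal (2 * a * (indicator {0..} \<tau> * exp (- (2 * a * \<tau>))) * ?E g \<tau>) \<partial>lborel)"
    by (rule rep[OF g])
  also have "\<dots> \<le> (\<integral>\<^sup>+\<tau>. ennreal C * ennreal (2 * a * (indicator {0..} \<tau> * exp (- (2 * a * \<tau>))) * ?E f \<tau>) \<partial>lborel)"
  proof (rule nn_integral_mono_AE)
    \<comment> \<open>The assumed bound concerns \<open>\<tau> > 0\<close>. The weight vanishes for
      negative \<open>\<tau>\<close>, which leaves only the null set {0}.\<close>
    have "AE \<tau> in lborel. \<tau> \<noteq> (0::real)" by (rule AE_lborel_singleton)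
    then show "AE \<tau> in lborel. ennreal (2 * a * (indicator {0..} \<tau> * exp (- (2 * a * \<tau>))) * ?E g \<tau>) \<le>
        ennreal C * ennreal (2 * a * (indicator {0..} \<tau> * exp (- (2 * a * \<tau>))) * ?E f \<tau>)"
    proof eventually_elim
      case (elim \<tau>)
      show ?case
      proof (cases "0 < \<tau>")
        case True
        have "2 * a * (indicator {0..} \<tau> * exp (- (2 * a * \<tau>))) * ?E g \<tau> \<le> 2 * a * (indicator {0..} \<tau> * exp (- (2 * a * \<tau>))) * (C * ?E f \<tau>)"
          using a by (intro mult_left_mono le True) simp
        also have "\<dots> = C * (2 * a * (indicator {0..} \<tau> * exp (- (2 * a * \<tau>))) * ?E f \<tau>)" by (simp only: mult_ac)
        finally show ?thesis using C by (subst ennreal_mult'[symmetric]) (auto intro: ennreal_leI)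
      qed (use elim in \<open>simp add: indicator_def\<close>)
    qed
  qed
  also have "\<dots> = ennreal C * (\<integral>\<^sup>+\<tau>. ennreal (2 * a * (indicator {0..} \<tau> * exp (- (2 * a * \<tau>))) * ?E f \<tau>) \<partial>lborel)"
    by (rule nn_integral_cmult) (use Em in measurable)
  also have "\<dots> = ennreal (C * (LI t. (norm (f t))\<^sup>2 * exp (- (2 * a * t))))"
    unfolding rep[OF f, symmetric] using C by (rule ennreal_mult'[symmetric])
  finally show ?thesis using C by (subst (asm) ennreal_le_iff) auto
qed

section \<open>Bounded multipliers, test functions and delays in \<open>H2\<close>\<close>

lemma Hinf_holomorphic: "F \<in> Hinf \<Longrightarrow> (\<lambda>s. F s $ i $ j) holomorphic_on rhp"
  by (simp add: Hinf_def)

lemma Hinf_vector_bounded: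
  fixes F :: "complex \<Rightarrow> complex ^ 'm ^ 'm"
  assumes "F \<in> Hinf"
  shows "\<exists>K. \<forall>s\<in>rhp. norm (F s *v x) \<le> K"
proof -
  have "linear (\<lambda>A :: complex ^ 'm ^ 'm. A *v x)"
    by (rule linearI) (simp_all add: vec_eq_iff matrix_vector_mult_def sum.distrib scaleR_sum_right algebra_simps)
  then have "bounded_linear (\<lambda>A :: complex ^ 'm ^ 'm. A *v x)" by (simp add: linear_conv_bounded_linear)
  moreover have "bounded (F ` rhp)" using assms by (simp add: Hinf_def)
  ultimately have "bounded ((\<lambda>A. A *v x) ` (F ` rhp))" by (rule bounded_linear_image[rotated])
  then show ?thesis unfolding bounded_iff by auto
qed

text \<open>The summand 1 moves the pole to \<open>\<i> * w0 - 1\<close>, away from the closed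
  half-plane, so the norms on vertical lines stay bounded. On Re s = a the squared modulus of the
  scalar factor is \<open>(1 / ((a + 1)\<^sup>2 + (w - w0)\<^sup>2)) ^ Suc k\<close>, the weight of
  the concentration argument.\<close>

lemma H2_kernel:
  fixes x :: "complex ^ 'm"
  shows "(\<lambda>s. if s \<in> rhp then (1 / (s - \<i> * of_real w0 + 1)) ^ Suc k *s x else 0) \<in> H2"
    (is "?v \<in> H2")
proof -
  have nz: "s - \<i> * of_real w0 + 1 \<noteq> 0" if "s \<in> rhp" for s
    using that by (auto simp: complex_eq_iff rhp_def)
  have hol: "(\<lambda>s. ?v s $ i) holomorphic_on rhp" for i
  proof -
    have "(\<lambda>s. (1 / (s - \<i> * of_real w0 + 1)) ^ Suc k * x $ i) holomorphic_on rhp"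
      by (intro holomorphic_intros nz)
    then show ?thesis by (rule holomorphic_transform) auto
  qed
  let ?b = "\<lambda>w. (norm x)\<^sup>2 * inverse (1 + (w - w0)\<^sup>2)"
  have bd: "(norm (?v (Complex \<sigma> w)))\<^sup>2 \<le> ?b w" if \<sigma>: "0 < \<sigma>" for \<sigma> w
  proof -
    have "(norm (Complex \<sigma> w - \<i> * of_real w0 + 1))\<^sup>2 = (\<sigma> + 1)\<^sup>2 + (w - w0)\<^sup>2"
      by (simp add: cmod_power2)
    moreover have "1 \<le> (\<sigma> + 1)\<^sup>2" using \<sigma> by (simp add: one_le_power)
    ultimately have ge: "1 + (w - w0)\<^sup>2 \<le> (norm (Complex \<sigma> w - \<i> * of_real w0 + 1))\<^sup>2" by simp
    define q where "q = (norm (1 / (Complex \<sigma> w - \<i> * of_real w0 + 1)))\<^sup>2"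
    have q: "0 \<le> q" "q \<le> inverse (1 + (w - w0)\<^sup>2)"
      using ge unfolding q_def norm_divide power_divide inverse_eq_divide by (auto intro!: divide_left_mono mult_pos_pos add_pos_nonneg order_less_le_trans[OF _ ge])
    have "inverse (1 + (w - w0)\<^sup>2) \<le> 1" by (simp add: inverse_le_1_iff)
    then have "q \<le> 1" using q(2) by linarith
    then have "q ^ Suc k \<le> q" using q(1) by (simp add: mult_left_le power_le_one)
    moreover have "(norm (?v (Complex \<sigma> w)))\<^sup>2 = q ^ Suc k * (norm x)\<^sup>2"
      using \<sigma> unfolding q_def power_mult[symmetric] mult.commute[of 2 "Suc k"]
      by (simp add: rhp_def norm_vec_cscale norm_power power_mult_distrib power_mult[symmetric] mult.commute del: power_Suc)
    ultimately have "(norm (?v (Complex \<sigma> w)))\<^sup>2 \<le> inverse (1 + (w - w0)\<^sup>2) * (norm x)\<^sup>2"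
      using q(2) by (simp only:) (intro mult_right_mono order_trans[OF _ q(2)], auto)
    then show ?thesis by (simp only: mult.commute)
  qed
  have fin: "ennreal (1 / (2 * pi)) * (\<integral>\<^sup>+ w. ennreal (?b w) \<partial>lborel) < \<infinity>"
  proof -
    have "integrable lborel ?b" by (intro integrable_mult_right integrable_inverse_square_line)
    then have "(\<integral>\<^sup>+ w. ennreal (?b w) \<partial>lborel) = ennreal (LI w. ?b w)"
      by (intro nn_integral_eq_integral) auto
    then show ?thesis by (simp add: ennreal_mult_less_top)
  qed
  have "(SUP \<sigma>\<in>{0<..}. ennreal (1 / (2 * pi)) * (\<integral>\<^sup>+ w. ennreal ((norm (?v (Complex \<sigma> w)))\<^sup>2) \<partial>lborel)) < \<infinity>"
    by (rule order_le_less_trans[OF SUP_least fin]) (auto intro!: mult_left_mono nn_integral_mono ennreal_leI bd)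
  with hol show ?thesis unfolding H2_def by auto
qed

text \<open>The factor has modulus at most 1 on the half-plane because \<open>h\<close> is
  nonnegative.\<close>

lemma H2_delay:
  assumes v: "v \<in> H2" and h: "0 \<le> h"
  shows "(\<lambda>s. exp (- (s * of_real h)) *s v s) \<in> H2"
proof -
  have le: "norm (exp (- (Complex \<sigma> w * of_real h)) *s v (Complex \<sigma> w)) \<le> norm (v (Complex \<sigma> w))" if "0 < \<sigma>" for \<sigma> w
    using that h by (simp add: norm_vec_cscale mult_right_le_one_le mult_left_le_one_le)
  have "(SUP \<sigma>\<in>{0<..}. ennreal (1 / (2 * pi)) * (\<integral>\<^sup>+ w. ennreal ((norm (exp (- (Complex \<sigma> w * of_real h)) *s v (Complex \<sigma> w)))\<^sup>2) \<partial>lborel))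
     \<le> (SUP \<sigma>\<in>{0<..}. ennreal (1 / (2 * pi)) * (\<integral>\<^sup>+ w. ennreal ((norm (v (Complex \<sigma> w)))\<^sup>2) \<partial>lborel))"
  proof (rule SUP_mono)
    fix \<sigma> :: real assume "\<sigma> \<in> {0<..}"
    then show "\<exists>\<sigma>'\<in>{0<..}. ennreal (1 / (2 * pi)) * (\<integral>\<^sup>+ w. ennreal ((norm (exp (- (Complex \<sigma> w * of_real h)) *s v (Complex \<sigma> w)))\<^sup>2) \<partial>lborel)
        \<le> ennreal (1 / (2 * pi)) * (\<integral>\<^sup>+ w. ennreal ((norm (v (Complex \<sigma>' w)))\<^sup>2) \<partial>lborel)"
      by (intro bexI[of _ \<sigma>] mult_left_mono nn_integral_mono ennreal_leI power_mono le) auto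
  qed
  also have "\<dots> < \<infinity>" using v by (simp add: H2_def)
  finally show ?thesis using v by (auto simp: H2_def intro!: holomorphic_intros)
qed

definition trunc_energy :: "real \<Rightarrow> (real \<Rightarrow> complex ^ 'm) \<Rightarrow> real" where
  "trunc_energy \<tau> f = (LI t. (norm (if t \<le> \<tau> then f t else 0))\<^sup>2)"

text \<open>The test runs over \<open>v\<close> and not over the input, so \<open>A\<close> is never
  inverted. The defect \<open>F\<close>, a difference of squared norms, is bounded and continuous on
  the line through \<open>s0\<close>, and its integrals against the concentrating weights are
  nonpositive. Stating this for an abstract pair \<open>A\<close>, \<open>B\<close> permits the
  exchange of \<open>M\<close> and \<open>N\<close>.\<close>

lemma pointwise_bound_of_truncations:
  fixes A B :: "complex \<Rightarrow> complex ^ 'm ^ 'm"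
  assumes A: "A \<in> Hinf" and B: "B \<in> Hinf" and c: "0 \<le> c"
    and pairs: "\<And>v. v \<in> H2 \<Longrightarrow> \<exists>f g. sqint f \<and> sqint g \<and> (\<forall>s\<in>rhp. Lap f s = A s *v v s) \<and>
        (\<forall>s\<in>rhp. Lap g s = B s *v v s) \<and> (\<forall>\<tau>>0. trunc_energy \<tau> g \<le> c\<^sup>2 * trunc_energy \<tau> f)"
    and s0: "s0 \<in> rhp"
  shows "norm (B s0 *v x) \<le> c * norm (A s0 *v x)"
proof -
  define a where "a = Re s0"
  define w0 where "w0 = Im s0"
  have a: "0 < a" using s0 by (simp add: a_def rhp_def)
  have s0': "Complex a w0 = s0" by (simp add: a_def w0_def)
  let ?s = "\<lambda>w. Complex a w"
  have srhp: "?s w \<in> rhp" for w using a by (simp add: rhp_def)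
  define F where "F = (\<lambda>w. (norm (B (?s w) *v x))\<^sup>2 - c\<^sup>2 * (norm (A (?s w) *v x))\<^sup>2)"
  have contS: "isCont ?s w" for w
  proof -
    have "isCont (\<lambda>w. of_real a + \<i> * of_real w) w" by (intro continuous_intros)
    then show ?thesis by (simp add: Complex_eq)
  qed
  have contC: "isCont (\<lambda>w. C (?s w) *v x) w" if "C \<in> Hinf" for C :: "complex \<Rightarrow> complex ^ 'm ^ 'm" and w
    by (rule isCont_o2[OF contS isCont_matrix_vector[OF isCont_holomorphic_rhp[OF Hinf_holomorphic[OF that] srhp] continuous_const]])
  have contF: "isCont F w" for w
    unfolding F_def by (intro isCont_diff isCont_mult isCont_power isCont_norm continuous_const contC A B)
  obtain KA where KA: "\<And>s. s \<in> rhp \<Longrightarrow> norm (A s *v x) \<le> KA" using Hinf_vector_bounded[OF A] by blast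
  obtain KB where KB: "\<And>s. s \<in> rhp \<Longrightarrow> norm (B s *v x) \<le> KB" using Hinf_vector_bounded[OF B] by blast
  have bdF: "\<bar>F w\<bar> \<le> KB\<^sup>2 + c\<^sup>2 * KA\<^sup>2" for w
  proof -
    have "(norm (B (?s w) *v x))\<^sup>2 \<le> KB\<^sup>2" by (intro power_mono KB srhp) simp
    moreover have "c\<^sup>2 * (norm (A (?s w) *v x))\<^sup>2 \<le> c\<^sup>2 * KA\<^sup>2" by (intro mult_left_mono power_mono KA srhp) auto
    moreover have "0 \<le> c\<^sup>2 * (norm (A (?s w) *v x))\<^sup>2" "0 \<le> (norm (B (?s w) *v x))\<^sup>2" by simp_all
    ultimately show ?thesis unfolding F_def abs_le_iff by linarith
  qed
  have "F w0 \<le> 0"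
  proof (rule concentration_nonpos[where F = F and ?w0.0 = w0 and a = "a + 1" and B = "KB\<^sup>2 + c\<^sup>2 * KA\<^sup>2"])
    show "F \<in> borel_measurable borel"
      by (intro borel_measurable_continuous_onI continuous_at_imp_continuous_on ballI contF)
    fix k
    let ?z = "\<lambda>s. (1 / (s - \<i> * of_real w0 + 1)) ^ Suc k"
    let ?v = "\<lambda>s. if s \<in> rhp then ?z s *s x else 0"
    obtain f g where f: "sqint f" "\<And>s. s \<in> rhp \<Longrightarrow> Lap f s = A s *v ?v s"
      and g: "sqint g" "\<And>s. s \<in> rhp \<Longrightarrow> Lap g s = B s *v ?v s"
      and le: "\<And>\<tau>. 0 < \<tau> \<Longrightarrow> trunc_energy \<tau> g \<le> c\<^sup>2 * trunc_energy \<tau> f"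
      using pairs[OF H2_kernel[of w0 k x]] by blast
    have zn: "(norm (?z (?s w)))\<^sup>2 = (1 / ((a + 1)\<^sup>2 + (w - w0)\<^sup>2)) ^ Suc k" for w
    proof -
      have "(norm (?s w - \<i> * of_real w0 + 1))\<^sup>2 = (a + 1)\<^sup>2 + (w - w0)\<^sup>2" by (simp add: cmod_power2)
      then have "(norm (1 / (?s w - \<i> * of_real w0 + 1)))\<^sup>2 = 1 / ((a + 1)\<^sup>2 + (w - w0)\<^sup>2)"
        by (simp add: norm_divide power_divide)
      then show ?thesis unfolding norm_power power_mult[symmetric] mult.commute[of "Suc k" 2]
        by (simp only: power_mult)
    qed
    have Cn: "(norm (C (?s w) *v ?v (?s w)))\<^sup>2 = (norm (C (?s w) *v x))\<^sup>2 * (1 / ((a + 1)\<^sup>2 + (w - w0)\<^sup>2)) ^ Suc k" for C :: "complex \<Rightarrow> complex ^ 'm ^ 'm" and w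
    proof -
      have "C (?s w) *v ?v (?s w) = ?z (?s w) *s (C (?s w) *v x)"
        using srhp[of w] by (simp add: vector_scalar_commute del: power_Suc)
      then show ?thesis by (simp only: norm_vec_cscale power_mult_distrib zn mult.commute)
    qed
    have gi: "integrable lborel (\<lambda>w. (norm (Lap g (?s w)))\<^sup>2)" and fi: "integrable lborel (\<lambda>w. (norm (Lap f (?s w)))\<^sup>2)"
      using Lap_line_L2(2)[OF g(1) a] Lap_line_L2(2)[OF f(1) a] .
    have "(LI w. F w * (1 / ((a + 1)\<^sup>2 + (w - w0)\<^sup>2)) ^ Suc k) =
       (LI w. (norm (Lap g (?s w)))\<^sup>2 - c\<^sup>2 * (norm (Lap f (?s w)))\<^sup>2)"
      unfolding f(2)[OF srhp] g(2)[OF srhp] Cn F_def by (simp only: left_diff_distrib mult.assoc)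
    also have "\<dots> = (LI w. (norm (Lap g (?s w)))\<^sup>2) - c\<^sup>2 * (LI w. (norm (Lap f (?s w)))\<^sup>2)"
      by (subst integralL_diff[OF gi integrable_mult_right[OF fi]]) (simp only: integral_mult_right_zero)
    also have "\<dots> \<le> 0"
      using exponential_weight_bound[OF f(1) g(1) a, of "c\<^sup>2"] le
      unfolding Lap_line_L2(3)[OF g(1) a] Lap_line_L2(3)[OF f(1) a] trunc_energy_def
      by (simp add: mult.left_commute)
    finally show "(LI w. F w * (1 / ((a + 1)\<^sup>2 + (w - w0)\<^sup>2)) ^ Suc k) \<le> 0" .
  qed (use a contF bdF in auto)
  then have "(norm (B s0 *v x))\<^sup>2 \<le> (c * norm (A s0 *v x))\<^sup>2"
    by (simp add: F_def s0' power_mult_distrib)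
  then show ?thesis by (rule power2_le_imp_le) (simp add: c)
qed

text \<open>Dividing out \<open>A\<close> turns the pair into a single multiplier \<open>S\<close>
  bounded by \<open>c\<close>, to which causality of bounded multipliers applies.\<close>

lemma truncations_of_pointwise_bound:
  fixes A B :: "complex \<Rightarrow> complex ^ 'm ^ 'm"
  assumes A: "A \<in> Hinf" and B: "B \<in> Hinf" and c: "0 \<le> c"
    and s1: "s1 \<in> rhp" "det (A s1) \<noteq> 0"
    and b: "\<And>s x. s \<in> rhp \<Longrightarrow> norm (B s *v x) \<le> c * norm (A s *v x)"
    and f: "sqint f" "\<And>s. s \<in> rhp \<Longrightarrow> Lap f s = A s *v v s"
    and g: "sqint g" "\<And>s. s \<in> rhp \<Longrightarrow> Lap g s = B s *v v s" and \<tau>: "0 < \<tau>"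
  shows "trunc_energy \<tau> g \<le> c\<^sup>2 * trunc_energy \<tau> f"
proof -
  obtain S :: "complex \<Rightarrow> complex ^ 'm ^ 'm" where S: "\<And>i j. (\<lambda>s. S s $ i $ j) holomorphic_on rhp"
     "\<And>s x. s \<in> rhp \<Longrightarrow> norm (S s *v x) \<le> c * norm x" "\<And>s x. s \<in> rhp \<Longrightarrow> B s *v x = S s *v (A s *v x)"
    using holomorphic_matrix_division[OF Hinf_holomorphic[OF B] Hinf_holomorphic[OF A] s1 b] by blast
  show ?thesis unfolding trunc_energy_def
  proof (rule causal_norm_bound[OF S(1,2) c f(1) g(1)])
    show "Lap g s = S s *v Lap f s" if "s \<in> rhp" for s
      using f(2)[OF that] g(2)[OF that] S(3)[OF that] by simp
  qed (use \<tau> in auto)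
qed

section \<open>From truncated energies to gains of truncated operators\<close>

lemma repr_trunc_energy:
  assumes "repr u f"
  shows "(norm (P_trunc \<tau> u))\<^sup>2 = trunc_energy \<tau> f"
  unfolding trunc_energy_def by (rule repr_norm[OF repr_trunc[OF assms]])

lemma norm_trunc_le_iff:
  assumes "repr u f" "repr y g" "0 \<le> c"
  shows "norm (P_trunc \<tau> y) \<le> c * norm (P_trunc \<tau> u) \<longleftrightarrow> trunc_energy \<tau> g \<le> c\<^sup>2 * trunc_energy \<tau> f"
proof -
  have "norm (P_trunc \<tau> y) \<le> c * norm (P_trunc \<tau> u) \<longleftrightarrow> (norm (P_trunc \<tau> y))\<^sup>2 \<le> (c * norm (P_trunc \<tau> u))\<^sup>2"
    using assms(3) by (intro power_mono_iff[symmetric]) auto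
  then show ?thesis by (simp add: power_mult_distrib repr_trunc_energy[OF assms(1)] repr_trunc_energy[OF assms(2)])
qed

lemma P_trunc_zero: "P_trunc \<tau> 0 = 0"
proof -
  have z: "sqint (\<lambda>t. 0)" by (simp add: sqint_def)
  have "repr 0 (\<lambda>t. 0)" using z by (simp add: repr_def zero_L2_def)
  from repr_norm[OF repr_trunc[OF this]] show ?thesis by simp
qed

text \<open>The supremum omits pairs whose truncated input is 0. Causality, applied to such a pair
  and \<open>(0, 0)\<close>, makes the truncated output 0 too, so the inequality on the right holds
  for them as well.\<close>

lemma op_sigma_max_truncation_le_iff:
  assumes G: "(0, 0) \<in> G" and caus: "causal G" and \<tau>: "0 < \<tau>" and c: "0 \<le> c"
  shows "op_sigma_max (truncation \<tau> G) \<le> ennreal c \<longleftrightarrow> (\<forall>(u, y)\<in>G. norm (P_trunc \<tau> y) \<le> c * norm (P_trunc \<tau> u))"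
proof -
  have "op_sigma_max (truncation \<tau> G) \<le> ennreal c \<longleftrightarrow>
     (\<forall>(u, y)\<in>G. P_trunc \<tau> u \<noteq> 0 \<longrightarrow> ennreal (norm (P_trunc \<tau> y) / norm (P_trunc \<tau> u)) \<le> ennreal c)"
    unfolding op_sigma_max_def truncation_def by (fastforce simp: SUP_le_iff)
  also have "\<dots> \<longleftrightarrow> (\<forall>(u, y)\<in>G. norm (P_trunc \<tau> y) \<le> c * norm (P_trunc \<tau> u))"
  proof (intro ball_cong refl, clarify)
    fix u y assume uy: "(u, y) \<in> G"
    show "(P_trunc \<tau> u \<noteq> 0 \<longrightarrow> ennreal (norm (P_trunc \<tau> y) / norm (P_trunc \<tau> u)) \<le> ennreal c) \<longleftrightarrow> norm (P_trunc \<tau> y) \<le> c * norm (P_trunc \<tau> u)"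
    proof (cases "P_trunc \<tau> u = 0")
      case True
      then have "P_trunc \<tau> y = 0" using caus uy G \<tau> P_trunc_zero[where 'a='a] unfolding causal_def by fastforce
      then show ?thesis using True by simp
    next
      case False
      then show ?thesis using c by (simp add: ennreal_le_iff divide_le_eq)
    qed
  qed
  finally show ?thesis .
qed

lemma op_sigma_min_truncation_ge_iff:
  assumes c: "0 \<le> c"
  shows "ennreal c \<le> op_sigma_min (truncation \<tau> G) \<longleftrightarrow> (\<forall>(u, y)\<in>G. c * norm (P_trunc \<tau> u) \<le> norm (P_trunc \<tau> y))"
proof -
  have "ennreal c \<le> op_sigma_min (truncation \<tau> G) \<longleftrightarrow>
     (\<forall>(u, y)\<in>G. P_trunc \<tau> u \<noteq> 0 \<longrightarrow> ennreal c \<le> ennreal (norm (P_trunc \<tau> y) / norm (P_trunc \<tau> u)))"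
    unfolding op_sigma_min_def truncation_def by (fastforce simp: le_INF_iff)
  also have "\<dots> \<longleftrightarrow> (\<forall>(u, y)\<in>G. c * norm (P_trunc \<tau> u) \<le> norm (P_trunc \<tau> y))"
  proof (intro ball_cong refl, clarify)
    fix u y
    show "(P_trunc \<tau> u \<noteq> 0 \<longrightarrow> ennreal c \<le> ennreal (norm (P_trunc \<tau> y) / norm (P_trunc \<tau> u))) \<longleftrightarrow> c * norm (P_trunc \<tau> u) \<le> norm (P_trunc \<tau> y)"
      using c by (cases "P_trunc \<tau> u = 0") (simp_all add: ennreal_le_iff le_divide_eq)
  qed
  finally show ?thesis .
qed

section \<open>The transfer function at regular points\<close>

lemma right_fraction_at_regular:
  fixes T N M :: "complex \<Rightarrow> complex ^ 'm ^ 'm"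
  assumes fr: "is_right_fraction T N M" and s: "s \<in> rhp" "det (M s) \<noteq> 0"
  shows "T s *v (M s *v x) = N s *v x" "N s *v (matrix_inv (M s) *v x) = T s *v x" "M s *v (matrix_inv (M s) *v x) = x"
proof -
  have T: "T s = N s ** matrix_inv (M s)" using fr s by (simp add: is_right_fraction_def)
  note inv = matrix_inv_right_left[OF s(2)]
  show "T s *v (M s *v x) = N s *v x"
    unfolding T by (simp add: matrix_vector_mul_assoc inv flip: matrix_mul_assoc)
  show "N s *v (matrix_inv (M s) *v x) = T s *v x" unfolding T by (simp add: matrix_vector_mul_assoc)
  show "M s *v (matrix_inv (M s) *v x) = x" by (simp add: matrix_vector_mul_assoc inv)
qed

text \<open>Near such a point Cramer's rule writes each entry of \<open>T\<close> as a quotient with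
  nonvanishing denominator, which has a finite limit.\<close>

lemma regular_point_if_det_nonzero:
  fixes T N M :: "complex \<Rightarrow> complex ^ 'm ^ 'm"
  assumes fr: "is_right_fraction T N M" and s: "s \<in> rhp" "det (M s) \<noteq> 0"
  shows "s \<in> regular_points T"
proof -
  have M: "(\<lambda>s. M s $ i $ j) holomorphic_on rhp" and N: "(\<lambda>s. N s $ i $ j) holomorphic_on rhp" for i j
    using fr by (auto simp: is_right_fraction_def Hinf_def)
  have d: "(\<lambda>s. det (M s)) holomorphic_on rhp" by (rule det_holomorphic[OF M])
  have "\<not> is_pole (\<lambda>z. T z $ i $ j) s" for i j
  proof
    assume pole: "is_pole (\<lambda>z. T z $ i $ j) s"
    obtain p where p: "p holomorphic_on rhp" "\<And>s. det (M s) \<noteq> 0 \<Longrightarrow> (N s ** matrix_inv (M s)) $ i $ j = p s / det (M s)"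
      using right_fraction_entry[of N M i j, OF N M] by blast
    have "((\<lambda>z. p z / det (M z)) \<longlongrightarrow> p s / det (M s)) (at s)"
      using isCont_holomorphic_rhp[OF p(1) s(1)] isCont_holomorphic_rhp[OF d s(1)] s(2)
      unfolding isCont_def by (rule tendsto_divide)
    moreover have "eventually (\<lambda>z. p z / det (M z) = T z $ i $ j) (at s)"
      using eventually_nonzero[OF d s s(1)]
    proof eventually_elim
      case (elim z)
      then have "T z = N z ** matrix_inv (M z)" using fr by (auto simp: is_right_fraction_def)
      then show ?case using p(2)[of z] elim by simp
    qed
    ultimately have "((\<lambda>z. T z $ i $ j) \<longlongrightarrow> p s / det (M s)) (at s)"
      by (rule Lim_transform_eventually)
    then show False using pole unfolding is_pole_def
      using not_tendsto_and_filterlim_at_infinity[OF at_neq_bot] by blast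
  qed
  then show ?thesis using s(1) by (simp add: regular_points_def)
qed

text \<open>Here the normal form of the entries enters: away from poles a nicely meromorphic
  function is analytic, so its value agrees with its limit.\<close>

lemma isCont_regular:
  fixes T :: "complex \<Rightarrow> complex ^ 'm ^ 'm"
  assumes T: "\<And>i j. (\<lambda>s. T s $ i $ j) nicely_meromorphic_on rhp" and s: "s \<in> regular_points T"
  shows "isCont (\<lambda>z. T z *v x) s"
proof (rule isCont_matrix_vector[OF _ continuous_const])
  fix i j
  have "(\<lambda>z. T z $ i $ j) analytic_on {s}"
    using s by (intro nicely_meromorphic_on_imp_analytic_at[OF T]) (auto simp: regular_points_def)
  then show "isCont (\<lambda>z. T z $ i $ j) s" by (rule analytic_at_imp_isCont)
qed

text \<open>The sign \<open>\<epsilon> = 1\<close> serves the upper bound and \<open>\<epsilon> = -1\<close> the lower bound.\<close>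

lemma regular_bound_iff:
  fixes T N M :: "complex \<Rightarrow> complex ^ 'm ^ 'm" and \<epsilon> c :: real
  assumes T: "\<And>i j. (\<lambda>s. T s $ i $ j) nicely_meromorphic_on rhp" and fr: "is_right_fraction T N M"
  shows "(\<forall>s\<in>regular_points T. \<forall>x. \<epsilon> * norm (T s *v x) \<le> \<epsilon> * (c * norm x)) \<longleftrightarrow>
     (\<forall>s\<in>rhp. \<forall>x. \<epsilon> * norm (N s *v x) \<le> \<epsilon> * (c * norm (M s *v x)))"
proof -
  have M: "(\<lambda>s. M s $ i $ j) holomorphic_on rhp" and N: "(\<lambda>s. N s $ i $ j) holomorphic_on rhp" for i j
    using fr by (auto simp: is_right_fraction_def Hinf_def)
  have d: "(\<lambda>s. det (M s)) holomorphic_on rhp" by (rule det_holomorphic[OF M])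
  obtain s1 where s1: "s1 \<in> rhp" "det (M s1) \<noteq> 0" using fr by (auto simp: is_right_fraction_def)
  show ?thesis
  proof (intro iffI ballI allI)
    fix s x
    assume b: "\<forall>s\<in>regular_points T. \<forall>x. \<epsilon> * norm (T s *v x) \<le> \<epsilon> * (c * norm x)" and s: "s \<in> rhp"
    have "0 \<le> \<epsilon> * (c * norm (M s *v x)) - \<epsilon> * norm (N s *v x)"
    proof (rule nonneg_by_density[OF d s1 s])
      show "isCont (\<lambda>s. \<epsilon> * (c * norm (M s *v x)) - \<epsilon> * norm (N s *v x)) s"
        by (intro isCont_diff isCont_mult isCont_norm continuous_const
            isCont_matrix_vector[OF isCont_holomorphic_rhp[OF M s] continuous_const]
            isCont_matrix_vector[OF isCont_holomorphic_rhp[OF N s] continuous_const])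
      fix z assume z: "z \<in> rhp" "det (M z) \<noteq> 0"
      from b[rule_format, OF regular_point_if_det_nonzero[OF fr z], of "M z *v x"]
      show "0 \<le> \<epsilon> * (c * norm (M z *v x)) - \<epsilon> * norm (N z *v x)"
        by (simp add: right_fraction_at_regular(1)[OF fr z])
    qed
    then show "\<epsilon> * norm (N s *v x) \<le> \<epsilon> * (c * norm (M s *v x))" by simp
  next
    fix s x
    assume b: "\<forall>s\<in>rhp. \<forall>x. \<epsilon> * norm (N s *v x) \<le> \<epsilon> * (c * norm (M s *v x))" and s: "s \<in> regular_points T"
    have s': "s \<in> rhp" using s by (simp add: regular_points_def)
    \<comment> \<open>A regular point may still be a zero of \<open>det (M s)\<close>, for instance
      through a common factor of \<open>M\<close> and \<open>N\<close>; the bound at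
      \<open>s\<close> is then a limit of bounds at nearby points.\<close>
    have "0 \<le> \<epsilon> * (c * norm x) - \<epsilon> * norm (T s *v x)"
    proof (rule nonneg_by_density[OF d s1 s'])
      show "isCont (\<lambda>s. \<epsilon> * (c * norm x) - \<epsilon> * norm (T s *v x)) s"
        by (intro isCont_diff isCont_mult isCont_norm continuous_const isCont_regular[OF T s])
      fix z assume z: "z \<in> rhp" "det (M z) \<noteq> 0"
      from b[rule_format, OF z(1), of "matrix_inv (M z) *v x"]
      show "0 \<le> \<epsilon> * (c * norm x) - \<epsilon> * norm (T z *v x)"
        by (simp add: right_fraction_at_regular(2,3)[OF fr z])
    qed
    then show "\<epsilon> * norm (T s *v x) \<le> \<epsilon> * (c * norm x)" by simp
  qed
qed

lemma sup_sigma_max_le_iff: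
  fixes T N M :: "complex \<Rightarrow> complex ^ 'm ^ 'm"
  assumes T: "\<And>i j. (\<lambda>s. T s $ i $ j) nicely_meromorphic_on rhp" and fr: "is_right_fraction T N M" and c: "0 \<le> c"
  shows "(SUP s\<in>regular_points T. ennreal (sigma_max (T s))) \<le> ennreal c \<longleftrightarrow>
    (\<forall>s\<in>rhp. \<forall>x. norm (N s *v x) \<le> c * norm (M s *v x))"
  using regular_bound_iff[OF T fr, of 1 c] by (simp add: SUP_le_iff ennreal_le_iff c sigma_max_le_iff)

lemma le_inf_sigma_min_iff:
  fixes T N M :: "complex \<Rightarrow> complex ^ 'm ^ 'm"
  assumes T: "\<And>i j. (\<lambda>s. T s $ i $ j) nicely_meromorphic_on rhp" and fr: "is_right_fraction T N M" and c: "0 \<le> c"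
  shows "ennreal c \<le> (INF s\<in>regular_points T. ennreal (sigma_min (T s))) \<longleftrightarrow>
    (\<forall>s\<in>rhp. \<forall>x. c * norm (M s *v x) \<le> norm (N s *v x))"
  using regular_bound_iff[OF T fr, of "-1" c] by (simp add: le_INF_iff ennreal_le_iff sigma_nonneg sigma_min_ge_iff)

section \<open>Truncations of the operator\<close>

lemma graph_pair:
  assumes h: "hat_graph G = (\<lambda>v. (\<lambda>s. M s *v v s, \<lambda>s. N s *v v s)) ` H2" and uy: "(u, y) \<in> G"
  obtains v f g where "v \<in> H2" "laplace u = (\<lambda>s. M s *v v s)" "laplace y = (\<lambda>s. N s *v v s)"
    "repr u f" "repr y g" "sqint f" "sqint g" "\<forall>s\<in>rhp. Lap f s = M s *v v s" "\<forall>s\<in>rhp. Lap g s = N s *v v s"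
proof -
  have "(laplace u, laplace y) \<in> hat_graph G" using uy unfolding hat_graph_def by force
  then obtain v where v: "v \<in> H2" "laplace u = (\<lambda>s. M s *v v s)" "laplace y = (\<lambda>s. N s *v v s)"
    unfolding h by auto
  obtain f g where r: "repr u f" "repr y g" using repr_exists[of u] repr_exists[of y] by blast
  have L: "\<forall>s\<in>rhp. Lap f s = M s *v v s" "\<forall>s\<in>rhp. Lap g s = N s *v v s"
    using repr_laplace[OF r(1)] repr_laplace[OF r(2)] v(2,3) by (simp_all add: rhp_def)
  have "sqint f" "sqint g" using r by (simp_all add: repr_def)
  from that[OF v r this L] show ?thesis .
qed

lemma graph_pair_of_H2:
  assumes h: "hat_graph G = (\<lambda>v. (\<lambda>s. M s *v v s, \<lambda>s. N s *v v s)) ` H2" and v: "v \<in> H2"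
  obtains u y where "(u, y) \<in> G" "laplace u = (\<lambda>s. M s *v v s)" "laplace y = (\<lambda>s. N s *v v s)"
proof -
  have "(\<lambda>s. M s *v v s, \<lambda>s. N s *v v s) \<in> hat_graph G" unfolding h using v by blast
  then show ?thesis unfolding hat_graph_def by (auto intro: that)
qed

text \<open>The scalar \<open>exp (- (s * d))\<close> commutes with \<open>M s\<close> and
  \<open>N s\<close>, so delaying a pair amounts to delaying \<open>v\<close> in \<open>H2\<close>.
  Injectivity of the Laplace transform identifies the delayed functions with the members of the
  graph.\<close>

lemma graph_delay:
  fixes M N :: "complex \<Rightarrow> complex ^ 'm ^ 'm" and G :: "'m operator"
  assumes h: "hat_graph G = (\<lambda>v. (\<lambda>s. M s *v v s, \<lambda>s. N s *v v s)) ` H2" and uy: "(u, y) \<in> G" and d: "0 \<le> d"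
  shows "\<exists>(u', y')\<in>G. \<forall>\<tau>. norm (P_trunc (\<tau> + d) u') = norm (P_trunc \<tau> u) \<and> norm (P_trunc (\<tau> + d) y') = norm (P_trunc \<tau> y)"
proof -
  obtain v where v: "v \<in> H2" "laplace u = (\<lambda>s. M s *v v s)" "laplace y = (\<lambda>s. N s *v v s)"
    by (rule graph_pair[OF h uy])
  let ?v = "\<lambda>s. exp (- (s * of_real d)) *s v s"
  obtain u' y' where uy': "(u', y') \<in> G" "laplace u' = (\<lambda>s. M s *v ?v s)" "laplace y' = (\<lambda>s. N s *v ?v s)"
    by (rule graph_pair_of_H2[OF h H2_delay[OF v(1) d]])
  obtain u1 where u1: "\<And>s. laplace u1 s = exp (- (s * of_real d)) *s laplace u s" "\<And>\<tau>. norm (P_trunc (\<tau> + d) u1) = norm (P_trunc \<tau> u)"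
    using shift_exists[OF d, of u] by blast
  obtain y1 where y1: "\<And>s. laplace y1 s = exp (- (s * of_real d)) *s laplace y s" "\<And>\<tau>. norm (P_trunc (\<tau> + d) y1) = norm (P_trunc \<tau> y)"
    using shift_exists[OF d, of y] by blast
  have "laplace u1 = laplace u'" unfolding uy'(2) using u1(1) v(2) by (auto simp: vector_scalar_commute)
  moreover have "laplace y1 = laplace y'" unfolding uy'(3) using y1(1) v(3) by (auto simp: vector_scalar_commute)
  ultimately have "u1 = u'" "y1 = y'" using laplace_injective by blast+
  with uy'(1) u1(2) y1(2) show ?thesis by blast
qed

text \<open>Nonsingularity of the denominator is requested only under the pointwise bound, since
  after exchanging \<open>M\<close> and \<open>N\<close> it is a consequence of that bound.\<close>

lemma truncation_bound_iff:
  fixes M N :: "complex \<Rightarrow> complex ^ 'm ^ 'm" and G :: "'m operator"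
  assumes M: "M \<in> Hinf" and N: "N \<in> Hinf"
    and h: "hat_graph G = (\<lambda>v. (\<lambda>s. M s *v v s, \<lambda>s. N s *v v s)) ` H2" and c: "0 \<le> c"
    and inv: "\<forall>s\<in>rhp. \<forall>x. norm (N s *v x) \<le> c * norm (M s *v x) \<Longrightarrow> \<exists>s\<in>rhp. det (M s) \<noteq> 0"
  shows "(\<forall>\<tau>>0. \<forall>(u, y)\<in>G. norm (P_trunc \<tau> y) \<le> c * norm (P_trunc \<tau> u)) \<longleftrightarrow>
     (\<forall>s\<in>rhp. \<forall>x. norm (N s *v x) \<le> c * norm (M s *v x))" (is "?U \<longleftrightarrow> ?B")
proof (intro iffI ballI allI impI)
  fix s x assume U: ?U and s: "s \<in> rhp"
  show "norm (N s *v x) \<le> c * norm (M s *v x)"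
  proof (rule pointwise_bound_of_truncations[OF M N c _ s])
    fix v :: "complex \<Rightarrow> complex ^ 'm" assume "v \<in> H2"
    then obtain u y where uy: "(u, y) \<in> G" "laplace u = (\<lambda>s. M s *v v s)" "laplace y = (\<lambda>s. N s *v v s)"
      by (rule graph_pair_of_H2[OF h])
    obtain f g where r: "repr u f" "repr y g" using repr_exists[of u] repr_exists[of y] by blast
    have "\<forall>s\<in>rhp. Lap f s = M s *v v s" "\<forall>s\<in>rhp. Lap g s = N s *v v s"
      using repr_laplace[OF r(1)] repr_laplace[OF r(2)] uy(2,3) by (simp_all add: rhp_def)
    moreover have "\<forall>\<tau>>0. trunc_energy \<tau> g \<le> c\<^sup>2 * trunc_energy \<tau> f"
      using U uy(1) unfolding norm_trunc_le_iff[OF r c, symmetric] by blast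
    ultimately show "\<exists>f g. sqint f \<and> sqint g \<and> (\<forall>s\<in>rhp. Lap f s = M s *v v s) \<and>
      (\<forall>s\<in>rhp. Lap g s = N s *v v s) \<and> (\<forall>\<tau>>0. trunc_energy \<tau> g \<le> c\<^sup>2 * trunc_energy \<tau> f)"
      using r by (auto simp: repr_def)
  qed
next
  fix \<tau> :: real and p assume B: ?B and \<tau>: "0 < \<tau>" and "p \<in> G"
  obtain s1 where s1: "s1 \<in> rhp" "det (M s1) \<noteq> 0" using inv[OF B] by blast
  obtain u y where p: "p = (u, y)" by force
  obtain v f g where "v \<in> H2" "laplace u = (\<lambda>s. M s *v v s)" "laplace y = (\<lambda>s. N s *v v s)" and r: "repr u f" "repr y g" and q: "sqint f" "sqint g"
    "\<forall>s\<in>rhp. Lap f s = M s *v v s" "\<forall>s\<in>rhp. Lap g s = N s *v v s"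
    by (rule graph_pair[OF h \<open>p \<in> G\<close>[unfolded p]])
  have "trunc_energy \<tau> g \<le> c\<^sup>2 * trunc_energy \<tau> f"
    by (rule truncations_of_pointwise_bound[OF M N c s1 _ q(1) q(3)[rule_format] q(2) q(4)[rule_format] \<tau>]) (use B in auto)
  then show "case p of (u, y) \<Rightarrow> norm (P_trunc \<tau> y) \<le> c * norm (P_trunc \<tau> u)"
    unfolding p prod.case norm_trunc_le_iff[OF r c] .
qed

text \<open>The lower bound is the upper bound for the converse relation, with constant
  \<open>1 / c\<close>; the case \<open>c = 0\<close> is trivial. The converse may fail to be single
  valued, which is why bounds are expressed for pairs in a relation.\<close>

lemma truncation_bounds_iff:
  fixes T N M :: "complex \<Rightarrow> complex ^ 'm ^ 'm" and G :: "'m operator"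
  assumes fr: "is_right_fraction T N M" and h: "hat_graph G = (\<lambda>v. (\<lambda>s. M s *v v s, \<lambda>s. N s *v v s)) ` H2"
    and c: "0 \<le> c"
  shows "(\<forall>\<tau>>0. \<forall>(u, y)\<in>G. norm (P_trunc \<tau> y) \<le> c * norm (P_trunc \<tau> u)) \<longleftrightarrow>
     (\<forall>s\<in>rhp. \<forall>x. norm (N s *v x) \<le> c * norm (M s *v x))"
    and "(\<forall>\<tau>>0. \<forall>(u, y)\<in>G. c * norm (P_trunc \<tau> u) \<le> norm (P_trunc \<tau> y)) \<longleftrightarrow>
     (\<forall>s\<in>rhp. \<forall>x. c * norm (M s *v x) \<le> norm (N s *v x))" (is ?lower)
proof -
  have M: "M \<in> Hinf" and N: "N \<in> Hinf" using fr by (auto simp: is_right_fraction_def)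
  obtain s1 where s1: "s1 \<in> rhp" "det (M s1) \<noteq> 0" using fr by (auto simp: is_right_fraction_def)
  show "(\<forall>\<tau>>0. \<forall>(u, y)\<in>G. norm (P_trunc \<tau> y) \<le> c * norm (P_trunc \<tau> u)) \<longleftrightarrow>
     (\<forall>s\<in>rhp. \<forall>x. norm (N s *v x) \<le> c * norm (M s *v x))"
    by (rule truncation_bound_iff[OF M N h c]) (use s1 in blast)
  show ?lower
  proof (cases "c = 0")
    case False
    then have c': "0 < c" and ci: "0 \<le> 1 / c" using c by auto
    have flip: "c * a \<le> b \<longleftrightarrow> a \<le> 1 / c * b" for a b :: real using c' by (simp add: field_simps)
    have "hat_graph (G\<inverse>) = prod.swap ` hat_graph G"
      unfolding hat_graph_def by force
    then have h': "hat_graph (G\<inverse>) = (\<lambda>v. (\<lambda>s. N s *v v s, \<lambda>s. M s *v v s)) ` H2"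
      unfolding h by (simp add: image_image)
    have "(\<forall>\<tau>>0. \<forall>(y, u)\<in>G\<inverse>. norm (P_trunc \<tau> u) \<le> 1 / c * norm (P_trunc \<tau> y)) \<longleftrightarrow>
       (\<forall>s\<in>rhp. \<forall>x. norm (M s *v x) \<le> 1 / c * norm (N s *v x))"
    proof (rule truncation_bound_iff[OF N M h' ci])
      assume B: "\<forall>s\<in>rhp. \<forall>x. norm (M s *v x) \<le> 1 / c * norm (N s *v x)"
      \<comment> \<open>The reversed bound puts the kernel of \<open>N s1\<close> inside that of the
        invertible matrix \<open>M s1\<close>, so \<open>N s1\<close> is invertible.\<close>
      have "x = 0" if "N s1 *v x = 0" for x
      proof -
        have "M s1 *v x = 0" using B[rule_format, OF s1(1), of x] that by simp
        then have "matrix_inv (M s1) *v (M s1 *v x) = 0" by simp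
        then show "x = 0" by (simp add: matrix_vector_mul_assoc matrix_inv_right_left[OF s1(2)])
      qed
      then have "\<exists>N'. N' ** N s1 = mat 1" unfolding matrix_left_invertible_ker by blast
      then have "det (N s1) \<noteq> 0"
        unfolding invertible_det_nz[symmetric] invertible_def using matrix_left_right_inverse by blast
      with s1(1) show "\<exists>s\<in>rhp. det (N s) \<noteq> 0" by blast
    qed
    then show ?thesis unfolding flip by auto
  qed auto
qed

text \<open>By \<open>mono\<close> the function increases, so it converges to its supremum, which
  \<open>iff\<close> identifies with \<open>L\<close>. Tests against real \<open>c\<close> are
  enough to pin down an element of [0, \<infinity>].\<close>

lemma tendsto_of_upper_bounds:
  fixes f :: "real \<Rightarrow> ennreal"
  assumes iff: "\<And>c. 0 \<le> c \<Longrightarrow> L \<le> ennreal c \<longleftrightarrow> (\<forall>\<tau>>0. f \<tau> \<le> ennreal c)"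
    and mono: "\<And>c \<tau> \<tau>'. 0 \<le> c \<Longrightarrow> 0 < \<tau> \<Longrightarrow> \<tau> \<le> \<tau>' \<Longrightarrow> f \<tau>' \<le> ennreal c \<Longrightarrow> f \<tau> \<le> ennreal c"
  shows "(f \<longlongrightarrow> L) at_top"
proof (rule order_tendstoI)
  fix a assume a: "a < L"
  then obtain c where c: "0 \<le> c" "a = ennreal c" by (cases a) auto
  then obtain \<tau>0 where \<tau>0: "0 < \<tau>0" "\<not> f \<tau>0 \<le> a" using iff[OF c(1)] a by auto
  show "eventually (\<lambda>\<tau>. a < f \<tau>) at_top"
    using eventually_ge_at_top[of \<tau>0]
  proof eventually_elim
    case (elim \<tau>)
    then have "\<not> f \<tau> \<le> a" using mono[OF c(1) \<tau>0(1) elim] \<tau>0(2) c(2) by auto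
    then show ?case by simp
  qed
next
  fix a assume a: "L < a"
  then obtain c where c: "0 \<le> c" "L = ennreal c" by (cases L) auto
  then have "\<forall>\<tau>>0. f \<tau> \<le> L" using iff[OF c(1)] by simp
  then show "eventually (\<lambda>\<tau>. f \<tau> < a) at_top"
    using a by (intro eventually_mono[OF eventually_gt_at_top[of 0]]) (auto intro: order_le_less_trans)
qed

lemma tendsto_of_lower_bounds:
  fixes f :: "real \<Rightarrow> ennreal"
  assumes iff: "\<And>c. 0 \<le> c \<Longrightarrow> ennreal c \<le> L \<longleftrightarrow> (\<forall>\<tau>>0. ennreal c \<le> f \<tau>)"
    and mono: "\<And>c \<tau> \<tau>'. 0 \<le> c \<Longrightarrow> 0 < \<tau> \<Longrightarrow> \<tau> \<le> \<tau>' \<Longrightarrow> ennreal c \<le> f \<tau>' \<Longrightarrow> ennreal c \<le> f \<tau>"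
  shows "(f \<longlongrightarrow> L) at_top"
proof (rule order_tendstoI)
  fix a assume "a < L"
  \<comment> \<open>The intermediate value is finite even if \<open>L\<close> is infinite, so it is
    a legitimate test constant, and it leaves a strict gap above \<open>a\<close>.\<close>
  then obtain b where b: "a < b" "b < L" using dense by blast
  then obtain c where c: "0 \<le> c" "b = ennreal c" by (cases b) auto
  have "ennreal c \<le> L" using b(2) c(2) by simp
  then have "\<forall>\<tau>>0. b \<le> f \<tau>" using iff[OF c(1)] c(2) by simp
  then show "eventually (\<lambda>\<tau>. a < f \<tau>) at_top"
    using b by (intro eventually_mono[OF eventually_gt_at_top[of 0]]) (auto intro: order_less_le_trans)
next
  fix a assume "L < a"
  then obtain b where b: "L < b" "b < a" using dense by blast
  then obtain c where c: "0 \<le> c" "b = ennreal c" by (cases b) auto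
  then obtain \<tau>0 where \<tau>0: "0 < \<tau>0" "\<not> b \<le> f \<tau>0" using iff[OF c(1)] b by auto
  show "eventually (\<lambda>\<tau>. f \<tau> < a) at_top"
    using eventually_ge_at_top[of \<tau>0]
  proof eventually_elim
    case (elim \<tau>)
    then have "\<not> b \<le> f \<tau>" using mono[OF c(1) \<tau>0(1) elim] \<tau>0(2) c(2) by auto
    then show ?case using b(2) by simp
  qed
qed

text \<open>Delaying a pair by \<open>\<tau>' - \<tau>\<close> carries its norms on the window up to
  \<open>\<tau>\<close> to the window up to \<open>\<tau>'\<close>, so whatever holds for all pairs
  on the longer window holds on the shorter one. The relation \<open>R\<close> is arbitrary in order
  to serve upper and lower bounds alike.\<close>

lemma truncation_bound_antimono:
  fixes M N :: "complex \<Rightarrow> complex ^ 'm ^ 'm" and G :: "'m operator"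
  assumes h: "hat_graph G = (\<lambda>v. (\<lambda>s. M s *v v s, \<lambda>s. N s *v v s)) ` H2" and \<tau>: "\<tau> \<le> \<tau>'"
    and R: "\<forall>(u, y)\<in>G. R (norm (P_trunc \<tau>' u)) (norm (P_trunc \<tau>' y))"
  shows "\<forall>(u, y)\<in>G. R (norm (P_trunc \<tau> u)) (norm (P_trunc \<tau> y))"
proof (intro ballI, clarify)
  fix u y assume uy: "(u, y) \<in> G"
  obtain u' y' where uy': "(u', y') \<in> G" "\<And>t. norm (P_trunc (t + (\<tau>' - \<tau>)) u') = norm (P_trunc t u)"
    "\<And>t. norm (P_trunc (t + (\<tau>' - \<tau>)) y') = norm (P_trunc t y)"
    using graph_delay[OF h uy, of "\<tau>' - \<tau>"] \<tau> by auto
  show "R (norm (P_trunc \<tau> u)) (norm (P_trunc \<tau> y))"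
    using R uy'(1) uy'(2,3)[of \<tau>] by auto
qed

theorem theorem4:
  fixes T :: "complex \<Rightarrow> complex ^ 'm ^ 'm" and G :: "'m operator"
  assumes "T \<in> Finf"
    and "is_maximal_operator T G"
    and "causally_extendible G"
  shows "((\<lambda>\<tau>. op_sigma_max (truncation \<tau> G)) \<longlongrightarrow>
            (SUP s\<in>regular_points T. ennreal (sigma_max (T s)))) at_top
       \<and> ((\<lambda>\<tau>. op_sigma_min (truncation \<tau> G)) \<longlongrightarrow>
            (INF s\<in>regular_points T. ennreal (sigma_min (T s)))) at_top"
proof -
  have T: "(\<lambda>s. T s $ i $ j) nicely_meromorphic_on rhp" for i j
    using assms(1) by (simp add: Finf_def)
  obtain N M where fr: "is_right_fraction T N M"
    and h: "hat_graph G = (\<lambda>v. (\<lambda>s. M s *v v s, \<lambda>s. N s *v v s)) ` H2"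
    and lin: "linear_operator G"
    using assms(2) by (auto simp: is_maximal_operator_def operators_of_def)
  have z: "(0, 0) \<in> G" using lin by (simp add: linear_operator_def)
  have caus: "causal G" using assms(3) by (simp add: causally_extendible_def)
  note smax = op_sigma_max_truncation_le_iff[OF z caus]
  show ?thesis
  proof
    show "((\<lambda>\<tau>. op_sigma_max (truncation \<tau> G)) \<longlongrightarrow> (SUP s\<in>regular_points T. ennreal (sigma_max (T s)))) at_top"
    \<comment> \<open>A constant \<open>c\<close> bounds all truncated gains iff it bounds the
      truncated norms on the graph, iff the inequality between \<open>N\<close> and \<open>M\<close>
      holds on the half-plane, iff \<open>c\<close> bounds \<open>sigma_max (T s)\<close> at all
      regular points.\<close>
    proof (rule tendsto_of_upper_bounds)
      fix c :: real assume c: "0 \<le> c"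
      show "(SUP s\<in>regular_points T. ennreal (sigma_max (T s))) \<le> ennreal c \<longleftrightarrow> (\<forall>\<tau>>0. op_sigma_max (truncation \<tau> G) \<le> ennreal c)"
        unfolding sup_sigma_max_le_iff[OF T fr c] truncation_bounds_iff(1)[OF fr h c, symmetric]
        using smax[OF _ c] by blast
      fix \<tau> \<tau>' :: real assume \<tau>: "0 < \<tau>" "\<tau> \<le> \<tau>'" and le: "op_sigma_max (truncation \<tau>' G) \<le> ennreal c"
      show "op_sigma_max (truncation \<tau> G) \<le> ennreal c"
        using le unfolding smax[OF \<tau>(1) c] smax[OF less_le_trans[OF \<tau>] c]
        by (rule truncation_bound_antimono[OF h \<tau>(2), where R = "\<lambda>a b. b \<le> c * a"])
    qed
    show "((\<lambda>\<tau>. op_sigma_min (truncation \<tau> G)) \<longlongrightarrow> (INF s\<in>regular_points T. ennreal (sigma_min (T s)))) at_top"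
    proof (rule tendsto_of_lower_bounds)
      fix c :: real assume c: "0 \<le> c"
      show "ennreal c \<le> (INF s\<in>regular_points T. ennreal (sigma_min (T s))) \<longleftrightarrow> (\<forall>\<tau>>0. ennreal c \<le> op_sigma_min (truncation \<tau> G))"
        unfolding le_inf_sigma_min_iff[OF T fr c] truncation_bounds_iff(2)[OF fr h c, symmetric]
          op_sigma_min_truncation_ge_iff[OF c] ..
      fix \<tau> \<tau>' :: real assume \<tau>: "0 < \<tau>" "\<tau> \<le> \<tau>'" and le: "ennreal c \<le> op_sigma_min (truncation \<tau>' G)"
      show "ennreal c \<le> op_sigma_min (truncation \<tau> G)"
        using le unfolding op_sigma_min_truncation_ge_iff[OF c]
        by (rule truncation_bound_antimono[OF h \<tau>(2), where R = "\<lambda>a b. c * a \<le> b"])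
    qed
  qed
qed

end
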